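(* Let $K$ be a field and let $\mathcal{C}$ be an unmixed uniform admissible clutter with $\operatorname{ht} I(\mathcal{C})=4$. Then the Alexander dual $I(\mathcal{C})^\vee$ of $I(\mathcal{C})$ has linear quotients if and only if $\mathcal{C}$ does not have a bad vertex cover pair, i.e. if and only if there do not exist indices $a,b,c,q,s,t$ such that $\{x_1^a,x_2^b,x_3^c,x_4^q\}$ and $\{x_1^a,x_2^s,x_3^t,x_4^q\}$ are vertex covers of $\mathcal{C}$ while neither $\{x_1^a,x_2^b,x_3^t,x_4^q\}$ nor $\{x_1^a,x_2^s,x_3^c,x_4^q\}$ is a vertex cover of $\mathcal{C}$. In particular, if $\mathcal{C}$ has no bad vertex cover pair, then $\mathcal{C}$ is a Cohen-Macaulay clutter.
   Context: A clutter $\mathcal{C}$ consists of a finite vertex set $V(\mathcal{C})=\{x_1,\dots,x_n\}$ and a family $E(\mathcal{C})$ of nonempty subsets of $V(\mathcal{C})$ (edges), none of which properly contains another. It is uniform if all edges have the same cardinality. Let $K$ be a field, identify the vertices with the variables of a polynomial ring $R$ over $K$, and let $I(\mathcal{C})=\langle \prod_{x\in e}x \mid e\in E(\mathcal{C})\rangle\subset R$ be the edge ideal. $\mathcal{C}$ is Cohen-Macaulay if $R/I(\mathcal{C})$ is a Cohen-Macaulay ring. A vertex cover is a subset $C\subseteq V(\mathcal{C})$ meeting every edge; it is minimal if no proper subset is a vertex cover. $\operatorname{ht} I(\mathcal{C})$ equals the smallest cardinality of a minimal vertex cover. $\mathcal{C}$ is unmixed if all its minimal vertex covers have the same cardinality.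 The Alexander dual of $I(\mathcal{C})$ is $I(\mathcal{C})^\vee=\langle \prod_{x\in C}x \mid C \text{ a minimal vertex cover of }\mathcal{C}\rangle$. Admissible: let $g=\operatorname{ht} I(\mathcal{C})$. Suppose that for some positive integer $d$ there are two partitions $\{X^1,\dots,X^d\}$ and $\{e_1,\dots,e_g\}$ of $V(\mathcal{C})$ with $|e_i\cap X^j|\le 1$ for all $i,j$. A subset $e\subseteq V(\mathcal{C})$ of size $k$ with $|e\cap X^i|\le 1$ for all $i$ is admissible if $e$ meets exactly the classes $X^1,\dots,X^k$ and, writing $j_l$ for the index such that the vertex of $e\cap X^l$ lies in $e_{j_l}$, one has $j_1\le j_2\le\cdots\le j_k$. The clutter $\mathcal{C}$ is admissible if (for some such partitions, which are then fixed) $e_1,\dots,e_g\in E(\mathcal{C})$ and all edges of $\mathcal{C}$ are admissible. If $\mathcal{C}$ is uniform and admissible, then $|e_j|=d$ and $|e_j\cap X^i|=1$ for all $i,j$; $x^i_j$ denotes the unique vertex of $e_j\cap X^i$, for $1\le i\le d$, $1\le j\le g$ (the superscript is an index, not a power). Here $g=4$ and the indices $a,b,c,q,s,t$ range over $\{1,\dots,d\}$. Linear quotients: a monomial ideal $I$ has linear quotients if it has a system of minimal generators $\{u_1,\dots,u_r\}$, ordered with $\deg u_1\le\cdots\le\deg u_r$, such that for all $1\le i\le r-1$ the colon ideal $((u_1,\dots,u_i):u_{i+1})$ is generated by linear forms. *)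

theory Defs
  imports
    "HOL-Algebra.QuotRing"
    "HOL-Algebra.Ring_Divisibility"
    "HOL-Library.Poly_Mapping"
    "HOL-Library.Disjoint_Sets"
    "HOL-Library.Extended_Nat"
begin

section \<open>Commutative algebra\<close>

subsection \<open>Prime chains, dimension, height\<close>

definition prime_chain :: "('a, 'm) ring_scheme \<Rightarrow> nat \<Rightarrow> (nat \<Rightarrow> 'a set) \<Rightarrow> bool" where
  "prime_chain R n Q \<longleftrightarrow> (\<forall>i\<le>n. primeideal (Q i) R) \<and> (\<forall>i<n. Q i \<subset> Q (Suc i))"

definition krull_dim :: "('a, 'm) ring_scheme \<Rightarrow> enat" where
  "krull_dim R = Sup {enat n | n. \<exists>Q. prime_chain R n Q}"

definition prime_height :: "('a, 'm) ring_scheme \<Rightarrow> 'a set \<Rightarrow> enat" where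
  "prime_height R P = Sup {enat n | n. \<exists>Q. prime_chain R n Q \<and> Q n = P}"

definition ideal_height :: "('a, 'm) ring_scheme \<Rightarrow> 'a set \<Rightarrow> enat" where
  "ideal_height R I = Inf {prime_height R P | P. primeideal P R \<and> I \<subseteq> P}"

subsection \<open>Localization\<close>

text \<open>
  The ring of fractions of a commutative ring \<open>R\<close> with respect to a multiplicative
  subset \<open>S\<close>.  The extra factor \<open>u\<close> is needed because \<open>S\<close> may contain zero divisors.
\<close>

definition frac_rel :: "('a, 'm) ring_scheme \<Rightarrow> 'a set \<Rightarrow> (('a \<times> 'a) \<times> ('a \<times> 'a)) set" where
  "frac_rel R S = {((a, s), (b, t)) | a s b t.
     a \<in> carrier R \<and> s \<in> S \<and> b \<in> carrier R \<and> t \<in> S \<and>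
     (\<exists>u\<in>S. u \<otimes>\<^bsub>R\<^esub> (a \<otimes>\<^bsub>R\<^esub> t) = u \<otimes>\<^bsub>R\<^esub> (b \<otimes>\<^bsub>R\<^esub> s))}"

definition frac :: "('a, 'm) ring_scheme \<Rightarrow> 'a set \<Rightarrow> 'a \<Rightarrow> 'a \<Rightarrow> ('a \<times> 'a) set" where
  "frac R S a s = frac_rel R S `` {(a, s)}"

definition localization :: "('a, 'm) ring_scheme \<Rightarrow> 'a set \<Rightarrow> ('a \<times> 'a) set ring" where
  "localization R S = \<lparr>
     carrier = (carrier R \<times> S) // frac_rel R S,
     mult = (\<lambda>X Y. \<Union>(a, s)\<in>X. \<Union>(b, t)\<in>Y. frac R S (a \<otimes>\<^bsub>R\<^esub> b) (s \<otimes>\<^bsub>R\<^esub> t)),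
     one = frac R S \<one>\<^bsub>R\<^esub> \<one>\<^bsub>R\<^esub>,
     zero = frac R S \<zero>\<^bsub>R\<^esub> \<one>\<^bsub>R\<^esub>,
     add = (\<lambda>X Y. \<Union>(a, s)\<in>X. \<Union>(b, t)\<in>Y.
              frac R S (a \<otimes>\<^bsub>R\<^esub> t \<oplus>\<^bsub>R\<^esub> b \<otimes>\<^bsub>R\<^esub> s) (s \<otimes>\<^bsub>R\<^esub> t))\<rparr>"

subsection \<open>Regular sequences and Cohen-Macaulay rings\<close>

definition regular_sequence :: "('a, 'm) ring_scheme \<Rightarrow> 'a list \<Rightarrow> bool" where
  "regular_sequence R xs \<longleftrightarrow>
     set xs \<subseteq> carrier R \<and>
     (\<forall>i<length xs. \<forall>y\<in>carrier R.
        xs ! i \<otimes>\<^bsub>R\<^esub> y \<in> Idl\<^bsub>R\<^esub> (set (take i xs)) \<longrightarrow> y \<in> Idl\<^bsub>R\<^esub> (set (take i xs))) \<and>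
     Idl\<^bsub>R\<^esub> (set xs) \<noteq> carrier R"

text \<open>For a Noetherian local ring with maximal ideal \<open>M\<close>, this is the depth of the ring.\<close>

definition depth :: "('a, 'm) ring_scheme \<Rightarrow> 'a set \<Rightarrow> enat" where
  "depth R M = Sup {enat (length xs) | xs. regular_sequence R xs \<and> set xs \<subseteq> M}"

definition cm_local_ring :: "('a, 'm) ring_scheme \<Rightarrow> bool" where
  "cm_local_ring R \<longleftrightarrow>
     cring R \<and> noetherian_ring R \<and>
     (\<exists>M. {N. maximalideal N R} = {M} \<and> depth R M = krull_dim R)"

definition cohen_macaulay_ring :: "('a, 'm) ring_scheme \<Rightarrow> bool" where
  "cohen_macaulay_ring R \<longleftrightarrow>
     cring R \<and> noetherian_ring R \<and>
     (\<forall>M. maximalideal M R \<longrightarrow> cm_local_ring (localization R (carrier R - M)))"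

subsection \<open>The polynomial ring with variable set \<open>V\<close>\<close>

text \<open>
  A polynomial is a finitely supported map from exponent vectors to coefficients, an exponent
  vector being a finitely supported map from variables to exponents.
\<close>

definition mpoly_ring :: "'k::field itself \<Rightarrow> 'v set \<Rightarrow> (('v \<Rightarrow>\<^sub>0 nat) \<Rightarrow>\<^sub>0 'k) ring" where
  "mpoly_ring _ V = \<lparr>
     carrier = {p. \<forall>m\<in>Poly_Mapping.keys p. Poly_Mapping.keys m \<subseteq> V},
     mult = (*), one = 1, zero = 0, add = (+)\<rparr>"

definition monomial :: "('v \<Rightarrow>\<^sub>0 nat) \<Rightarrow> (('v \<Rightarrow>\<^sub>0 nat) \<Rightarrow>\<^sub>0 'k::field)" where
  "monomial m = Poly_Mapping.single m 1"

definition var :: "'v \<Rightarrow> (('v \<Rightarrow>\<^sub>0 nat) \<Rightarrow>\<^sub>0 'k::field)" where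
  "var x = monomial (Poly_Mapping.single x 1)"

definition mon_degree :: "('v \<Rightarrow>\<^sub>0 nat) \<Rightarrow> nat" where
  "mon_degree m = (\<Sum>x\<in>Poly_Mapping.keys m. Poly_Mapping.lookup m x)"

definition linear_form :: "(('v \<Rightarrow>\<^sub>0 nat) \<Rightarrow>\<^sub>0 'k::field) \<Rightarrow> bool" where
  "linear_form f \<longleftrightarrow> (\<forall>m\<in>Poly_Mapping.keys f. mon_degree m = 1)"

subsection \<open>Linear quotients\<close>

definition colon :: "('a, 'm) ring_scheme \<Rightarrow> 'a set \<Rightarrow> 'a \<Rightarrow> 'a set" where
  "colon R J u = {r \<in> carrier R. r \<otimes>\<^bsub>R\<^esub> u \<in> J}"

text \<open>
  \<open>ms\<close> lists the exponent vectors of the minimal generators, which, for a monomial ideal,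
  are monomials.  With lists indexed from \<open>0\<close>, \<open>us ! i\<close> is the generator \<open>u\<^sub>i\<^sub>+\<^sub>1\<close>
  and \<open>take i us\<close> is \<open>[u\<^sub>1, \<dots>, u\<^sub>i]\<close>.
\<close>

definition has_linear_quotients ::
  "(('v \<Rightarrow>\<^sub>0 nat) \<Rightarrow>\<^sub>0 'k::field) ring \<Rightarrow> (('v \<Rightarrow>\<^sub>0 nat) \<Rightarrow>\<^sub>0 'k) set \<Rightarrow> bool" where
  "has_linear_quotients R I \<longleftrightarrow>
     (\<exists>ms. let us = map monomial ms in
        set us \<subseteq> carrier R \<and> distinct us \<and>
        Idl\<^bsub>R\<^esub> (set us) = I \<and> (\<forall>U. U \<subset> set us \<longrightarrow> Idl\<^bsub>R\<^esub> U \<noteq> I) \<and>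
        sorted (map mon_degree ms) \<and>
        (\<forall>i. 1 \<le> i \<and> i < length us \<longrightarrow>
           (\<exists>L. L \<subseteq> carrier R \<and> (\<forall>f\<in>L. linear_form f) \<and>
                colon R (Idl\<^bsub>R\<^esub> (set (take i us))) (us ! i) = Idl\<^bsub>R\<^esub> L)))"

section \<open>Clutters\<close>

definition clutter :: "'v set \<Rightarrow> 'v set set \<Rightarrow> bool" where
  "clutter V E \<longleftrightarrow>
     finite V \<and> (\<forall>e\<in>E. e \<subseteq> V \<and> e \<noteq> {}) \<and> (\<forall>e\<in>E. \<forall>f\<in>E. \<not> e \<subset> f)"

definition uniform :: "'v set set \<Rightarrow> bool" where
  "uniform E \<longleftrightarrow> (\<exists>k. \<forall>e\<in>E. card e = k)"

definition vertex_cover :: "'v set \<Rightarrow> 'v set set \<Rightarrow> 'v set \<Rightarrow> bool" where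
  "vertex_cover V E C \<longleftrightarrow> C \<subseteq> V \<and> (\<forall>e\<in>E. C \<inter> e \<noteq> {})"

definition minimal_vertex_cover :: "'v set \<Rightarrow> 'v set set \<Rightarrow> 'v set \<Rightarrow> bool" where
  "minimal_vertex_cover V E C \<longleftrightarrow>
     vertex_cover V E C \<and> (\<forall>D. D \<subset> C \<longrightarrow> \<not> vertex_cover V E D)"

definition unmixed :: "'v set \<Rightarrow> 'v set set \<Rightarrow> bool" where
  "unmixed V E \<longleftrightarrow>
     (\<forall>C D. minimal_vertex_cover V E C \<longrightarrow> minimal_vertex_cover V E D \<longrightarrow> card C = card D)"

definition edge_ideal ::
  "'k::field itself \<Rightarrow> 'v set \<Rightarrow> 'v set set \<Rightarrow> (('v \<Rightarrow>\<^sub>0 nat) \<Rightarrow>\<^sub>0 'k) set" where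
  "edge_ideal K V E = Idl\<^bsub>mpoly_ring K V\<^esub> {\<Prod>x\<in>e. var x | e. e \<in> E}"

definition alexander_dual ::
  "'k::field itself \<Rightarrow> 'v set \<Rightarrow> 'v set set \<Rightarrow> (('v \<Rightarrow>\<^sub>0 nat) \<Rightarrow>\<^sub>0 'k) set" where
  "alexander_dual K V E =
     Idl\<^bsub>mpoly_ring K V\<^esub> {\<Prod>x\<in>C. var x | C. minimal_vertex_cover V E C}"

definition cohen_macaulay_clutter :: "'k::field itself \<Rightarrow> 'v set \<Rightarrow> 'v set set \<Rightarrow> bool" where
  "cohen_macaulay_clutter K V E \<longleftrightarrow>
     cohen_macaulay_ring (mpoly_ring K V Quot edge_ideal K V E)"

subsection \<open>Admissible clutters\<close>

text \<open>
  The partitions are \<open>X 1, \<dots>, X d\<close> and \<open>e 1, \<dots>, e g\<close>; values of \<open>X\<close> and \<open>e\<close> at other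
  indices are irrelevant.
\<close>

definition admissible_partitions ::
  "'v set \<Rightarrow> nat \<Rightarrow> nat \<Rightarrow> (nat \<Rightarrow> 'v set) \<Rightarrow> (nat \<Rightarrow> 'v set) \<Rightarrow> bool" where
  "admissible_partitions V d g X e \<longleftrightarrow>
     1 \<le> d \<and>
     partition_on V (X ` {1..d}) \<and> inj_on X {1..d} \<and>
     partition_on V (e ` {1..g}) \<and> inj_on e {1..g} \<and>
     (\<forall>i\<in>{1..g}. \<forall>j\<in>{1..d}. card (e i \<inter> X j) \<le> 1)"

text \<open>
  \<open>j l\<close> is the index of the block of the second partition that contains the vertex
  of \<open>A \<inter> X l\<close>.
\<close>

definition admissible_set ::
  "'v set \<Rightarrow> nat \<Rightarrow> nat \<Rightarrow> (nat \<Rightarrow> 'v set) \<Rightarrow> (nat \<Rightarrow> 'v set) \<Rightarrow> 'v set \<Rightarrow> bool" where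
  "admissible_set V d g X e A \<longleftrightarrow>
     A \<subseteq> V \<and>
     (\<forall>i\<in>{1..d}. card (A \<inter> X i) \<le> 1) \<and>
     {i \<in> {1..d}. A \<inter> X i \<noteq> {}} = {1..card A} \<and>
     (\<exists>j. (\<forall>l\<in>{1..card A}. j l \<in> {1..g} \<and> A \<inter> X l \<subseteq> e (j l)) \<and>
          (\<forall>l m. 1 \<le> l \<and> l \<le> m \<and> m \<le> card A \<longrightarrow> j l \<le> (j m :: nat)))"

definition admissible_clutter ::
  "'v set \<Rightarrow> 'v set set \<Rightarrow> nat \<Rightarrow> nat \<Rightarrow> (nat \<Rightarrow> 'v set) \<Rightarrow> (nat \<Rightarrow> 'v set) \<Rightarrow> bool" where
  "admissible_clutter V E d g X e \<longleftrightarrow>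
     admissible_partitions V d g X e \<and>
     (\<forall>i\<in>{1..g}. e i \<in> E) \<and> (\<forall>A\<in>E. admissible_set V d g X e A)"

text \<open>
  \<open>vert X e i j\<close> is the vertex with superscript \<open>i\<close> and subscript \<open>j\<close>.  It is well defined
  for \<open>1 \<le> i \<le> d\<close>, \<open>1 \<le> j \<le> g\<close> when the admissible clutter is uniform.
\<close>

definition vert :: "(nat \<Rightarrow> 'v set) \<Rightarrow> (nat \<Rightarrow> 'v set) \<Rightarrow> nat \<Rightarrow> nat \<Rightarrow> 'v" where
  "vert X e i j = (THE x. x \<in> e j \<inter> X i)"

definition has_bad_vertex_cover_pair ::
  "'v set \<Rightarrow> 'v set set \<Rightarrow> nat \<Rightarrow> (nat \<Rightarrow> 'v set) \<Rightarrow> (nat \<Rightarrow> 'v set) \<Rightarrow> bool" where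
  "has_bad_vertex_cover_pair V E d X e \<longleftrightarrow>
     (\<exists>a\<in>{1..d}. \<exists>b\<in>{1..d}. \<exists>c\<in>{1..d}. \<exists>q\<in>{1..d}. \<exists>s\<in>{1..d}. \<exists>t\<in>{1..d}.
        vertex_cover V E {vert X e a 1, vert X e b 2, vert X e c 3, vert X e q 4} \<and>
        vertex_cover V E {vert X e a 1, vert X e s 2, vert X e t 3, vert X e q 4} \<and>
        \<not> vertex_cover V E {vert X e a 1, vert X e b 2, vert X e t 3, vert X e q 4} \<and>
        \<not> vertex_cover V E {vert X e a 1, vert X e s 2, vert X e c 3, vert X e q 4})"

end

theory Submission
  imports Defs "HOL-Library.Product_Lexorder"
begin

text \<open>
  Unmixedness forces every minimal vertex cover to meet each of \<open>e 1, \<dots>, e 4\<close> in exactly one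
  vertex, so the generators of the Alexander dual correspond to quadruples \<open>(a, b, c, q)\<close> of
  superscripts, and admissibility implies that covers stay covers when \<open>a\<close> decreases or \<open>q\<close>
  increases. For fixed \<open>a\<close> and \<open>q\<close>, the absence of bad pairs means that the sets
  \<open>{c. (a, b, c, q) is a cover}\<close> are nested, that is, the pairs \<open>(b, c)\<close> form a Ferrers diagram.
  Ordering the covers by increasing \<open>a\<close>, then decreasing \<open>q\<close>, then decreasing row length gives
  linear quotients. Conversely, the later member of a bad pair cannot be exchanged by one vertex
  towards the earlier one.

  The same order is a shelling, and it filters \<open>R / I\<close> by copies of the rings \<open>R / P\<^sub>C\<close>, where
  \<open>P\<^sub>C\<close> is generated by the variables in the cover \<open>C\<close>. Given a maximal ideal \<open>M\<close>, the
  Nullstellensatz provides for each variable \<open>v\<close> a polynomial \<open>q\<^sub>v\<close> in \<open>v\<close> alone that lies in \<open>M\<close>;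
  put \<open>z\<^sub>v = v q\<^sub>v\<close>. As \<open>C\<close> meets each \<open>e j\<close> once, the differences of \<open>z\<^sub>v\<close> and \<open>z\<^sub>w\<close>, where \<open>w\<close> is
  the last vertex in the block of \<open>v\<close>, form a regular sequence of length \<open>n - 4\<close> on every
  \<open>R / P\<^sub>C\<close> at once, hence on \<open>R / I\<close> and its localization at \<open>M\<close>. The dimension is at most
  \<open>n - 4\<close>, because \<open>n - 3\<close> elements of \<open>R / P\<^sub>C\<close> are algebraically dependent, and the depth is at
  most the dimension, because a prime containing a regular element is not minimal.
\<close>

text \<open>Every maximal ideal has to be treated, not only the irrelevant one, and \<open>K\<close>
  is arbitrary, so a variable need not lie in \<open>M\<close> and graded arguments do not apply.
  This dictates \<open>z\<close>: the factor from the Nullstellensatz puts \<open>z v\<close> into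
  \<open>M\<close>, the factor \<open>var v\<close> makes it vanish modulo the variables of a cover
  through \<open>v\<close>, and being monic in \<open>v\<close> alone lets division with remainder
  prove regularity. The combinatorial obstacle sits in the two middle blocks. Along an edge the
  block index grows weakly with the superscript. So the superscripts that an edge uses in block 1
  form an initial segment and those in block 4 a final segment, but those in blocks 2 and 3 merely
  form intervals. Hence \<open>a\<close> and \<open>q\<close> can be moved in one direction at no
  cost, whereas \<open>b\<close> and \<open>c\<close> have no such monotonicity. Their order has to
  be supplied by the lengths of the rows, and it works once the rows are nested.\<close>

abbreviation keys :: "('a \<Rightarrow>\<^sub>0 'b::zero) \<Rightarrow> 'a set" where "keys \<equiv> Poly_Mapping.keys"
abbreviation lookup :: "('a \<Rightarrow>\<^sub>0 'b::zero) \<Rightarrow> 'a \<Rightarrow> 'b" where "lookup \<equiv> Poly_Mapping.lookup"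
abbreviation single :: "'a \<Rightarrow> 'b \<Rightarrow> ('a \<Rightarrow>\<^sub>0 'b::zero)" where "single \<equiv> Poly_Mapping.single"

type_synonym ('v, 'k) mpoly = "('v \<Rightarrow>\<^sub>0 nat) \<Rightarrow>\<^sub>0 'k"

section \<open>Polynomials with variables in \<open>V\<close>\<close>

definition pol :: "'v set \<Rightarrow> ('v, 'k::field) mpoly set" where
  "pol V = {p. \<forall>m\<in>keys p. keys m \<subseteq> V}"

text \<open>Natural exponents cannot cancel, so the support of a product of monomials is exactly a
  union. Divisibility by squarefree monomials thereby becomes inclusion of sets.\<close>

lemma keys_plus_nat: "keys (m + n) = keys m \<union> keys (n :: 'v \<Rightarrow>\<^sub>0 nat)"
  by (auto simp: in_keys_iff lookup_add)

lemma keys_uminus: "keys (- p) = keys (p :: 'a \<Rightarrow>\<^sub>0 'b::ab_group_add)"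
  by (auto simp: in_keys_iff)

lemma pol_0 [simp]: "0 \<in> pol V"
  and pol_1 [simp]: "1 \<in> pol V"
  by (auto simp: pol_def)

lemma pol_add [simp, intro]: "p \<in> pol V \<Longrightarrow> q \<in> pol V \<Longrightarrow> p + q \<in> pol V"
  using keys_add[of p q] by (auto simp: pol_def)

lemma pol_uminus [simp, intro]: "p \<in> pol V \<Longrightarrow> - p \<in> pol V"
  by (auto simp: pol_def keys_uminus)

lemma pol_diff [simp, intro]: "p \<in> pol V \<Longrightarrow> q \<in> pol V \<Longrightarrow> p - q \<in> pol V"
  using pol_add[of p V "- q"] by simp

lemma pol_mult [simp, intro]:
  assumes "p \<in> pol V" "q \<in> pol V"
  shows "p * q \<in> pol V"
  unfolding pol_def
proof (intro CollectI ballI)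
  fix m assume "m \<in> keys (p * q)"
  then obtain a b where "m = a + b" "a \<in> keys p" "b \<in> keys q"
    using keys_mult by blast
  then show "keys m \<subseteq> V" using assms by (auto simp: pol_def keys_plus_nat)
qed

lemma pol_sum [intro]: "(\<And>a. a \<in> A \<Longrightarrow> f a \<in> pol V) \<Longrightarrow> sum f A \<in> pol V"
  by (induction A rule: infinite_finite_induct) auto

lemma pol_prod [intro]: "(\<And>a. a \<in> A \<Longrightarrow> f a \<in> pol V) \<Longrightarrow> prod f A \<in> pol V"
  by (induction A rule: infinite_finite_induct) auto

lemma pol_power [simp, intro]: "p \<in> pol V \<Longrightarrow> p ^ n \<in> pol V"
  by (induction n) auto

lemma pol_single [simp, intro]: "keys m \<subseteq> V \<Longrightarrow> single m a \<in> pol V"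
  by (auto simp: pol_def)

lemma pol_mono: "V \<subseteq> W \<Longrightarrow> pol V \<subseteq> pol W"
  by (auto simp: pol_def)

lemma pol_monomial [simp]: "monomial m \<in> (pol V :: (_ \<Rightarrow>\<^sub>0 'k::field) set) \<longleftrightarrow> keys m \<subseteq> V"
  by (auto simp: monomial_def pol_def)

lemma pol_var [simp]: "var v \<in> (pol V :: (_ \<Rightarrow>\<^sub>0 'k::field) set) \<longleftrightarrow> v \<in> V"
  by (simp add: var_def)

lemma sum_single_keys: "(\<Sum>m\<in>keys f. single m (lookup f m)) = (f :: 'a \<Rightarrow>\<^sub>0 'b::comm_monoid_add)"
proof (rule poly_mapping_eqI)
  fix k
  have "lookup (\<Sum>m\<in>keys f. single m (lookup f m)) k = (\<Sum>m\<in>keys f. if m = k then lookup f m else 0)"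
    by (simp add: lookup_sum lookup_single when_def)
  also have "\<dots> = lookup f k" by (auto simp: in_keys_iff)
  finally show "lookup (\<Sum>m\<in>keys f. single m (lookup f m)) k = lookup f k" .
qed

lemma lookup_single_mult:
  fixes f :: "('v, 'k::field) mpoly"
  shows "lookup (single e a * f) (e + m) = a * lookup f m"
proof -
  have *: "(\<Sum>q. lookup f q when e + m = e + q) = lookup f m"
    by simp
  have "lookup (single e a * f) (e + m)
      = (\<Sum>l. (a * (\<Sum>q. lookup f q when e + m = l + q)) when e = l)"
    by (simp add: lookup_mult lookup_single when_mult)
  then show ?thesis using * by simp
qed

lemma keys_single_mult:
  fixes f :: "('v, 'k::field) mpoly"
  assumes "a \<noteq> 0"
  shows "keys (single e a * f) = (+) e ` keys f"
proof
  show "keys (single e a * f) \<subseteq> (+) e ` keys f"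
    using keys_mult[of "single e a" f] by (auto split: if_splits)
  show "(+) e ` keys f \<subseteq> keys (single e a * f)"
    using assms by (auto simp: in_keys_iff lookup_single_mult)
qed

lemma var_power: "var v ^ n = (single (single v n) 1 :: ('v, 'k::field) mpoly)"
proof (induction n)
  case (Suc n)
  then show ?case
    by (simp add: var_def monomial_def mult_single single_add[symmetric])
qed simp

text \<open>Subtraction of exponents is truncated, hence exact only below this bound. With it,
  divisibility of monomials becomes a decomposition \<open>n = m + h\<close>.\<close>

lemma exp_le_split:
  fixes m n :: "'v \<Rightarrow>\<^sub>0 nat"
  assumes "\<And>v. lookup m v \<le> lookup n v"
  shows "n = m + (n - m)"
  by (rule poly_mapping_eqI) (simp add: lookup_add lookup_minus assms)

section \<open>Ideals\<close>

text \<open>Ideals of \<open>mpoly_ring K V\<close>, expressed with the class operations so that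
  \<open>algebra_simps\<close> applies; \<open>ideal_iff_pideal\<close> connects the two
  views.\<close>

definition pideal :: "'v set \<Rightarrow> ('v, 'k::field) mpoly set \<Rightarrow> bool" where
  "pideal V J \<longleftrightarrow> J \<subseteq> pol V \<and> 0 \<in> J \<and> (\<forall>x\<in>J. \<forall>y\<in>J. x + y \<in> J) \<and> (\<forall>r\<in>pol V. \<forall>x\<in>J. r * x \<in> J)"

lemma pidealD:
  assumes "pideal V J"
  shows "J \<subseteq> pol V" "0 \<in> J" "x \<in> J \<Longrightarrow> y \<in> J \<Longrightarrow> x + y \<in> J"
    "r \<in> pol V \<Longrightarrow> x \<in> J \<Longrightarrow> r * x \<in> J" "x \<in> J \<Longrightarrow> - x \<in> J"
    "x \<in> J \<Longrightarrow> y \<in> J \<Longrightarrow> x - y \<in> J"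
proof -
  show u: "- x \<in> J" if "x \<in> J" for x
    using assms that pol_uminus[OF pol_1] unfolding pideal_def by fastforce
  show "x - y \<in> J" if "x \<in> J" "y \<in> J"
    using assms that u[of y] unfolding pideal_def by fastforce
qed (use assms in \<open>auto simp: pideal_def\<close>)

lemma pideal_sum:
  assumes "pideal V J" "\<And>a. a \<in> A \<Longrightarrow> f a \<in> J"
  shows "sum f A \<in> J"
  using assms(2) by (induction A rule: infinite_finite_induct) (use pidealD[OF assms(1)] in auto)

lemma pideal_pol: "pideal V (pol V)"
  by (auto simp: pideal_def)

text \<open>Adding one multiple of a generator at a time gives an induction principle without
  families of coefficients; \<open>Idl_eq_gen\<close> identifies the result with
  \<open>genideal\<close>.\<close>

inductive_set gen :: "'v set \<Rightarrow> ('v, 'k::field) mpoly set \<Rightarrow> ('v, 'k) mpoly set"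
  for V S where
  gen_0: "0 \<in> gen V S"
| gen_step: "s \<in> S \<Longrightarrow> r \<in> pol V \<Longrightarrow> y \<in> gen V S \<Longrightarrow> r * s + y \<in> gen V S"

lemma gen_add: "x \<in> gen V S \<Longrightarrow> y \<in> gen V S \<Longrightarrow> x + y \<in> gen V S"
  by (induction x rule: gen.induct) (auto simp: add.assoc intro: gen_step)

lemma gen_mult: "x \<in> gen V S \<Longrightarrow> r \<in> pol V \<Longrightarrow> r * x \<in> gen V S"
proof (induction x rule: gen.induct)
  case (gen_step s r' y)
  then have "(r * r') * s + r * y \<in> gen V S" by (intro gen.gen_step) auto
  then show ?case by (simp add: algebra_simps)
qed (auto intro: gen_0)

lemma gen_base: "s \<in> S \<Longrightarrow> s \<in> gen V S"
  using gen_step[of s S 1 V 0] gen_0 by auto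

lemma gen_base_mult: "s \<in> S \<Longrightarrow> r \<in> pol V \<Longrightarrow> r * s \<in> gen V S"
  by (intro gen_mult gen_base)

lemma gen_minimal:
  assumes "pideal V J" "S \<subseteq> J" shows "gen V S \<subseteq> J"
proof
  fix x assume "x \<in> gen V S"
  then show "x \<in> J" by induction (use assms pidealD[OF assms(1)] in auto)
qed

lemma pideal_gen: "S \<subseteq> pol V \<Longrightarrow> pideal V (gen V S)"
  using gen_minimal[OF pideal_pol, of S V] unfolding pideal_def
  by (auto intro: gen_0 gen_add gen_mult)

lemma gen_sub: "S \<subseteq> gen V T \<Longrightarrow> gen V S \<subseteq> gen V T"
proof
  fix x assume "S \<subseteq> gen V T" "x \<in> gen V S"
  from this(2,1) show "x \<in> gen V T"
    by induction (auto intro: gen_0 gen_add gen_mult)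
qed

lemma gen_mono: "S \<subseteq> T \<Longrightarrow> gen V S \<subseteq> gen V T"
  by (intro gen_sub) (auto intro: gen_base)

lemma gen_eqI: "S \<subseteq> gen V T \<Longrightarrow> T \<subseteq> gen V S \<Longrightarrow> gen V S = gen V T"
  by (intro equalityI gen_sub)

lemma gen_pideal: "pideal V J \<Longrightarrow> gen V J = J"
  using gen_minimal[of V J J] by (auto intro: gen_base)

lemma gen_insertD:
  assumes "x \<in> gen V (insert s S)"
  shows "\<exists>r\<in>pol V. \<exists>y\<in>gen V S. x = r * s + y"
  using assms
proof induction
  case gen_0
  then show ?case by (intro bexI[of _ 0]) (auto intro: gen.gen_0)
next
  case (gen_step t q y)
  then obtain r z where rz: "r \<in> pol V" "z \<in> gen V S" "y = r * s + z" by auto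
  show ?case
  proof (cases "t = s")
    case True
    then show ?thesis using rz gen_step by (intro bexI[of _ "q + r"] bexI[of _ z]) (auto simp: algebra_simps)
  next
    case False
    then have "q * t + z \<in> gen V S" using gen_step rz by (intro gen.gen_step) auto
    then show ?thesis using rz by (intro bexI[of _ r] bexI[of _ "q * t + z"]) (auto simp: algebra_simps)
  qed
qed

lemma gen_insert: "gen V (insert s S) = {b + s * a | b a. b \<in> gen V S \<and> a \<in> pol V}"
proof (intro equalityI subsetI)
  fix x assume "x \<in> gen V (insert s S)"
  from gen_insertD[OF this] show "x \<in> {b + s * a | b a. b \<in> gen V S \<and> a \<in> pol V}"
    by (auto simp: algebra_simps)
next
  fix x assume "x \<in> {b + s * a | b a. b \<in> gen V S \<and> a \<in> pol V}"
  then obtain a b where "a \<in> pol V" "b \<in> gen V S" "x = b + s * a" by auto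
  moreover have "b \<in> gen V (insert s S)" using \<open>b \<in> gen V S\<close> gen_mono[of S "insert s S" V] by auto
  moreover have "a * s \<in> gen V (insert s S)" using \<open>a \<in> pol V\<close> by (auto intro: gen_base_mult)
  ultimately show "x \<in> gen V (insert s S)" by (auto intro: gen_add simp: mult.commute)
qed

text \<open>Sums and products create no exponents beyond sums of old ones. This finds a generator
  responsible for a given monomial, even when the generators are not monomials.\<close>

lemma gen_keys:
  assumes "x \<in> gen V S" "m \<in> keys x"
  shows "\<exists>s\<in>S. \<exists>k\<in>keys s. \<exists>h. m = k + h"
  using assms
proof (induction arbitrary: m)
  case (gen_step s r y)
  have "m \<in> keys (r * s) \<or> m \<in> keys y" using subsetD[OF keys_add gen_step.prems] by simp
  then show ?case
  proof
    assume "m \<in> keys (r * s)"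
    from subsetD[OF keys_mult this]
    obtain a b where "a \<in> keys r" "b \<in> keys s" "m = a + b" by auto
    then have "m = b + a" by (simp add: add.commute)
    then show ?thesis using \<open>s \<in> S\<close> \<open>b \<in> keys s\<close> by blast
  next
    assume "m \<in> keys y"
    then show ?thesis by (rule gen_step.IH)
  qed
qed simp

lemma pideal_singles:
  assumes "pideal V J" "\<And>m. m \<in> keys f \<Longrightarrow> monomial m \<in> J"
  shows "f \<in> J"
proof -
  have "single m (lookup f m) \<in> J" if "m \<in> keys f" for m
  proof -
    have "single 0 (lookup f m) * monomial m \<in> J"
      using assms that by (intro pidealD(4)[OF assms(1)]) auto
    then show ?thesis by (simp add: monomial_def mult_single)
  qed
  then have "(\<Sum>m\<in>keys f. single m (lookup f m)) \<in> J" by (intro pideal_sum[OF assms(1)])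
  then show ?thesis by (simp add: sum_single_keys)
qed

lemma gen_monomials:
  assumes "\<And>g. g \<in> G \<Longrightarrow> keys g \<subseteq> V"
  shows "gen V (monomial ` G) = {f \<in> pol V. \<forall>m\<in>keys f. \<exists>g\<in>G. \<exists>h. m = g + h}"
proof (intro equalityI subsetI)
  have sub: "monomial ` G \<subseteq> pol V" using assms by auto
  note pi = pideal_gen[OF sub]
  {
    fix f assume f: "f \<in> gen V (monomial ` G)"
    have "\<exists>g\<in>G. \<exists>h. m = g + h" if "m \<in> keys f" for m
      using gen_keys[OF f that] by (auto simp: monomial_def)
    then show "f \<in> {f \<in> pol V. \<forall>m\<in>keys f. \<exists>g\<in>G. \<exists>h. m = g + h}"
      using f pidealD(1)[OF pi] by auto
  }
  fix f assume f: "f \<in> {f \<in> pol V. \<forall>m\<in>keys f. \<exists>g\<in>G. \<exists>h. m = g + h}"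
  show "f \<in> gen V (monomial ` G)"
  proof (rule pideal_singles[OF pi])
    fix m assume m: "m \<in> keys f"
    then obtain g h where gh: "g \<in> G" "m = g + h" using f by auto
    have "keys m \<subseteq> V" using f m by (auto simp: pol_def)
    then have "keys h \<subseteq> V" using gh by (auto simp: keys_plus_nat)
    then have "monomial h * monomial g \<in> gen V (monomial ` G)"
      using gh by (intro gen_base_mult) auto
    then show "monomial m \<in> gen V (monomial ` G)"
      using gh by (simp add: monomial_def mult_single add.commute)
  qed
qed

section \<open>Comparison with the ring \<open>mpoly_ring\<close>\<close>

lemma mpoly_ring_simps [simp]:
  "carrier (mpoly_ring K V) = pol V" "mult (mpoly_ring K V) = (*)"
  "one (mpoly_ring K V) = 1" "zero (mpoly_ring K V) = 0" "add (mpoly_ring K V) = (+)"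
  by (simp_all add: mpoly_ring_def pol_def)

lemma mpoly_cring: "cring (mpoly_ring (K :: 'k::field itself) V)"
proof (rule cringI)
  show "abelian_group (mpoly_ring K V)"
  proof (rule abelian_groupI)
    fix x assume "x \<in> carrier (mpoly_ring K V)"
    then show "\<exists>y\<in>carrier (mpoly_ring K V). y \<oplus>\<^bsub>mpoly_ring K V\<^esub> x = \<zero>\<^bsub>mpoly_ring K V\<^esub>"
      by (intro bexI[of _ "- x"]) auto
  qed (auto simp: algebra_simps)
  show "comm_monoid (mpoly_ring K V)"
    by (rule comm_monoidI) (auto simp: algebra_simps)
qed (auto simp: algebra_simps)

lemma mpoly_a_inv:
  assumes "x \<in> pol V"
  shows "\<ominus>\<^bsub>mpoly_ring K V\<^esub> x = - x"
proof -
  interpret cring "mpoly_ring K V" by (rule mpoly_cring)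
  show ?thesis using assms minus_equality[of "- x" x] by auto
qed

lemma ideal_iff_pideal: "ideal J (mpoly_ring K V) \<longleftrightarrow> pideal V J"
proof
  interpret cring "mpoly_ring K V" by (rule mpoly_cring)
  assume "ideal J (mpoly_ring K V)"
  then interpret ideal J "mpoly_ring K V" .
  show "pideal V J"
    unfolding pideal_def
    using a_subset zero_closed a_closed I_l_closed by auto
next
  interpret cring "mpoly_ring K V" by (rule mpoly_cring)
  assume J: "pideal V J"
  note D = pidealD[OF J]
  show "ideal J (mpoly_ring K V)"
  proof (rule idealI)
    show "subgroup J (add_monoid (mpoly_ring K V))"
      using D mpoly_a_inv[of _ V K, unfolded a_inv_def]
      by (intro subgroup.intro) (auto simp: subset_iff)
    show "a \<otimes>\<^bsub>mpoly_ring K V\<^esub> x \<in> J" if "a \<in> J" "x \<in> carrier (mpoly_ring K V)" for a x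
      using D(4)[of x a] that by (simp add: mult.commute)
  qed (use D ring_axioms in auto)
qed

lemma Idl_eq_gen:
  assumes "S \<subseteq> pol V" shows "Idl\<^bsub>mpoly_ring K V\<^esub> S = gen V S"
proof -
  interpret cring "mpoly_ring K V" by (rule mpoly_cring)
  show ?thesis
  proof
    show "Idl\<^bsub>mpoly_ring K V\<^esub> S \<subseteq> gen V S"
      using assms pideal_gen[OF assms] by (intro genideal_minimal) (auto simp: ideal_iff_pideal intro: gen_base)
    show "gen V S \<subseteq> Idl\<^bsub>mpoly_ring K V\<^esub> S"
      using assms genideal_ideal[of S] genideal_self[of S]
      by (intro gen_minimal) (auto simp: ideal_iff_pideal)
  qed
qed

section \<open>Degree in one variable\<close>

text \<open>The bound is strict so that bound 0 singles out the zero polynomial and a remainder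
  modulo a polynomial of degree \<open>D\<close> lies in \<open>lowdeg w D\<close>.\<close>

definition lowdeg :: "'v \<Rightarrow> nat \<Rightarrow> ('v, 'k::field) mpoly set" where
  "lowdeg w D = {f. \<forall>m\<in>keys f. lookup m w < D}"

lemma lowdeg_zero [simp]: "0 \<in> lowdeg w D"
  by (simp add: lowdeg_def)

lemma lowdeg_add: "f \<in> lowdeg w D \<Longrightarrow> g \<in> lowdeg w D \<Longrightarrow> f + g \<in> lowdeg w D"
  using keys_add[of f g] by (auto simp: lowdeg_def)

lemma lowdeg_uminus: "f \<in> lowdeg w D \<Longrightarrow> - f \<in> lowdeg w D"
  by (simp add: lowdeg_def keys_uminus)

lemma lowdeg_diff: "f \<in> lowdeg w D \<Longrightarrow> g \<in> lowdeg w D \<Longrightarrow> f - g \<in> lowdeg w D"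
  using lowdeg_add[of f w D "- g"] lowdeg_uminus[of g w D] by simp

lemma lowdeg_mono: "f \<in> lowdeg w D \<Longrightarrow> D \<le> D' \<Longrightarrow> f \<in> lowdeg w D'"
  by (auto simp: lowdeg_def)

text \<open>The first factor has degree at most \<open>a\<close>, the second less than
  \<open>b\<close>; these unequal bounds keep the strict inequality sharp.\<close>

lemma lowdeg_mult:
  assumes "f \<in> lowdeg w (Suc a)" "g \<in> lowdeg w b"
  shows "f * g \<in> lowdeg w (a + b)"
  unfolding lowdeg_def
proof (intro CollectI ballI)
  fix m assume "m \<in> keys (f * g)"
  from subsetD[OF keys_mult this] obtain p q where "p \<in> keys f" "q \<in> keys g" "m = p + q"
    by auto
  then have "lookup p w < Suc a" "lookup q w < b" using assms by (auto simp: lowdeg_def)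
  then show "lookup m w < a + b" using \<open>m = p + q\<close> by (simp add: lookup_add)
qed

lemma pol_minus_lowdeg:
  assumes "f \<in> pol (V - {w})"
  shows "f \<in> lowdeg w (Suc 0)"
proof -
  have "lookup m w = 0" if "m \<in> keys f" for m
  proof -
    have "w \<notin> keys m" using assms that unfolding pol_def by blast
    then show ?thesis by (simp add: in_keys_iff)
  qed
  then show ?thesis by (simp add: lowdeg_def)
qed

lemma pol_minus_mult_lowdeg:
  assumes "f \<in> pol (V - {w})" "g \<in> lowdeg w D"
  shows "f * g \<in> lowdeg w D"
  using lowdeg_mult[OF pol_minus_lowdeg[OF assms(1)] assms(2)] by simp

lemma var_power_lowdeg:
  fixes h :: "('v, 'k::field) mpoly"
  assumes "h \<in> pol (V - {w})"
  shows "var w ^ N * h \<in> lowdeg w (Suc N)"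
proof -
  have "(var w ^ N :: (_ \<Rightarrow>\<^sub>0 'k)) \<in> lowdeg w (Suc N)"
    by (simp add: var_power lowdeg_def)
  from lowdeg_mult[OF this pol_minus_lowdeg[OF assms]] show ?thesis by simp
qed

text \<open>The power raises every exponent of \<open>w\<close> to at least \<open>N\<close>, so
  only the zero polynomial escapes. This is how a leading coefficient is shown to vanish.\<close>

lemma var_power_mult_lowdeg_zero:
  fixes h :: "('v, 'k::field) mpoly"
  assumes "var w ^ N * h \<in> lowdeg w N"
  shows "h = 0"
proof (rule ccontr)
  assume "h \<noteq> 0"
  then obtain m where "m \<in> keys h" by (metis all_not_in_conv poly_mapping_eqI in_keys_iff lookup_zero)
  then have "single w N + m \<in> keys (var w ^ N * h)"
    by (simp add: var_power keys_single_mult)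
  then have "lookup (single w N + m) w < N" using assms unfolding lowdeg_def by blast
  then show False by (simp add: lookup_add)
qed

lemma keys_nonempty: "f \<noteq> 0 \<Longrightarrow> keys f \<noteq> {}"
  by (metis all_not_in_conv poly_mapping_eqI in_keys_iff lookup_zero)

text \<open>An additive induction that visits only monomials in the support of \<open>f\<close>, so
  that degree and support conditions on \<open>f\<close> are available for them.\<close>

lemma singles_induct:
  fixes f :: "'a \<Rightarrow>\<^sub>0 'b::comm_monoid_add"
  assumes "P 0" "\<And>p q. P p \<Longrightarrow> P q \<Longrightarrow> P (p + q)" "\<And>m a. m \<in> keys f \<Longrightarrow> P (single m a)"
  shows "P f"
proof -
  have "P (\<Sum>m\<in>A. single m (lookup f m))" if "finite A" "A \<subseteq> keys f" for A
    using that by (induction A rule: finite_induct) (use assms in auto)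
  from this[of "keys f"] show ?thesis
    by (simp add: sum_single_keys)
qed


lemma lowdeg_exists: "\<exists>N. f \<in> lowdeg w N"
proof
  show "f \<in> lowdeg w (Suc (Max (insert 0 ((\<lambda>m. lookup m w) ` keys f))))"
    unfolding lowdeg_def by (auto simp: less_Suc_eq_le intro: Max_ge)
qed

lemma split_top:
  fixes f :: "('v, 'k::field) mpoly"
  assumes "f \<in> pol V" "f \<in> lowdeg w (Suc N)"
  shows "\<exists>h\<in>pol (V - {w}). \<exists>r\<in>pol V \<inter> lowdeg w N. f = var w ^ N * h + r"
proof (rule singles_induct[of _ f])
  let ?P = "\<lambda>f. \<exists>h\<in>pol (V - {w}). \<exists>r\<in>pol V \<inter> lowdeg w N. f = var w ^ N * h + r"
  show "?P 0" by (intro bexI[of _ 0]) auto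
  show "?P (p + q)" if pq: "?P p" "?P q" for p q
  proof -
    from pq obtain h r h' r' where "h \<in> pol (V - {w})" "r \<in> pol V \<inter> lowdeg w N" "p = var w ^ N * h + r"
      "h' \<in> pol (V - {w})" "r' \<in> pol V \<inter> lowdeg w N" "q = var w ^ N * h' + r'" by metis
    then show ?thesis
      by (intro bexI[of _ "h + h'"] bexI[of _ "r + r'"]) (auto simp: algebra_simps intro: lowdeg_add)
  qed
  fix m a assume m: "m \<in> keys f"
  then have mV: "keys m \<subseteq> V" and mw: "lookup m w \<le> N" using assms by (auto simp: pol_def lowdeg_def)
  show "?P (single m a)"
  proof (cases "lookup m w = N")
    case True
    have "m = single w N + (m - single w N)"
      by (rule exp_le_split) (auto simp: lookup_single when_def True)
    then have "single m a = var w ^ N * single (m - single w N) a"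
      by (simp add: var_power mult_single)
    moreover have "keys (m - single w N) \<subseteq> V - {w}"
      using mV True by (auto simp: in_keys_iff lookup_minus lookup_single when_def split: if_splits)
    ultimately show ?thesis
      by (intro bexI[of _ "single (m - single w N) a"] bexI[of _ 0]) auto
  next
    case False
    then have "single m a \<in> lowdeg w N" using mw by (auto simp: lowdeg_def)
    then show ?thesis using mV by (intro bexI[of _ 0] bexI[of _ "single m a"]) auto
  qed
qed

lemma top_exists:
  fixes f :: "('v, 'k::field) mpoly"
  assumes "f \<in> pol V" "f \<noteq> 0"
  obtains N h r where "h \<in> pol (V - {w})" "h \<noteq> 0" "r \<in> pol V" "r \<in> lowdeg w N" "f = var w ^ N * h + r"
proof -
  define N where "N = Max ((\<lambda>m. lookup m w) ` keys f)"
  have ne: "keys f \<noteq> {}" using assms(2) by (rule keys_nonempty)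
  have "f \<in> lowdeg w (Suc N)"
    unfolding lowdeg_def N_def by (auto simp: less_Suc_eq_le)
  from split_top[OF assms(1) this] obtain h r where
    hr: "h \<in> pol (V - {w})" "r \<in> pol V" "r \<in> lowdeg w N" "f = var w ^ N * h + r" by auto
  have "N \<in> (\<lambda>m. lookup m w) ` keys f" unfolding N_def using ne by (intro Max_in) auto
  then have "f \<notin> lowdeg w N" by (auto simp: lowdeg_def)
  then have "h \<noteq> 0" using hr by auto
  then show ?thesis using hr that by blast
qed

text \<open>The leading parts in \<open>w\<close> multiply, and each of the other three products has
  smaller degree in \<open>w\<close>.\<close>

lemma top_mult:
  fixes f g :: "('v, 'k::field) mpoly"
  assumes "h \<in> pol (V - {w})" "r \<in> lowdeg w N" "f = var w ^ N * h + r"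
    "h' \<in> pol (V - {w})" "r' \<in> lowdeg w M" "g = var w ^ M * h' + r'"
  shows "f * g - var w ^ (N + M) * (h * h') \<in> lowdeg w (N + M)"
proof -
  have "(var w ^ N * h) * r' \<in> lowdeg w (N + M)" by (rule lowdeg_mult[OF var_power_lowdeg[OF assms(1)] assms(5)])
  moreover have "(var w ^ M * h') * r \<in> lowdeg w (M + N)" by (rule lowdeg_mult[OF var_power_lowdeg[OF assms(4)] assms(2)])
  moreover have "r * r' \<in> lowdeg w (N + M)"
    using lowdeg_mult[of r w N r' M] assms lowdeg_mono[of r w N "Suc N"] by auto
  ultimately have "(var w ^ N * h) * r' + (var w ^ M * h') * r + r * r' \<in> lowdeg w (N + M)"
    by (intro lowdeg_add) (auto simp: add.commute)
  moreover have "f * g - var w ^ (N + M) * (h * h') = (var w ^ N * h) * r' + (var w ^ M * h') * r + r * r'"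
    unfolding assms(3,6) by (simp add: algebra_simps power_add)
  ultimately show ?thesis by simp
qed

section \<open>Absence of zero divisors\<close>

lemma pol_empty: "f \<in> pol {} \<Longrightarrow> f = single 0 (lookup f 0)"
proof (rule poly_mapping_eqI)
  fix m assume "f \<in> pol {}"
  then have "m \<in> keys f \<Longrightarrow> m = 0" by (auto simp: pol_def)
  then show "lookup f m = lookup (single 0 (lookup f 0)) m"
    by (auto simp: lookup_single when_def in_keys_iff)
qed

text \<open>Induction on the variables: the leading coefficients in the new variable
  \<open>w\<close> have product zero, although they are nonzero polynomials in fewer
  variables.\<close>

lemma pol_domain_finite:
  fixes f :: "('v, 'k::field) mpoly"
  assumes "finite V" "f \<in> pol V" "g \<in> pol V" "f * g = 0"
  shows "f = 0 \<or> g = 0"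
  using assms
proof (induction V arbitrary: f g rule: finite_induct)
  case empty
  then have "f = single 0 (lookup f 0)" "g = single 0 (lookup g 0)" by (auto dest: pol_empty)
  then have "single 0 (lookup f 0 * lookup g 0) = (0 :: ('v, 'k) mpoly)"
    using empty(3) by (metis mult_single add.right_neutral)
  then have "lookup f 0 * lookup g 0 = 0" by (metis lookup_single_eq lookup_zero)
  then show ?case using \<open>f = _\<close> \<open>g = _\<close> by (metis mult_eq_0_iff single_zero)
next
  case (insert w V)
  show ?case
  proof (rule ccontr)
    assume "\<not> (f = 0 \<or> g = 0)"
    then have "f \<noteq> 0" "g \<noteq> 0" by auto
    have V: "insert w V - {w} = V" using insert.hyps by auto
    obtain N h r where f: "h \<in> pol V" "h \<noteq> 0" "r \<in> lowdeg w N" "f = var w ^ N * h + r"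
      using top_exists[OF insert.prems(1) \<open>f \<noteq> 0\<close>, of w] unfolding V by metis
    obtain M h' r' where g: "h' \<in> pol V" "h' \<noteq> 0" "r' \<in> lowdeg w M" "g = var w ^ M * h' + r'"
      using top_exists[OF insert.prems(2) \<open>g \<noteq> 0\<close>, of w] unfolding V by metis
    have "f * g - var w ^ (N + M) * (h * h') \<in> lowdeg w (N + M)"
      using f g V by (intro top_mult[of h "insert w V"]) auto
    then have "var w ^ (N + M) * (h * h') \<in> lowdeg w (N + M)"
      using lowdeg_uminus[of "- (var w ^ (N + M) * (h * h'))"] insert.prems(3) by auto
    then have "h * h' = 0" by (rule var_power_mult_lowdeg_zero)
    then show False using insert.IH f g by auto
  qed
qed

lemma pol_support: "\<exists>V. finite V \<and> f \<in> pol V"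
  by (rule exI[of _ "\<Union>(keys ` keys f)"]) (auto simp: pol_def)

lemma mpoly_domain:
  fixes f :: "('v, 'k::field) mpoly"
  assumes "f * g = 0"
  shows "f = 0 \<or> g = 0"
proof -
  obtain V W where V: "finite V" "f \<in> pol V" and W: "finite W" "g \<in> pol W"
    using pol_support by metis
  have "f \<in> pol (V \<union> W)" "g \<in> pol (V \<union> W)" using V W pol_mono[of V "V \<union> W"] pol_mono[of W "V \<union> W"] by auto
  then show ?thesis using pol_domain_finite[of "V \<union> W" f g] V W assms by auto
qed

section \<open>Division by polynomials monic in one variable\<close>

definition monic_in :: "'v set \<Rightarrow> 'v \<Rightarrow> nat \<Rightarrow> ('v, 'k::field) mpoly \<Rightarrow> bool" where
  "monic_in V w D g \<longleftrightarrow> w \<in> V \<and> g - var w ^ D \<in> pol V \<and> g - var w ^ D \<in> lowdeg w D"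

lemma monic_in_pol: "monic_in V w D g \<Longrightarrow> g \<in> pol V"
  using pol_add[of "g - var w ^ D" V "var w ^ D"] by (auto simp: monic_in_def)

lemma monic_div:
  fixes g :: "('v, 'k::field) mpoly"
  assumes g: "monic_in V w D g" and y: "y \<in> pol V"
  shows "\<exists>q\<in>pol V. \<exists>r\<in>pol V \<inter> lowdeg w D. y = q * g + r"
proof -
  let ?P = "\<lambda>y. \<exists>q\<in>pol V. \<exists>r\<in>pol V \<inter> lowdeg w D. y = q * g + r"
  have add: "?P (p + q)" if pq: "?P p" "?P q" for p q
  proof -
    from pq obtain h r h' r' where "h \<in> pol V" "r \<in> pol V \<inter> lowdeg w D" "p = h * g + r"
      "h' \<in> pol V" "r' \<in> pol V \<inter> lowdeg w D" "q = h' * g + r'" by metis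
    then show ?thesis
      by (intro bexI[of _ "h + h'"] bexI[of _ "r + r'"]) (auto simp: algebra_simps intro: lowdeg_add)
  qed
  have zero: "?P 0" by (intro bexI[of _ 0]) auto
  define g' where "g' = g - var w ^ D"
  have g': "g' \<in> pol V" "g' \<in> lowdeg w D" "g = var w ^ D + g'"
    using g by (auto simp: g'_def monic_in_def)
  have "?P y" if "y \<in> pol V" "y \<in> lowdeg w N" for N y
    using that
  proof (induction N arbitrary: y)
    case 0
    then have "y = 0" using keys_nonempty[of y] by (auto simp: lowdeg_def)
    then show ?case using zero by simp
  next
    case (Suc N)
    show ?case
    proof (cases "Suc N \<le> D")
      case True
      then show ?thesis using Suc.prems lowdeg_mono[of y w "Suc N" D]
        by (intro bexI[of _ 0] bexI[of _ y]) auto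
    next
      case False
      from split_top[OF Suc.prems] obtain h r where hr: "h \<in> pol (V - {w})" "r \<in> pol V" "r \<in> lowdeg w N"
        "y = var w ^ N * h + r" by auto
      \<comment> \<open>Subtracting \<open>q * g\<close> cancels the part of degree exactly
        \<open>N\<close>; what remains has degree below \<open>N\<close>.\<close>
      define q where "q = var w ^ (N - D) * h"
      have hV: "h \<in> pol V" using hr(1) pol_mono[of "V - {w}" V] by auto
      have qV: "q \<in> pol V" using hV g by (auto simp: q_def monic_in_def)
      have "q * g' \<in> lowdeg w (N - D + D)"
        unfolding q_def by (rule lowdeg_mult[OF var_power_lowdeg[OF hr(1)] g'(2)])
      then have 1: "q * g' \<in> lowdeg w N" using False by simp
      have "y = q * g + (r - q * g')"
        using False by (simp add: hr(4) g'(3) q_def algebra_simps power_add[symmetric])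
      moreover have "?P (q * g)" using qV by (intro bexI[of _ q] bexI[of _ 0]) auto
      moreover have "?P (r - q * g')"
        using 1 hr(2,3) qV g'(1) by (intro Suc.IH lowdeg_diff) auto
      ultimately show ?thesis using add by metis
    qed
  qed
  moreover obtain N where "y \<in> lowdeg w N" using lowdeg_exists[of y w] by auto
  ultimately show ?thesis using y by blast
qed

text \<open>A leading coefficient 1 cannot annihilate that of \<open>q\<close>, so a nonzero
  multiple of \<open>g\<close> keeps degree at least \<open>D\<close>. This is uniqueness of
  division with remainder.\<close>

lemma monic_mult_lowdeg_zero:
  fixes g :: "('v, 'k::field) mpoly"
  assumes g: "monic_in V w D g" and q: "q \<in> pol V" "q * g \<in> lowdeg w D"
  shows "q = 0"
proof (rule ccontr)
  assume "q \<noteq> 0"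
  then obtain N h r where f: "h \<in> pol (V - {w})" "h \<noteq> 0" "r \<in> lowdeg w N" "q = var w ^ N * h + r"
    using top_exists[OF q(1), of w] by metis
  define g' where "g' = g - var w ^ D"
  have g': "g' \<in> lowdeg w D" "g = var w ^ D + g'" using g by (auto simp: g'_def monic_in_def)
  have "(var w ^ D :: ('v, 'k) mpoly) \<in> lowdeg w (Suc D)"
    by (simp add: var_power lowdeg_def)
  then have "var w ^ D * r \<in> lowdeg w (D + N)" using f(3) by (rule lowdeg_mult)
  moreover have "(var w ^ N * h) * g' \<in> lowdeg w (N + D)"
    by (rule lowdeg_mult[OF var_power_lowdeg[OF f(1)] g'(1)])
  moreover have "r * g' \<in> lowdeg w (N + D)"
    using lowdeg_mult[of r w N g' D] f(3) g'(1) lowdeg_mono[of r w N "Suc N"] by auto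
  moreover have "q * g \<in> lowdeg w (N + D)" using q(2) by (rule lowdeg_mono) auto
  ultimately have "q * g - (var w ^ D * r + (var w ^ N * h) * g' + r * g') \<in> lowdeg w (N + D)"
    by (intro lowdeg_diff lowdeg_add) (auto simp: add.commute)
  moreover have "q * g - (var w ^ D * r + (var w ^ N * h) * g' + r * g') = var w ^ (N + D) * h"
    unfolding f(4) g'(2) by (simp add: algebra_simps power_add)
  ultimately have "h = 0" using var_power_mult_lowdeg_zero by metis
  then show False using f by simp
qed

section \<open>Triangular systems\<close>

text \<open>Each pair holds a pivot and a polynomial monic in it; later polynomials avoid earlier
  pivots. Eliminating pivots from the front presents the quotient as a free module over the
  polynomials in the other variables, the fact behind \<open>triangular_regular\<close>.\<close>

fun triangular :: "'v set \<Rightarrow> ('v \<times> ('v, 'k::field) mpoly) list \<Rightarrow> bool" where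
  "triangular V [] = True"
| "triangular V ((w, g) # l) \<longleftrightarrow>
     (\<exists>D. monic_in V w D g) \<and> (\<forall>(w', g')\<in>set l. g' \<in> pol (V - {w})) \<and> triangular V l"

lemma triangular_pol: "triangular V l \<Longrightarrow> snd ` set l \<subseteq> pol V"
  by (induction V l rule: triangular.induct) (auto dest: monic_in_pol)

lemma triangular_append1:
  "triangular V (l @ [(w, g)]) \<longleftrightarrow>
     triangular V l \<and> (\<exists>D. monic_in V w D g) \<and> (\<forall>w'\<in>fst ` set l. g \<in> pol (V - {w'}))"
  by (induction V l rule: triangular.induct) auto

text \<open>Dividing the coefficients by \<open>g\<close>, rather than \<open>z\<close> itself,
  keeps the remainder in the ideal: the generators in \<open>S\<close> do not involve
  \<open>w\<close>, so they do not raise the degree in \<open>w\<close>.\<close>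

lemma gen_reduce:
  fixes g :: "('v, 'k::field) mpoly"
  assumes g: "monic_in V w D g" and S: "S \<subseteq> pol (V - {w})" and z: "z \<in> gen V S"
  shows "\<exists>q\<in>pol V. \<exists>r\<in>gen V S \<inter> lowdeg w D. z = q * g + r"
  using z
proof induction
  case gen_0
  then show ?case by (intro bexI[of _ 0]) (auto intro: gen.gen_0)
next
  case (gen_step s p y)
  then obtain q r where qr: "q \<in> pol V" "r \<in> gen V S" "r \<in> lowdeg w D" "y = q * g + r" by auto
  obtain q' r' where qr': "q' \<in> pol V" "r' \<in> pol V" "r' \<in> lowdeg w D" "p = q' * g + r'"
    using monic_div[OF g gen_step(2)] by auto
  have s: "s \<in> pol (V - {w})" using S gen_step by auto
  then have sV: "s \<in> pol V" using pol_mono[of "V - {w}" V] by auto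
  show ?case
  proof (intro bexI)
    show "p * s + y = (q' * s + q) * g + (r' * s + r)" by (simp add: qr(4) qr'(4) algebra_simps)
    have "r' * s \<in> lowdeg w D" using pol_minus_mult_lowdeg[OF s qr'(3)] by (simp add: mult.commute)
    then show "r' * s + r \<in> gen V S \<inter> lowdeg w D"
      using qr qr' gen_step by (auto intro: lowdeg_add gen.gen_step)
  qed (use sV qr qr' in auto)
qed

lemma triangular_regular:
  fixes f :: "('v, 'k::field) mpoly"
  assumes "triangular V l" "\<forall>w\<in>fst ` set l. f \<in> pol (V - {w})" "f \<in> pol V" "f \<noteq> 0" "y \<in> pol V"
    "f * y \<in> gen V (snd ` set l)"
  shows "y \<in> gen V (snd ` set l)"
  using assms
proof (induction V l arbitrary: y rule: triangular.induct)
  case (1 V)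
  have "f * y = 0" using 1(6) by cases auto
  then have "y = 0" using mpoly_domain 1(4) by blast
  then show ?case by (simp add: gen_0)
next
  case (2 V w g l)
  let ?S = "snd ` set l"
  obtain D where g: "monic_in V w D g" using 2 by auto
  have fw: "f \<in> pol (V - {w})" using 2 by auto
  have S: "?S \<subseteq> pol (V - {w})" using 2(2) by auto
  obtain c y' where cy: "c \<in> pol V" "y' \<in> pol V" "y' \<in> lowdeg w D" "y = c * g + y'"
    using monic_div[OF g \<open>y \<in> pol V\<close>] by auto
  have "f * y \<in> gen V (insert g ?S)" using 2(7) by simp
  from gen_insertD[OF this] obtain h z where hz: "h \<in> pol V" "z \<in> gen V ?S" "f * y = h * g + z" by auto
  obtain q z' where qz: "q \<in> pol V" "z' \<in> gen V ?S" "z' \<in> lowdeg w D" "z = q * g + z'"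
    using gen_reduce[OF g S hz(2)] by auto
  \<comment> \<open>Both terms on the left have degree below \<open>D\<close> in \<open>w\<close>,
    so the multiple of \<open>g\<close> on the right must be zero and the relation descends to the
    tail of the list.\<close>
  have eq: "f * y' - z' = (h + q - f * c) * g"
    using hz(3) unfolding cy(4) qz(4) by (simp add: algebra_simps)
  have "f * y' \<in> lowdeg w D" by (rule pol_minus_mult_lowdeg[OF fw cy(3)])
  then have "(h + q - f * c) * g \<in> lowdeg w D" using qz(3) unfolding eq[symmetric] by (rule lowdeg_diff)
  then have "h + q - f * c = 0"
    using hz qz cy 2 by (intro monic_mult_lowdeg_zero[OF g]) auto
  then have "f * y' = z'" using eq by simp
  then have "y' \<in> gen V ?S" using 2 qz cy by auto
  then have "y' \<in> gen V (insert g ?S)" using gen_mono[of ?S "insert g ?S" V] by auto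
  moreover have "c * g \<in> gen V (insert g ?S)" using cy by (auto intro: gen_base_mult)
  ultimately show ?case using gen_add cy(4) by (simp add: gen_add)
qed

section \<open>Weakly regular sequences on subquotients\<close>

definition add_multiples :: "('v, 'k::field) mpoly set \<Rightarrow> ('v, 'k) mpoly \<Rightarrow> ('v, 'k) mpoly set
    \<Rightarrow> ('v, 'k) mpoly set" where
  "add_multiples B x A = {b + x * a | b a. b \<in> B \<and> a \<in> A}"

fun weakly_regular :: "('v, 'k::field) mpoly set \<Rightarrow> ('v, 'k) mpoly set \<Rightarrow> ('v, 'k) mpoly list \<Rightarrow> bool" where
  "weakly_regular A B [] \<longleftrightarrow> True"
| "weakly_regular A B (x # xs) \<longleftrightarrow> (\<forall>y\<in>A. x * y \<in> B \<longrightarrow> y \<in> B) \<and> weakly_regular A (add_multiples B x A) xs"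

lemma add_multiplesI: "b \<in> B \<Longrightarrow> a \<in> A \<Longrightarrow> b + x * a \<in> add_multiples B x A"
  by (auto simp: add_multiples_def)

lemma pideal_add_multiples:
  assumes "pideal V A" "pideal V B" "x \<in> pol V"
  shows "pideal V (add_multiples B x A)"
  unfolding pideal_def
proof (intro conjI ballI)
  note A = pidealD[OF assms(1)] and B = pidealD[OF assms(2)]
  show "add_multiples B x A \<subseteq> pol V" using A(1) B(1) assms(3) by (auto simp: add_multiples_def)
  show "0 \<in> add_multiples B x A" using add_multiplesI[OF B(2) A(2), of x] by simp
  fix p assume "p \<in> add_multiples B x A"
  then obtain b a where p: "b \<in> B" "a \<in> A" "p = b + x * a" by (auto simp: add_multiples_def)
  show "p + q \<in> add_multiples B x A" if q: "q \<in> add_multiples B x A" for q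
  proof -
    from q obtain b' a' where q: "b' \<in> B" "a' \<in> A" "q = b' + x * a'" by (auto simp: add_multiples_def)
    have "(b + b') + x * (a + a') \<in> add_multiples B x A" using p q A B by (intro add_multiplesI) auto
    then show ?thesis unfolding p q by (simp add: algebra_simps)
  qed
  show "r * p \<in> add_multiples B x A" if "r \<in> pol V" for r
  proof -
    have "r * b + x * (r * a) \<in> add_multiples B x A" using p that A B by (intro add_multiplesI) auto
    then show ?thesis unfolding p by (simp add: algebra_simps)
  qed
qed

text \<open>Multiplication by \<open>u\<close> induces an isomorphism from \<open>A1 / B1\<close> onto \<open>A2 / B2\<close>.\<close>

lemma weakly_regular_iso:
  assumes "pideal V A1" "pideal V B1" "pideal V A2" "pideal V B2" "B1 \<subseteq> A1" "B2 \<subseteq> A2"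
    and "\<And>a. a \<in> A1 \<Longrightarrow> u * a \<in> A2"
    and "\<And>y. y \<in> A2 \<Longrightarrow> \<exists>a\<in>A1. \<exists>b\<in>B2. y = u * a + b"
    and "\<And>a. a \<in> A1 \<Longrightarrow> u * a \<in> B2 \<longleftrightarrow> a \<in> B1"
    and "set xs \<subseteq> pol V" "u \<in> pol V" "weakly_regular A1 B1 xs"
  shows "weakly_regular A2 B2 xs"
  using assms
proof (induction xs arbitrary: B1 B2)
  case (Cons x xs)
  note A1 = pidealD[OF Cons.prems(1)] and B1 = pidealD[OF Cons.prems(2)]
    and A2 = pidealD[OF Cons.prems(3)] and B2 = pidealD[OF Cons.prems(4)]
  note to = Cons.prems(7) and onto = Cons.prems(8) and iff = Cons.prems(9)
  have x: "x \<in> pol V" using Cons.prems by auto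
  have "y \<in> B2" if y: "y \<in> A2" "x * y \<in> B2" for y
  proof -
    obtain a b where ab: "a \<in> A1" "b \<in> B2" "y = u * a + b" using onto[OF y(1)] by auto
    have "x * y - x * b \<in> B2" using y ab x B2 by auto
    then have "u * (x * a) \<in> B2" by (simp add: ab(3) algebra_simps)
    then have "x * a \<in> B1" using iff[of "x * a"] ab x A1 by auto
    then have "a \<in> B1" using Cons.prems ab by auto
    then have "u * a \<in> B2" using iff ab by auto
    then show ?thesis using ab B2 by auto
  qed
  moreover have "weakly_regular A2 (add_multiples B2 x A2) xs"
  proof (rule Cons.IH[of "add_multiples B1 x A1"])
    show "pideal V A1" "pideal V A2" using Cons.prems by auto
    show "pideal V (add_multiples B1 x A1)" "pideal V (add_multiples B2 x A2)" using Cons.prems x by (auto intro: pideal_add_multiples)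
    show "add_multiples B1 x A1 \<subseteq> A1" using Cons.prems(5) x A1 by (auto simp: add_multiples_def)
    show "add_multiples B2 x A2 \<subseteq> A2" using Cons.prems(6) x A2 by (auto simp: add_multiples_def)
    show "u * a \<in> A2" if "a \<in> A1" for a using to that .
    show "\<exists>a\<in>A1. \<exists>b\<in>add_multiples B2 x A2. y = u * a + b" if y: "y \<in> A2" for y
    proof -
      obtain a b where ab: "a \<in> A1" "b \<in> B2" "y = u * a + b" using onto[OF y] by auto
      moreover have "b + x * 0 \<in> add_multiples B2 x A2" using ab A2 by (intro add_multiplesI) auto
      ultimately show ?thesis by auto
    qed
    show "u * a \<in> add_multiples B2 x A2 \<longleftrightarrow> a \<in> add_multiples B1 x A1" if a: "a \<in> A1" for a
    proof
      assume "u * a \<in> add_multiples B2 x A2"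
      then obtain b c where bc: "b \<in> B2" "c \<in> A2" "u * a = b + x * c" by (auto simp: add_multiples_def)
      obtain a' b' where ab': "a' \<in> A1" "b' \<in> B2" "c = u * a' + b'" using onto[OF bc(2)] by auto
      have "u * (a - x * a') = b + x * b'" unfolding right_diff_distrib bc(3) ab'(3) by (simp add: algebra_simps)
      then have "u * (a - x * a') \<in> B2" using bc ab' x B2 by auto
      then have "a - x * a' \<in> B1" using iff[of "a - x * a'"] a ab' x A1 by auto
      from add_multiplesI[OF this ab'(1), of x] show "a \<in> add_multiples B1 x A1" by simp
    next
      assume "a \<in> add_multiples B1 x A1"
      then obtain b c where bc: "b \<in> B1" "c \<in> A1" "a = b + x * c" by (auto simp: add_multiples_def)
      have "u * b + x * (u * c) \<in> add_multiples B2 x A2"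
        using bc iff[of b] to Cons.prems(5) by (intro add_multiplesI) auto
      then show "u * a \<in> add_multiples B2 x A2" unfolding bc(3) by (simp add: algebra_simps)
    qed
  qed (use Cons.prems in auto)
  ultimately show ?case by simp
qed simp

text \<open>In the exact sequence \<open>0 -> B / D -> A / D -> A / B -> 0\<close> an element
  regular on both ends is regular in the middle. The sequence stays exact modulo \<open>x\<close>,
  which is what the induction needs.\<close>

lemma weakly_regular_trans:
  assumes "pideal V A" "pideal V B" "pideal V D" "D \<subseteq> B" "B \<subseteq> A" "set xs \<subseteq> pol V"
    and "weakly_regular A B xs" "weakly_regular B D xs"
  shows "weakly_regular A D xs"
  using assms
proof (induction xs arbitrary: B D)
  case (Cons x xs)
  note A = pidealD[OF Cons.prems(1)] and B = pidealD[OF Cons.prems(2)] and D = pidealD[OF Cons.prems(3)]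
  have x: "x \<in> pol V" using Cons.prems by auto
  have h1: "\<And>y. y \<in> A \<Longrightarrow> x * y \<in> B \<Longrightarrow> y \<in> B" and h2: "\<And>y. y \<in> B \<Longrightarrow> x * y \<in> D \<Longrightarrow> y \<in> D"
    using Cons.prems by auto
  note I = pideal_add_multiples[OF Cons.prems(2,3) x] pideal_add_multiples[OF Cons.prems(1,2) x] pideal_add_multiples[OF Cons.prems(1,3) x]
  \<comment> \<open>The kernel term of the reduced sequence is \<open>(B + xA) / (D + xA)\<close>,
    isomorphic to \<open>B / (D + xB)\<close>.\<close>
  have "weakly_regular (add_multiples B x A) (add_multiples D x A) xs"
  proof (rule weakly_regular_iso[where u = 1, OF Cons.prems(2) I])
    show "add_multiples D x B \<subseteq> B" using Cons.prems(4) x B by (auto simp: add_multiples_def)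
    show "add_multiples D x A \<subseteq> add_multiples B x A" using Cons.prems(4) by (auto simp: add_multiples_def)
    show "1 * a \<in> add_multiples B x A" if "a \<in> B" for a using add_multiplesI[OF that A(2), of x] by simp
    show "\<exists>a\<in>B. \<exists>b\<in>add_multiples D x A. y = 1 * a + b" if y: "y \<in> add_multiples B x A" for y
    proof -
      obtain b a where "b \<in> B" "a \<in> A" "y = b + x * a" using y by (auto simp: add_multiples_def)
      moreover from this have "0 + x * a \<in> add_multiples D x A" using D by (intro add_multiplesI) auto
      ultimately show ?thesis by auto
    qed
    show "1 * b \<in> add_multiples D x A \<longleftrightarrow> b \<in> add_multiples D x B" if b: "b \<in> B" for b
    proof
      assume "1 * b \<in> add_multiples D x A"
      then obtain d a where da: "d \<in> D" "a \<in> A" "b = d + x * a" by (auto simp: add_multiples_def)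
      have "d \<in> B" using da Cons.prems(4) by auto
      then have "b - d \<in> B" using b by (intro B(6))
      \<comment> \<open>Regularity of \<open>x\<close> on \<open>A / B\<close> shows that
        \<open>D + xA\<close> meets \<open>B\<close> only in \<open>D + xB\<close>.\<close>
      then have "a \<in> B" using h1[of a] da by simp
      then show "b \<in> add_multiples D x B" using da by (auto simp: add_multiples_def)
    next
      assume "b \<in> add_multiples D x B"
      then show "1 * b \<in> add_multiples D x A" using Cons.prems(5) by (auto simp: add_multiples_def)
    qed
    show "weakly_regular B (add_multiples D x B) xs" using Cons.prems by auto
  qed (use Cons.prems in auto)
  moreover have "add_multiples D x A \<subseteq> add_multiples B x A" using Cons.prems(4) by (auto simp: add_multiples_def)
  moreover have "add_multiples B x A \<subseteq> A" using Cons.prems(5) x A by (auto simp: add_multiples_def)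
  ultimately have "weakly_regular A (add_multiples D x A) xs"
    using Cons.prems by (intro Cons.IH[OF Cons.prems(1) I(2,3)]) auto
  then show ?case using h1 h2 Cons.prems(4) by auto
qed simp

lemma weakly_regular_refl: "pideal V A \<Longrightarrow> set xs \<subseteq> pol V \<Longrightarrow> weakly_regular A A xs"
proof (induction xs)
  case (Cons x xs)
  have "add_multiples A x A = A"
  proof
    show "add_multiples A x A \<subseteq> A" using Cons pidealD[OF Cons.prems(1)] by (auto simp: add_multiples_def)
    show "A \<subseteq> add_multiples A x A" using add_multiplesI[OF _ pidealD(2)[OF Cons.prems(1)], of _ A x] by auto
  qed
  then show ?case using Cons by simp
qed simp

lemma add_multiples_gen: "add_multiples (gen V S) x (pol V) = gen V (insert x S)"
  by (simp add: add_multiples_def gen_insert)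

lemma weakly_regular_regular:
  assumes "weakly_regular (pol V) (gen V S) xs" "i < length xs" "y \<in> pol V" "xs ! i * y \<in> gen V (S \<union> set (take i xs))"
  shows "y \<in> gen V (S \<union> set (take i xs))"
  using assms
proof (induction xs arbitrary: S i)
  case (Cons x xs)
  show ?case
  proof (cases i)
    case (Suc j)
    then show ?thesis using Cons.IH[of "insert x S" j] Cons.prems by (simp add: add_multiples_gen)
  qed (use Cons in auto)
qed simp

section \<open>A regular sequence for coordinate subspaces\<close>

lemma monic_in_diff:
  assumes "monic_in V w D g" "h \<in> pol (V - {w})" "0 < D"
  shows "monic_in V w D (g - h)"
proof -
  have "h \<in> lowdeg w D" using pol_minus_lowdeg[OF assms(2)] assms(3) by (auto intro: lowdeg_mono)
  moreover have "h \<in> pol V" using assms(2) pol_mono[of "V - {w}" V] by auto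
  moreover have "g - h - var w ^ D = (g - var w ^ D) - h" by simp
  ultimately show ?thesis using assms(1) by (metis lowdeg_diff monic_in_def pol_diff)
qed

lemma triangular_vars:
  "distinct cs \<Longrightarrow> set cs \<subseteq> V \<Longrightarrow> triangular V (map (\<lambda>c. (c, var c)) cs)"
  by (induction cs) (auto simp: monic_in_def intro!: exI[of _ 1])

text \<open>The blocks are the fibres of \<open>\<tau>\<close>, and \<open>C\<close> meets each of them at most once. Modulo the
  variables in \<open>C\<close> and the previous differences, each difference is congruent, up to sign, to a
  polynomial that is monic in a new variable (its pivot) and free of the previous pivots: \<open>z v\<close>,
  \<open>z (\<tau> v)\<close> or the difference itself.\<close>

lemma differences_weakly_regular:
  fixes z :: "'v \<Rightarrow> ('v, 'k::field) mpoly"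
  assumes C: "C \<subseteq> V" "finite C"
    and tau: "\<And>v. v \<in> V \<Longrightarrow> \<tau> v \<in> V" "\<And>v. v \<in> V \<Longrightarrow> \<tau> (\<tau> v) = \<tau> v"
    and uniq: "\<And>c c'. c \<in> C \<Longrightarrow> c' \<in> C \<Longrightarrow> \<tau> c = \<tau> c' \<Longrightarrow> c = c'"
    and z: "\<And>v. v \<in> V \<Longrightarrow> z v \<in> pol {v}" "\<And>v. v \<in> V \<Longrightarrow> z v \<in> gen V {var v}"
      "\<And>v. v \<in> V \<Longrightarrow> \<exists>D>0. monic_in V v D (z v)"
    and vs: "distinct vs" "set vs \<subseteq> {v \<in> V. \<tau> v \<noteq> v}"
  shows "weakly_regular (pol V) (gen V (var ` C)) (map (\<lambda>v. z v - z (\<tau> v)) vs)"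
proof -
  \<comment> \<open>For \<open>v\<close> in \<open>C\<close> the polynomial \<open>z v\<close>
    already vanishes in the quotient, so the difference leaves only \<open>z (\<tau> v)\<close>, and
    the pivot moves to \<open>\<tau> v\<close>.\<close>
  define piv where "piv v = (if v \<in> C then \<tau> v else v)" for v
  have zV: "z v \<in> pol W" if "v \<in> V" "v \<in> W" for v W
    using z(1)[OF that(1)] pol_mono[of "{v}" W] that by auto
  have znz: "z v \<noteq> 0" if vV: "v \<in> V" for v
  proof
    assume 0: "z v = 0"
    obtain D where "0 < D" "monic_in V v D (z v)" using z(3)[OF vV] by auto
    then have "(var v ^ D :: ('v, 'k) mpoly) \<in> lowdeg v D"
      using 0 lowdeg_uminus[of "- (var v ^ D)" v D] by (auto simp: monic_in_def)
    then show False by (auto simp: var_power lowdeg_def)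
  qed
  \<comment> \<open>The triangular system \<open>l\<close> generates an ideal containing
    \<open>z c\<close> for \<open>c\<close> in \<open>C\<close> and the differences of the processed
    vertices \<open>pr\<close>; its first components are the pivots used so far.\<close>
  have main: "weakly_regular (pol V) (gen V (snd ` set l)) (map (\<lambda>v. z v - z (\<tau> v)) vs)"
    if "triangular V l" "fst ` set l = C \<union> piv ` set pr" "\<forall>c\<in>C. z c \<in> gen V (snd ` set l)"
      "\<forall>v\<in>set pr. z v - z (\<tau> v) \<in> gen V (snd ` set l)"
      "distinct (pr @ vs)" "set (pr @ vs) \<subseteq> {v \<in> V. \<tau> v \<noteq> v}" for l pr vs
    using that
  proof (induction vs arbitrary: l pr)
    case (Cons v vs)
    let ?J = "gen V (snd ` set l)" and ?W = "C \<union> piv ` set pr" and ?th = "\<lambda>v. z v - z (\<tau> v)"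
    have J: "pideal V ?J" using triangular_pol[OF Cons.prems(1)] by (rule pideal_gen)
    note D = pidealD[OF J]
    have v: "v \<in> V" "\<tau> v \<noteq> v" "v \<notin> set pr" "\<tau> v \<in> V" using Cons.prems tau by auto
    have vW: "v \<notin> piv ` set pr"
    proof
      assume "v \<in> piv ` set pr"
      then obtain p where "p \<in> set pr" "v = piv p" by auto
      then show False using v Cons.prems(6) tau by (auto simp: piv_def split: if_splits)
    qed
    \<comment> \<open>A representative that is already a pivot lies in \<open>C\<close> or is the
      pivot of an earlier vertex of \<open>C\<close> in the same block; either way
      \<open>z (\<tau> v)\<close> is zero modulo \<open>?J\<close>.\<close>
    have tz: "z (\<tau> v) \<in> ?J" if tvW: "\<tau> v \<in> ?W"
    proof (cases "\<tau> v \<in> C")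
      case False
      then obtain p where p: "p \<in> set pr" "\<tau> v = piv p" using tvW by auto
      have "p \<in> V" "\<tau> p \<noteq> p" using p Cons.prems by auto
      then have "p \<in> C" "\<tau> v = \<tau> p" using p tau v by (auto simp: piv_def split: if_splits)
      then have "z p \<in> ?J" "z p - z (\<tau> p) \<in> ?J" using Cons.prems p by auto
      then have "z p - (z p - z (\<tau> p)) \<in> ?J" using D(6) by blast
      then show ?thesis using \<open>\<tau> v = \<tau> p\<close> by simp
    qed (use Cons.prems in auto)
    \<comment> \<open>\<open>C\<close> meets a block at most once, so no other member of
      \<open>C\<close> can have claimed the representative of the block of \<open>v\<close>.\<close>
    have tW: "\<tau> v \<notin> ?W" if "v \<in> C"
    proof
      assume "\<tau> v \<in> ?W"
      then consider "\<tau> v \<in> C" | p where "p \<in> set pr" "\<tau> v = piv p" by auto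
      then show False
      proof cases
        case 1
        then show ?thesis using uniq[of v "\<tau> v"] that v tau by auto
      next
        case 2
        have "p \<in> V" "\<tau> p \<noteq> p" using 2 Cons.prems by auto
        then have "p \<in> C" "\<tau> v = \<tau> p" using 2 tau v by (auto simp: piv_def split: if_splits)
        then show ?thesis using uniq[of v p] that 2 v by auto
      qed
    qed
    obtain f where f: "f - ?th v \<in> ?J \<or> f + ?th v \<in> ?J" "\<exists>D. monic_in V (piv v) D f"
      "\<forall>w\<in>?W. f \<in> pol (V - {w})" "f \<noteq> 0" "f \<in> pol V"
    proof (cases "v \<in> C")
      case True
      show ?thesis
      proof (rule that[of "z (\<tau> v)"])
        have "z (\<tau> v) + ?th v \<in> ?J" using True Cons.prems by auto
        then show "z (\<tau> v) - ?th v \<in> ?J \<or> z (\<tau> v) + ?th v \<in> ?J" ..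
        show "\<exists>D. monic_in V (piv v) D (z (\<tau> v))" using True z(3)[OF v(4)] by (auto simp: piv_def)
        show "\<forall>w\<in>?W. z (\<tau> v) \<in> pol (V - {w})"
        proof
          fix w assume "w \<in> ?W"
          then have "w \<noteq> \<tau> v" using tW[OF True] by auto
          then show "z (\<tau> v) \<in> pol (V - {w})" using v by (intro zV) auto
        qed
      qed (use znz zV v in auto)
    next
      case False
      obtain D where D: "D > 0" "monic_in V v D (z v)" using z(3) v by auto
      \<comment> \<open>When \<open>\<tau> v\<close> is an old pivot, \<open>z (\<tau> v)\<close> is
        dropped: it is zero modulo \<open>?J\<close>, and keeping it would involve that
        pivot.\<close>
      define h where "h = (if \<tau> v \<in> ?W then 0 else z (\<tau> v))"
      have h: "h \<in> pol (V - {v})" using v zV by (auto simp: h_def)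
      have mon: "monic_in V v D (z v - h)" using monic_in_diff[OF D(2) h D(1)] .
      show ?thesis
      proof (rule that[of "z v - h"])
        have "(z v - h) - ?th v \<in> ?J" using tz pidealD(2)[OF J] by (auto simp: h_def)
        then show "(z v - h) - ?th v \<in> ?J \<or> (z v - h) + ?th v \<in> ?J" ..
        show "\<exists>D. monic_in V (piv v) D (z v - h)" using False mon by (auto simp: piv_def)
        show "\<forall>w\<in>?W. z v - h \<in> pol (V - {w})"
        proof
          fix w assume w: "w \<in> ?W"
          then have "w \<noteq> v" using vW False by auto
          then have "z v \<in> pol (V - {w})" using v by (intro zV) auto
          moreover have "h \<in> pol (V - {w})"
          proof (cases "\<tau> v \<in> ?W")
            case False
            then have "\<tau> v \<noteq> w" using w by auto
            then show ?thesis using False v zV[of "\<tau> v" "V - {w}"] by (simp add: h_def)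
          qed (simp add: h_def)
          ultimately show "z v - h \<in> pol (V - {w})" by auto
        qed
        show "z v - h \<noteq> 0"
        proof
          assume "z v - h = 0"
          then have "(var v ^ D :: ('v, 'k) mpoly) \<in> lowdeg v D"
            using mon lowdeg_uminus[of "- (var v ^ D)" v D] by (auto simp: monic_in_def)
          then show False by (auto simp: var_power lowdeg_def)
        qed
        show "z v - h \<in> pol V" using mon by (rule monic_in_pol)
      qed
    qed
    have thV: "?th v \<in> pol V" using v zV by auto
    have reg: "y \<in> ?J" if y: "y \<in> pol V" "?th v * y \<in> ?J" for y
    proof -
      have "f * y \<in> ?J"
      proof (cases "f - ?th v \<in> ?J")
        case True
        then have "y * (f - ?th v) + ?th v * y \<in> ?J" using y D by auto
        then show ?thesis by (simp add: algebra_simps)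
      next
        case False
        then have "y * (f + ?th v) - ?th v * y \<in> ?J" using f(1) y D by auto
        then show ?thesis by (simp add: algebra_simps)
      qed
      then show ?thesis using triangular_regular[OF Cons.prems(1) _ f(5,4) y(1)] f(3) Cons.prems(2) by auto
    qed
    let ?l = "l @ [(piv v, f)]"
    \<comment> \<open>\<open>f\<close> agrees with the difference up to sign modulo
      \<open>?J\<close>, so either may serve as the new generator.\<close>
    have eq: "gen V (snd ` set ?l) = gen V (insert (?th v) (snd ` set l))"
    proof -
      have I: "?J \<subseteq> gen V (insert a (snd ` set l))" "a \<in> gen V (insert a (snd ` set l))" for a
        using gen_mono[of "snd ` set l" "insert a (snd ` set l)" V] by (auto intro: gen_base)
      have neg: "- b \<in> gen V T" if "b \<in> gen V T" for b and T :: "('v, 'k) mpoly set"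
        using gen_mult[OF that, of "- 1"] by simp
      have key: "b \<in> gen V (insert a (snd ` set l))" if "b - a \<in> ?J \<or> b + a \<in> ?J" for a b
        using that
      proof
        assume "b - a \<in> ?J"
        then have "(b - a) + a \<in> gen V (insert a (snd ` set l))"
          by (rule gen_add[OF subsetD[OF I(1)] I(2)])
        then show ?thesis by simp
      next
        assume "b + a \<in> ?J"
        then have "(b + a) + (- a) \<in> gen V (insert a (snd ` set l))"
          by (rule gen_add[OF subsetD[OF I(1)] neg[OF I(2)]])
        then show ?thesis by simp
      qed
      have "f \<in> gen V (insert (?th v) (snd ` set l))" using f(1) by (rule key)
      moreover have "?th v \<in> gen V (insert f (snd ` set l))"
      proof (rule key)
        show "?th v - f \<in> ?J \<or> ?th v + f \<in> ?J"
          using f(1) D(5)[of "f - ?th v"] by (auto simp: algebra_simps)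
      qed
      ultimately show ?thesis using I by (intro gen_eqI) (auto intro: gen_base)
    qed
    have "?J \<subseteq> gen V (snd ` set ?l)" by (rule gen_mono) auto
    moreover have "?th v \<in> gen V (snd ` set ?l)" unfolding eq by (auto intro: gen_base)
    ultimately have "weakly_regular (pol V) (gen V (snd ` set ?l)) (map ?th vs)"
      using Cons.prems f by (intro Cons.IH[where pr = "pr @ [v]"]) (auto simp: triangular_append1)
    then have "weakly_regular (pol V) (gen V (insert (?th v) (snd ` set l))) (map ?th vs)" by (simp only: eq)
    then show ?case using reg by (simp add: add_multiples_gen)
  qed simp
  obtain cs where cs: "set cs = C" "distinct cs" using finite_distinct_list[OF C(2)] by auto
  let ?l = "map (\<lambda>c. (c, var c)) cs"
  have S: "snd ` set ?l = var ` C" "fst ` set ?l = C" using cs by force+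
  have zc: "z c \<in> gen V (var ` C)" if "c \<in> C" for c
    using z(2)[of c] that C gen_mono[of "{var c}" "var ` C" V] by auto
  show ?thesis
    using main[of ?l "[]" vs, unfolded S] triangular_vars[OF cs(2), of V] cs C vs zc by auto
qed


section \<open>Squarefree monomial ideals and shellings\<close>

definition sqf_exp :: "'v set \<Rightarrow> ('v \<Rightarrow>\<^sub>0 nat)" where
  "sqf_exp C = (\<Sum>x\<in>C. single x 1)"

lemma lookup_sqf_exp: "finite C \<Longrightarrow> lookup (sqf_exp C) x = (if x \<in> C then 1 else 0)"
  by (simp add: sqf_exp_def lookup_sum lookup_single when_def)

lemma keys_sqf_exp [simp]: "finite C \<Longrightarrow> keys (sqf_exp C) = C"
  by (auto simp: in_keys_iff lookup_sqf_exp split: if_splits)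

lemma prod_var:
  assumes "finite C"
  shows "(\<Prod>x\<in>C. var x) = (monomial (sqf_exp C) :: ('v, 'k::field) mpoly)"
  using assms
proof (induction C rule: finite_induct)
  case (insert x C)
  then show ?case by (simp add: var_def monomial_def sqf_exp_def mult_single)
qed (simp add: monomial_def sqf_exp_def)

lemma sqf_exp_dvd:
  assumes "finite C"
  shows "C \<subseteq> keys m \<longleftrightarrow> (\<exists>h. m = sqf_exp C + h)"
proof
  assume C: "C \<subseteq> keys m"
  have "lookup (sqf_exp C) v \<le> lookup m v" for v
    using C assms by (auto simp: lookup_sqf_exp in_keys_iff Suc_le_eq)
  then show "\<exists>h. m = sqf_exp C + h" using exp_le_split by blast
qed (use assms in \<open>auto simp: keys_plus_nat\<close>)

lemma monomial_ideal_mem: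
  assumes "\<And>C. C \<in> F \<Longrightarrow> finite C" "\<And>C. C \<in> F \<Longrightarrow> C \<subseteq> V"
  shows "gen V ((\<lambda>C. monomial (sqf_exp C)) ` F) = {f \<in> pol V. \<forall>m\<in>keys f. \<exists>C\<in>F. C \<subseteq> keys m}"
proof -
  have "gen V (monomial ` (sqf_exp ` F)) = {f \<in> pol V. \<forall>m\<in>keys f. \<exists>g\<in>sqf_exp ` F. \<exists>h. m = g + h}"
  proof (rule gen_monomials)
    fix g assume "g \<in> sqf_exp ` F"
    then obtain C where "C \<in> F" "g = sqf_exp C" by auto
    then show "keys g \<subseteq> V" using assms[of C] by simp
  qed
  also have "\<dots> = {f \<in> pol V. \<forall>m\<in>keys f. \<exists>C\<in>F. C \<subseteq> keys m}"
  proof -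
    have "(\<exists>g\<in>sqf_exp ` F. \<exists>h. m = g + h) \<longleftrightarrow> (\<exists>C\<in>F. C \<subseteq> keys m)" for m
      using assms(1) sqf_exp_dvd[of _ m] by (simp cong: bex_cong)
    then show ?thesis by simp
  qed
  finally show ?thesis by (simp add: image_image)
qed

text \<open>The intersection of the prime ideals generated by the members of \<open>F\<close>.\<close>

definition meet_ideal :: "'v set \<Rightarrow> 'v set set \<Rightarrow> ('v, 'k::field) mpoly set" where
  "meet_ideal V F = {f \<in> pol V. \<forall>m\<in>keys f. \<forall>C\<in>F. keys m \<inter> C \<noteq> {}}"

lemma pideal_meet_ideal: "pideal V (meet_ideal V F)"
  unfolding pideal_def
proof (intro conjI ballI)
  show "f + g \<in> meet_ideal V F" if fg: "f \<in> meet_ideal V F" "g \<in> meet_ideal V F"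
    for f g :: "('a \<Rightarrow>\<^sub>0 nat) \<Rightarrow>\<^sub>0 'b"
    unfolding meet_ideal_def
  proof (intro CollectI conjI ballI)
    fix m C assume "m \<in> keys (f + g)" "C \<in> F"
    then show "keys m \<inter> C \<noteq> {}"
      using fg subsetD[OF keys_add, of m f g] unfolding meet_ideal_def by blast
  qed (use fg in \<open>auto simp: meet_ideal_def\<close>)
  fix r f :: "('a \<Rightarrow>\<^sub>0 nat) \<Rightarrow>\<^sub>0 'b" assume r: "r \<in> pol V" and f: "f \<in> meet_ideal V F"
  show "r * f \<in> meet_ideal V F"
    unfolding meet_ideal_def
  proof (intro CollectI conjI ballI)
    fix m C assume "m \<in> keys (r * f)" "C \<in> F"
    from subsetD[OF keys_mult this(1)] obtain p q where "q \<in> keys f" "m = p + q" by auto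
    then show "keys m \<inter> C \<noteq> {}" using f \<open>C \<in> F\<close> by (auto simp: meet_ideal_def keys_plus_nat)
  qed (use r f in \<open>auto simp: meet_ideal_def\<close>)
qed (auto simp: meet_ideal_def)

lemma meet_ideal_singleton:
  fixes V :: "'v set"
  assumes "C \<subseteq> V"
  shows "meet_ideal V {C} = (gen V (var ` C) :: ('v, 'k::field) mpoly set)"
proof -
  have "gen V ((\<lambda>C. monomial (sqf_exp C)) ` ((\<lambda>c. {c}) ` C))
      = {f \<in> pol V :: ('v, 'k) mpoly set. \<forall>m\<in>keys f. \<exists>D\<in>(\<lambda>c. {c}) ` C. D \<subseteq> keys m}"
    using assms by (intro monomial_ideal_mem) auto
  then have "gen V (var ` C) = {f \<in> pol V :: ('v, 'k) mpoly set. \<forall>m\<in>keys f. \<exists>c\<in>C. c \<in> keys m}"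
    by (simp add: image_image sqf_exp_def var_def)
  moreover have "(\<exists>c\<in>C. c \<in> keys m) \<longleftrightarrow> (\<forall>D\<in>{C}. keys m \<inter> D \<noteq> {})" for m :: "'v \<Rightarrow>\<^sub>0 nat"
    by auto
  ultimately show ?thesis by (simp add: meet_ideal_def)
qed

text \<open>The complements of the members of \<open>Cs\<close> are the facets, in shelling order.\<close>

definition shelling :: "'v set list \<Rightarrow> bool" where
  "shelling Cs \<longleftrightarrow> (\<forall>j<length Cs. \<forall>i<j. \<exists>k<j. \<exists>v\<in>Cs ! i. Cs ! k - Cs ! j = {v})"

text \<open>Each layer of the filtration is cyclic: it is generated by the class of
  \<open>u\<close>, the product of the variables in \<open>R\<close>, and the annihilator of that
  class is the prime of the new cover. The layers combine by
  \<open>weakly_regular_trans\<close>.\<close>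

lemma shelling_weakly_regular:
  fixes xs :: "('v, 'k::field) mpoly list"
  assumes V: "finite V" and Cs: "\<And>C. C \<in> set Cs \<Longrightarrow> C \<subseteq> V" and sh: "shelling Cs"
    and xs: "set xs \<subseteq> pol V"
    and reg: "\<And>C. C \<in> set Cs \<Longrightarrow> weakly_regular (pol V) (meet_ideal V {C}) xs"
  shows "weakly_regular (pol V) (meet_ideal V (set Cs)) xs"
proof -
  have "weakly_regular (pol V) (meet_ideal V (set (take j Cs))) xs" if "j \<le> length Cs" for j
    using that
  proof (induction j)
    case 0
    have "meet_ideal V {} = (pol V :: ('v, 'k) mpoly set)" by (auto simp: meet_ideal_def)
    then show ?case using weakly_regular_refl[OF pideal_pol xs] by simp
  next
    case (Suc j)
    let ?C = "Cs ! j" and ?F = "set (take j Cs)"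
    have j: "j < length Cs" using Suc by simp
    have F': "set (take (Suc j) Cs) = insert ?C ?F" using j by (simp add: take_Suc_conv_app_nth)
    \<comment> \<open>The restriction set of the new facet: a monomial in the old intersection that
      avoids \<open>?C\<close> must contain every vertex of \<open>R\<close>.\<close>
    define R where "R = {v. \<exists>k<j. Cs ! k - ?C = {v}}"
    have RC: "R \<inter> ?C = {}" by (auto simp: R_def)
    have RV: "R \<subseteq> V"
    proof
      fix v assume "v \<in> R"
      then obtain k where "k < j" "Cs ! k - ?C = {v}" by (auto simp: R_def)
      then have "v \<in> Cs ! k" "Cs ! k \<in> set Cs" using j by auto
      then show "v \<in> V" using Cs by auto
    qed
    have Rfin: "finite R" using RV V by (rule finite_subset)
    \<comment> \<open>The shelling condition places an element of \<open>R\<close> in every earlier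
      cover, so \<open>u\<close> lies in the old intersection.\<close>
    have hit: "C \<inter> R \<noteq> {}" if CF: "C \<in> ?F" for C
    proof -
      obtain i where "i < j" "C = Cs ! i" using CF j by (auto simp: in_set_conv_nth)
      then obtain k v where "k < j" "v \<in> C" "Cs ! k - ?C = {v}"
        using sh j unfolding shelling_def by blast
      then show ?thesis by (auto simp: R_def)
    qed
    define u where "u = (monomial (sqf_exp R) :: ('v, 'k) mpoly)"
    have ku: "keys (u * a) = (+) (sqf_exp R) ` keys a" for a
      by (simp add: u_def monomial_def keys_single_mult)
    have uV: "u \<in> pol V" using RV Rfin by (simp add: u_def)
    have "weakly_regular (meet_ideal V ?F) (meet_ideal V (insert ?C ?F)) xs"
    proof (rule weakly_regular_iso[where u = u, OF pideal_pol pideal_meet_ideal pideal_meet_ideal pideal_meet_ideal])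
      show "meet_ideal V {?C} \<subseteq> (pol V :: ('v, 'k) mpoly set)" by (auto simp: meet_ideal_def)
      show "meet_ideal V (insert ?C ?F) \<subseteq> (meet_ideal V ?F :: ('v, 'k) mpoly set)"
        by (auto simp: meet_ideal_def)
      show ua: "u * a \<in> meet_ideal V ?F" if "a \<in> pol V" for a
        using that uV hit Rfin by (auto simp: meet_ideal_def ku keys_plus_nat)
      show "u * a \<in> meet_ideal V (insert ?C ?F) \<longleftrightarrow> a \<in> meet_ideal V {?C}" if "a \<in> pol V" for a
        using ua[OF that] that RC Rfin by (auto simp: meet_ideal_def ku keys_plus_nat Int_Un_distrib2)
      show "\<exists>a\<in>pol V. \<exists>b\<in>meet_ideal V (insert ?C ?F). y = u * a + b" if y: "y \<in> meet_ideal V ?F" for y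
      proof (rule singles_induct[of _ y])
        note D = pidealD[OF pideal_meet_ideal[of V "insert ?C ?F"]]
        show "\<exists>a\<in>pol V. \<exists>b\<in>meet_ideal V (insert ?C ?F). 0 = u * a + b"
          by (intro bexI[of _ 0]) (auto simp: D)
        show "\<exists>a\<in>pol V. \<exists>b\<in>meet_ideal V (insert ?C ?F). p + q = u * a + b"
          if pq: "\<exists>a\<in>pol V. \<exists>b\<in>meet_ideal V (insert ?C ?F). p = u * a + b"
            "\<exists>a\<in>pol V. \<exists>b\<in>meet_ideal V (insert ?C ?F). q = u * a + b" for p q
        proof -
          from pq obtain a b a' b' where "a \<in> pol V" "b \<in> meet_ideal V (insert ?C ?F)" "p = u * a + b"
            "a' \<in> pol V" "b' \<in> meet_ideal V (insert ?C ?F)" "q = u * a' + b'" by metis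
          then show ?thesis
            by (intro bexI[of _ "a + a'"] bexI[of _ "b + b'"]) (auto simp: algebra_simps intro: D)
        qed
        fix m c assume m: "m \<in> keys y"
        then have mV: "keys m \<subseteq> V" and mF: "\<forall>C\<in>?F. keys m \<inter> C \<noteq> {}"
          using y by (auto simp: meet_ideal_def pol_def)
        show "\<exists>a\<in>pol V. \<exists>b\<in>meet_ideal V (insert ?C ?F). single m c = u * a + b"
        proof (cases "keys m \<inter> ?C = {}")
          case True
          have "R \<subseteq> keys m"
          proof
            fix v assume "v \<in> R"
            then obtain k where k: "k < j" "Cs ! k - ?C = {v}" by (auto simp: R_def)
            then have "Cs ! k \<in> ?F" using j by (auto simp: in_set_conv_nth)
            then have "keys m \<inter> Cs ! k \<noteq> {}" using mF by auto
            then obtain x where x: "x \<in> keys m" "x \<in> Cs ! k" by auto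
            then have "x \<in> Cs ! k - ?C" using True by auto
            then show "v \<in> keys m" using k x by simp
          qed
          then obtain h where h: "m = sqf_exp R + h" using sqf_exp_dvd[OF Rfin] by auto
          have "single h c \<in> pol V" using mV h by (intro pol_single) (auto simp: keys_plus_nat)
          moreover have "single m c = u * single h c" by (simp add: u_def h monomial_def mult_single)
          ultimately show ?thesis by (intro bexI[of _ "single h c"] bexI[of _ 0]) (auto simp: D)
        next
          case False
          then show ?thesis using mV mF
            by (intro bexI[of _ 0] bexI[of _ "single m c"]) (auto simp: meet_ideal_def)
        qed
      qed
      show "weakly_regular (pol V) (meet_ideal V {?C}) xs" using reg j by auto
    qed (use xs uV in auto)
    moreover have "weakly_regular (pol V) (meet_ideal V ?F) xs" using Suc by simp
    moreover have "meet_ideal V (insert ?C ?F) \<subseteq> (meet_ideal V ?F :: ('v, 'k) mpoly set)"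
      "meet_ideal V ?F \<subseteq> (pol V :: ('v, 'k) mpoly set)"
      by (auto simp: meet_ideal_def)
    ultimately show ?case unfolding F'
      by (rule_tac weakly_regular_trans[OF pideal_pol pideal_meet_ideal pideal_meet_ideal _ _ xs])
  qed
  from this[of "length Cs"] show ?thesis by simp
qed

section \<open>Hilbert's basis theorem\<close>

lemma gen_finite_subset:
  assumes "x \<in> gen V (range h)"
  shows "\<exists>K. x \<in> gen V (h ` {..<K::nat})"
  using assms
proof induction
  case gen_0
  then show ?case by (auto intro: gen.gen_0)
next
  case (gen_step s r y)
  then obtain K where K: "y \<in> gen V (h ` {..<K})" by auto
  obtain i where i: "s = h i" using gen_step by auto
  let ?L = "max K (Suc i)"
  have "h ` {..<K} \<subseteq> h ` {..<?L}" by auto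
  then have "y \<in> gen V (h ` {..<?L})" using K gen_mono by blast
  moreover have "h i \<in> h ` {..<?L}" by auto
  ultimately show ?case using gen_step i by (intro exI[of _ ?L] gen.gen_step) auto
qed

text \<open>Induction on the variables. Choose elements of \<open>J\<close>, each of least degree in
  \<open>w\<close> outside the ideal of its predecessors. Their leading coefficients generate a
  finitely generated ideal in fewer variables, so one of them is a combination of the previous ones
  and can be cancelled, against minimality.\<close>

lemma hilbert_basis:
  fixes J :: "('v, 'k::field) mpoly set"
  assumes "finite V" "pideal V J"
  shows "\<exists>A. finite A \<and> A \<subseteq> J \<and> J = gen V A"
  using assms
proof (induction V arbitrary: J rule: finite_induct)
  case empty
  note D = pidealD[OF empty]
  show ?case
  proof (cases "J = {0}")
    case True
    then show ?thesis by (intro exI[of _ "{}"]) (auto elim: gen.cases intro: gen_0)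
  next
    case False
    then obtain x where x: "x \<in> J" "x \<noteq> 0" using D(2) by auto
    then have xs: "x = single 0 (lookup x 0)" using D(1) pol_empty by auto
    then have "lookup x 0 \<noteq> 0" using x(2) by auto
    then have "single 0 (inverse (lookup x 0)) * x = single 0 1"
      by (subst (2) xs) (simp add: mult_single)
    then have one: "single 0 (inverse (lookup x 0)) * x = 1" by simp
    have "J \<subseteq> gen {} {x}"
    proof
      fix y assume "y \<in> J"
      then have "(y * single 0 (inverse (lookup x 0))) * x \<in> gen {} {x}"
        using D(1) by (intro gen_base_mult) auto
      then show "y \<in> gen {} {x}" by (simp add: mult.assoc one)
    qed
    then show ?thesis using x gen_minimal[OF empty, of "{x}"] by (intro exI[of _ "{x}"]) auto
  qed
next
  case (insert w V)
  let ?U = "insert w V"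
  have V: "?U - {w} = V" using insert.hyps by auto
  have VU: "p \<in> pol ?U" if "p \<in> pol V" for p using that pol_mono[of V ?U] by auto
  note D = pidealD[OF insert.prems]
  show ?case
  proof (rule ccontr)
    assume nfg: "\<not> ?case"
    \<comment> \<open>Least degree is expressed without naming it: any degree bound satisfied by a
      competitor is satisfied by \<open>x\<close>.\<close>
    let ?P = "\<lambda>f n x. x \<in> J - gen ?U (f ` {..<n}) \<and> (\<forall>g N. g \<in> J - gen ?U (f ` {..<n}) \<longrightarrow> g \<in> lowdeg w N \<longrightarrow> x \<in> lowdeg w N)"
    have "\<exists>f. \<forall>n::nat. ?P f n (f n)"
    proof (rule dependent_wellorder_choice)
      fix r and f g :: "nat \<Rightarrow> ('v, 'k) mpoly" and n
      assume "\<And>y. y < n \<Longrightarrow> f y = g y"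
      then have "f ` {..<n} = g ` {..<n}" by auto
      then show "?P f n r = ?P g n r" by simp
    next
      fix n and f :: "nat \<Rightarrow> ('v, 'k) mpoly"
      assume prev: "\<And>y. y < n \<Longrightarrow> ?P f y (f y)"
      then have sub: "f ` {..<n} \<subseteq> J" by auto
      then have "gen ?U (f ` {..<n}) \<subseteq> J" by (rule gen_minimal[OF insert.prems])
      moreover have "J \<noteq> gen ?U (f ` {..<n})"
      proof
        assume "J = gen ?U (f ` {..<n})"
        then have "finite (f ` {..<n}) \<and> f ` {..<n} \<subseteq> J \<and> J = gen ?U (f ` {..<n})" using sub by simp
        then have "\<exists>A. finite A \<and> A \<subseteq> J \<and> J = gen ?U A" by (rule exI)
        with nfg show False by contradiction
      qed
      ultimately obtain g where g: "g \<in> J - gen ?U (f ` {..<n})" by auto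
      let ?Q = "\<lambda>N. \<exists>g \<in> J - gen ?U (f ` {..<n}). g \<in> lowdeg w N"
      obtain N where "g \<in> lowdeg w N" using lowdeg_exists[of g w] by auto
      then have "?Q N" using g by auto
      then have "\<exists>N. ?Q N" by (rule exI)
      then have "?Q (LEAST N. ?Q N)" by (rule LeastI_ex)
      then obtain x where x: "x \<in> J - gen ?U (f ` {..<n})" "x \<in> lowdeg w (LEAST N. ?Q N)" by auto
      have "x \<in> lowdeg w N" if "g \<in> J - gen ?U (f ` {..<n})" "g \<in> lowdeg w N" for g N
      proof -
        have "(LEAST N. ?Q N) \<le> N" using that by (intro Least_le) auto
        then show ?thesis by (rule lowdeg_mono[OF x(2)])
      qed
      then have "?P f n x" using x(1) by simp
      then show "\<exists>r. ?P f n r" by (rule exI)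
    qed
    then obtain f :: "nat \<Rightarrow> ('v, 'k) mpoly" where "\<forall>n. ?P f n (f n)" by (rule exE)
    then have f: "\<And>n. f n \<in> J - gen ?U (f ` {..<n})"
      and fmin: "\<And>n g N. g \<in> J - gen ?U (f ` {..<n}) \<Longrightarrow> g \<in> lowdeg w N \<Longrightarrow> f n \<in> lowdeg w N"
      by simp_all
    have "\<exists>N h r. h \<in> pol V \<and> h \<noteq> 0 \<and> r \<in> pol ?U \<and> r \<in> lowdeg w N \<and> f n = var w ^ N * h + r" for n
    proof -
      have "f n \<in> pol ?U" "f n \<noteq> 0" using f[of n] D(1) by (auto intro: gen_0)
      from top_exists[OF this, of w] show ?thesis unfolding V by metis
    qed
    then obtain N h r where h: "\<And>n. h n \<in> pol V" "\<And>n. h n \<noteq> 0" "\<And>n. r n \<in> pol ?U" "\<And>n. r n \<in> lowdeg w (N n)"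
      and fn: "\<And>n. f n = var w ^ N n * h n + r n" by metis
    have fdeg: "f n \<in> lowdeg w (Suc (N n))" for n
    proof -
      have "var w ^ N n * h n \<in> lowdeg w (Suc (N n))"
        by (rule var_power_lowdeg[of _ ?U]) (simp add: V h)
      moreover have "r n \<in> lowdeg w (Suc (N n))" using h(4)[of n] by (rule lowdeg_mono) simp
      ultimately show ?thesis unfolding fn[of n] by (rule lowdeg_add)
    qed
    have fnot: "f n \<notin> lowdeg w (N n)" for n
    proof
      assume "f n \<in> lowdeg w (N n)"
      then have "f n - r n \<in> lowdeg w (N n)" using h(4) by (rule lowdeg_diff)
      then have "var w ^ N n * h n \<in> lowdeg w (N n)" by (simp add: fn)
      then have "h n = 0" by (rule var_power_mult_lowdeg_zero)
      then show False using h(2)[of n] by simp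
    qed
    \<comment> \<open>Degrees along the sequence do not decrease, so
      \<open>var w ^ (N K - N i)\<close> can raise an earlier element to the degree of
      \<open>f K\<close>.\<close>
    have Nmono: "N m \<le> N n" if "m \<le> n" for m n
    proof -
      have "gen ?U (f ` {..<m}) \<subseteq> gen ?U (f ` {..<n})" using that by (intro gen_mono) auto
      then have "f n \<in> J - gen ?U (f ` {..<m})" using f[of n] by auto
      then have "f m \<in> lowdeg w (Suc (N n))" by (rule fmin[OF _ fdeg])
      then show ?thesis using fnot[of m] lowdeg_mono[of "f m" w "Suc (N n)" "N m"] by linarith
    qed
    have "pideal V (gen V (range h))" using h by (intro pideal_gen) auto
    from insert.IH[OF this]
    obtain A where A: "finite A" "gen V (range h) = gen V A" "A \<subseteq> gen V (range h)" by auto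
    have "\<exists>K. A \<subseteq> gen V (h ` {..<K})"
      using A(1,3)
    proof (induction A rule: finite_induct)
      case (insert a A)
      then obtain K where K: "A \<subseteq> gen V (h ` {..<K})" by auto
      obtain L where L: "a \<in> gen V (h ` {..<L})" using gen_finite_subset[of a V h] insert.prems by auto
      have "gen V (h ` {..<K}) \<subseteq> gen V (h ` {..<max K L})" "gen V (h ` {..<L}) \<subseteq> gen V (h ` {..<max K L})"
        by (intro gen_mono; auto)+
      then show ?case using K L by (intro exI[of _ "max K L"]) auto
    qed auto
    then obtain K where K: "A \<subseteq> gen V (h ` {..<K})" by auto
    \<comment> \<open>Lifts a combination of leading coefficients to an element of the ideal that
      has this combination as its coefficient of \<open>var w ^ N K\<close>.\<close>
    have red: "\<exists>y\<in>gen ?U (f ` {..<K}). y - var w ^ N K * x \<in> lowdeg w (N K)" if "x \<in> gen V (h ` {..<K})" for x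
      using that
    proof induction
      case gen_0
      then show ?case by (intro bexI[of _ 0]) (auto intro: gen.gen_0)
    next
      case (gen_step s p x)
      then obtain y i where y: "y \<in> gen ?U (f ` {..<K})" "y - var w ^ N K * x \<in> lowdeg w (N K)"
        and i: "i < K" "s = h i" by auto
      have Ni: "N i \<le> N K" using Nmono i by auto
      have "(var w ^ (N K - N i) * p) * r i \<in> lowdeg w (N K - N i + N i)"
        by (rule lowdeg_mult[OF var_power_lowdeg[of _ ?U] h(4)]) (simp add: V gen_step)
      then have "(var w ^ (N K - N i) * p) * r i + (y - var w ^ N K * x) \<in> lowdeg w (N K)"
        using Ni y by (intro lowdeg_add) auto
      moreover have "(var w ^ (N K - N i) * p) * f i + y - var w ^ N K * (p * s + x)
          = (var w ^ (N K - N i) * p) * r i + (y - var w ^ N K * x)"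
      proof -
        have "var w ^ N K = (var w ^ (N K - N i) * var w ^ N i :: ('v, 'k) mpoly)"
          using Ni by (simp add: power_add[symmetric])
        then show ?thesis unfolding fn[of i] i by (simp add: algebra_simps)
      qed
      moreover have "(var w ^ (N K - N i) * p) * f i + y \<in> gen ?U (f ` {..<K})"
        using i y VU[OF gen_step(2)] by (intro gen.gen_step) auto
      ultimately show ?case by (intro bexI[of _ "(var w ^ (N K - N i) * p) * f i + y"]) (simp_all only:)
    qed
    have "h K \<in> gen V (range h)" by (rule gen_base) auto
    then have "h K \<in> gen V A" using A(2) by simp
    then have "h K \<in> gen V (h ` {..<K})" using gen_sub[OF K] by auto
    from red[OF this] obtain y where y: "y \<in> gen ?U (f ` {..<K})" "y - var w ^ N K * h K \<in> lowdeg w (N K)" by auto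
    have "r K - (y - var w ^ N K * h K) \<in> lowdeg w (N K)" by (rule lowdeg_diff[OF h(4) y(2)])
    moreover have "f K - y = r K - (y - var w ^ N K * h K)" by (simp add: fn)
    ultimately have "f K - y \<in> lowdeg w (N K)" by (simp only:)
    moreover have "f K - y \<in> J - gen ?U (f ` {..<K})"
    proof -
      have sub: "f ` {..<K} \<subseteq> J" using f by auto
      then have "y \<in> J" using y(1) gen_minimal[OF insert.prems sub] by auto
      moreover have "f K - y \<notin> gen ?U (f ` {..<K})"
      proof
        assume "f K - y \<in> gen ?U (f ` {..<K})"
        from gen_add[OF this y(1)] show False using f[of K] by simp
      qed
      ultimately show ?thesis using f[of K] D by auto
    qed
    ultimately have "f K \<in> lowdeg w (N K)" by (intro fmin[of "f K - y" K])
    then show False using fnot[of K] by simp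
  qed
qed


section \<open>Nullstellensatz\<close>

text \<open>\<open>M\<close> together with combinations of \<open>B\<close> over \<open>D\<close>.
  Keeping \<open>D\<close> as a parameter lets it be the multiples of \<open>a\<close> in the
  hypothesis of \<open>nakayama\<close>.\<close>

inductive_set lspan :: "('v, 'k::field) mpoly set \<Rightarrow> ('v, 'k) mpoly set
    \<Rightarrow> ('v, 'k) mpoly set \<Rightarrow> ('v, 'k) mpoly set"
  for D M B where
  lspan_base: "x \<in> M \<Longrightarrow> x \<in> lspan D M B"
| lspan_step: "p \<in> D \<Longrightarrow> b \<in> B \<Longrightarrow> y \<in> lspan D M B \<Longrightarrow> p * b + y \<in> lspan D M B"

lemma lspan_add:
  assumes "x \<in> lspan D M B" "y \<in> lspan D M B" "\<And>x y. x \<in> M \<Longrightarrow> y \<in> M \<Longrightarrow> x + y \<in> M"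
  shows "x + y \<in> lspan D M B"
  using assms(1)
proof induction
  case (lspan_base x)
  show ?case using assms(2)
  proof induction
    case (lspan_step p b z)
    then show ?case using lspan.lspan_step[of p D b B "x + z" M] by (simp add: algebra_simps)
  qed (use lspan_base assms(3) in \<open>auto intro: lspan.lspan_base\<close>)
qed (auto simp: add.assoc intro: lspan.lspan_step)

lemma lspan_mult:
  assumes "x \<in> lspan D M B" "\<And>x. x \<in> M \<Longrightarrow> r * x \<in> M" "\<And>p. p \<in> D \<Longrightarrow> r * p \<in> D'"
  shows "r * x \<in> lspan D' M B"
  using assms(1)
proof induction
  case (lspan_step p b y)
  then have "(r * p) * b + r * y \<in> lspan D' M B" using assms(3) by (intro lspan.lspan_step) auto
  then show ?case by (simp add: algebra_simps)
qed (use assms in \<open>auto intro: lspan.lspan_base\<close>)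

lemma lspan_insertD:
  assumes "x \<in> lspan D M (insert b B)" "0 \<in> D" "\<And>p q. p \<in> D \<Longrightarrow> q \<in> D \<Longrightarrow> p + q \<in> D"
  shows "\<exists>p\<in>D. \<exists>y\<in>lspan D M B. x = p * b + y"
  using assms(1)
proof induction
  case (lspan_base x)
  then show ?case using assms(2) by (intro bexI[of _ 0] bexI[of _ x]) (auto intro: lspan.lspan_base)
next
  case (lspan_step q c y)
  then obtain p z where pz: "p \<in> D" "z \<in> lspan D M B" "y = p * b + z" by auto
  show ?case
  proof (cases "c = b")
    case True
    then show ?thesis using pz lspan_step assms(3)
      by (intro bexI[of _ "q + p"] bexI[of _ z]) (auto simp: algebra_simps)
  next
    case False
    then have "q * c + z \<in> lspan D M B" using pz lspan_step by (intro lspan.lspan_step) auto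
    moreover have "q * c + y = p * b + (q * c + z)" by (simp add: pz algebra_simps)
    ultimately show ?thesis using pz(1) by blast
  qed
qed

text \<open>Nakayama's lemma for the ideal generated by \<open>a\<close>, proved by eliminating the
  generators one by one; the multipliers stay congruent to powers of \<open>c\<close> modulo \<open>a\<close>.\<close>

lemma nakayama:
  fixes a c :: "('v, 'k::field) mpoly" and T :: "'v set"
  defines "S \<equiv> {s. \<exists>n. \<exists>d\<in>pol T. s = c ^ n + a * d}"
  assumes "finite B" and M: "pideal V M" and T: "T \<subseteq> V" and ac: "a \<in> pol T" "c \<in> pol T"
    and B: "\<forall>b\<in>B. \<exists>s\<in>S. s * b \<in> lspan ((*) a ` pol T) M B"
  shows "\<exists>s\<in>S. \<forall>b\<in>B. s * b \<in> M"
  using assms(2) B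
proof (induction B rule: finite_induct)
  case empty
  have "1 = c ^ 0 + a * 0" by simp
  then have "1 \<in> S" unfolding S_def using pol_0 by blast
  then show ?case by auto
next
  case (insert b B)
  let ?D = "(*) a ` pol T"
  note MD = pidealD[OF M]
  have TV: "pol T \<subseteq> (pol V :: ('v, 'k) mpoly set)" using T by (rule pol_mono)
  have Spol: "s \<in> pol T" if "s \<in> S" for s using that ac by (auto simp: S_def)
  have Smult: "s * t \<in> S" if st: "s \<in> S" "t \<in> S" for s t
  proof -
    from st obtain m d n e where "d \<in> pol T" "s = c ^ m + a * d" "e \<in> pol T" "t = c ^ n + a * e" by (auto simp: S_def)
    then have "s * t = c ^ (m + n) + a * (c ^ m * e + d * c ^ n + a * d * e)"
      "c ^ m * e + d * c ^ n + a * d * e \<in> pol T"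
      using ac by (auto simp: algebra_simps power_add)
    then show ?thesis unfolding S_def by blast
  qed
  have Sdiff: "s - a * p \<in> S" if sp: "s \<in> S" "p \<in> pol T" for s p
  proof -
    from sp obtain m d where "d \<in> pol T" "s = c ^ m + a * d" by (auto simp: S_def)
    then have "s - a * p = c ^ m + a * (d - p)" "d - p \<in> pol T" using sp by (auto simp: algebra_simps)
    then show ?thesis unfolding S_def by blast
  qed
  have Dadd: "p + q \<in> ?D" if "p \<in> ?D" "q \<in> ?D" for p q
    using that by (auto simp: distrib_left[symmetric])
  have D0: "0 \<in> ?D" using image_eqI[of 0 "(*) a" 0 "pol T"] by simp
  have lm: "r * x \<in> lspan ?D M B" if "r \<in> pol T" "x \<in> lspan ?D M B" for r x
    using that TV MD by (intro lspan_mult[of x ?D]) (auto simp: mult.left_commute)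
  have ladd: "x + y \<in> lspan ?D M B" if "x \<in> lspan ?D M B" "y \<in> lspan ?D M B" for x y
    using that MD by (intro lspan_add) auto
  obtain s0 where s0: "s0 \<in> S" "s0 * b \<in> lspan ?D M (insert b B)" using insert.prems by auto
  from lspan_insertD[OF s0(2) D0 Dadd] obtain p y where
    py: "p \<in> pol T" "y \<in> lspan ?D M B" "s0 * b = a * p * b + y" by auto
  \<comment> \<open>The term with \<open>b\<close> on the right is moved to the left. Its
    coefficient is a multiple of \<open>a\<close>, so the new multiplier remains in
    \<open>S\<close>, and \<open>b\<close> can be eliminated.\<close>
  define s1 where "s1 = s0 - a * p"
  have s1: "s1 \<in> S" using Sdiff[OF s0(1) py(1)] by (simp add: s1_def)
  have s1b: "s1 * b = y" using py(3) by (simp add: s1_def left_diff_distrib)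
  have "\<exists>s\<in>S. s * b' \<in> lspan ?D M B" if b': "b' \<in> B" for b'
  proof -
    obtain s' where s': "s' \<in> S" "s' * b' \<in> lspan ?D M (insert b B)" using insert.prems b' by auto
    from lspan_insertD[OF s'(2) D0 Dadd] obtain q z where
      qz: "q \<in> pol T" "z \<in> lspan ?D M B" "s' * b' = a * q * b + z" by auto
    \<comment> \<open>Scaling the relation for \<open>b'\<close> by \<open>s1\<close> turns its
      \<open>b\<close> term into a multiple of \<open>y\<close>, whose expression no longer uses
      \<open>b\<close>.\<close>
    have "(s1 * s') * b' = s1 * (s' * b')" by (simp add: mult.assoc)
    also have "\<dots> = (a * q) * y + s1 * z" unfolding qz(3) s1b[symmetric] by (simp add: algebra_simps)
    finally have "(s1 * s') * b' \<in> lspan ?D M B"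
      using lm[of "a * q" y] lm[of s1 z] ladd qz py ac Spol s1 by auto
    then show ?thesis using Smult s1 s' by blast
  qed
  then obtain s where s: "s \<in> S" "\<forall>b\<in>B. s * b \<in> M" using insert.IH by blast
  have "s * x \<in> M" if "x \<in> lspan ?D M B" for x
    using that
  proof induction
    case (lspan_base x)
    then show ?case using MD(4)[of s x] Spol[OF s(1)] TV by auto
  next
    case (lspan_step p b y)
    then have "p \<in> pol V" "s * b \<in> M" using s TV ac by auto
    then have "p * (s * b) \<in> M" by (rule MD(4))
    from MD(3)[OF this lspan_step.IH] have "p * (s * b) + s * y \<in> M" .
    then show ?case by (simp add: algebra_simps)
  qed
  then have "s * y \<in> M" using py by auto
  then have "(s * s1) * b \<in> M" using s1b by (simp add: mult.assoc)
  moreover have "(s * s1) * b' \<in> M" if "b' \<in> B" for b'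
  proof -
    have "s1 * (s * b') \<in> M" using s that MD(4) Spol[OF s1] TV by auto
    then show ?thesis by (simp add: algebra_simps)
  qed
  ultimately show ?case using Smult s s1 by blast
qed

lemma exp_induct [consumes 1, case_names zero step]:
  fixes m :: "'v \<Rightarrow>\<^sub>0 nat"
  assumes "keys m \<subseteq> V" "P 0"
    "\<And>w m. w \<in> V \<Longrightarrow> keys m \<subseteq> V \<Longrightarrow> P m \<Longrightarrow> P (single w 1 + m)"
  shows "P m"
  using assms(1)
proof (induction "mon_degree m" arbitrary: m)
  case 0
  then have "m = 0" by (intro poly_mapping_eqI) (auto simp: mon_degree_def in_keys_iff)
  then show ?case using assms(2) by simp
next
  case (Suc n)
  then have "keys m \<noteq> {}" by (auto simp: mon_degree_def)
  then obtain w where w: "w \<in> keys m" by blast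
  define m' where "m' = m - single w 1"
  have m: "m = single w 1 + m'"
    unfolding m'_def using w by (intro exp_le_split) (auto simp: lookup_single when_def in_keys_iff Suc_le_eq)
  have km: "keys m = insert w (keys m')" unfolding m by (simp add: keys_plus_nat)
  have "mon_degree m = (\<Sum>x\<in>keys m. lookup m' x + (if x = w then 1 else 0))"
    unfolding mon_degree_def by (rule sum.cong) (auto simp: m lookup_add lookup_single when_def)
  also have "\<dots> = (\<Sum>x\<in>keys m. lookup m' x) + 1" using w by (simp add: sum.distrib)
  also have "(\<Sum>x\<in>keys m. lookup m' x) = mon_degree m'"
    unfolding mon_degree_def by (rule sum.mono_neutral_right) (auto simp: km in_keys_iff)
  finally have "P m'" using Suc km by auto
  then have "P (single w 1 + m')" using Suc(3) km by (intro assms(3)) auto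
  then show ?case using m by simp
qed

text \<open>\<open>1 + x c\<close> is prime to \<open>c\<close>, so it would have to be a unit.\<close>

lemma one_plus_not_dvd_power:
  fixes c :: "('v, 'k::field) mpoly"
  assumes c: "c \<noteq> 0" and eq: "c ^ n = (1 + var w * c) * d"
  shows False
proof -
  let ?a = "1 + var w * c"
  \<comment> \<open>Modulo \<open>?a\<close> the product \<open>var w * c\<close> is -1, so a power
    of \<open>c\<close> divisible by \<open>?a\<close> would make \<open>?a\<close> a unit.\<close>
  have "\<exists>e. (var w * c) ^ n = (- 1) ^ n + ?a * e" for n
  proof (induction n)
    case (Suc n)
    then obtain e where "(var w * c) ^ n = (- 1) ^ n + ?a * e" by auto
    then have "(var w * c) ^ Suc n = (- 1) ^ Suc n + ?a * ((- 1) ^ n + var w * c * e)"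
      by (simp add: algebra_simps)
    then show ?case by blast
  qed (auto intro: exI[of _ 0])
  then obtain e where e: "(var w * c) ^ n = (- 1) ^ n + ?a * e" by blast
  have "var w ^ n * c ^ n = (- 1) ^ n + ?a * e" using e by (simp add: power_mult_distrib)
  then have "(- 1) ^ n = ?a * (var w ^ n * d - e)" unfolding eq by (simp add: algebra_simps)
  then have "(- 1) ^ n * (- 1) ^ n = ?a * ((var w ^ n * d - e) * (- 1) ^ n)" by (simp add: mult.assoc)
  moreover have "(- 1) ^ n * (- 1) ^ n = (1 :: ('v, 'k) mpoly)" by (simp add: power_mult_distrib[symmetric])
  ultimately obtain u where u: "1 = ?a * u" by auto
  have "c \<in> pol UNIV" "u \<in> pol UNIV" by (auto simp: pol_def)
  obtain N h r where c': "h \<in> pol (UNIV - {w})" "h \<noteq> 0" "r \<in> lowdeg w N" "c = var w ^ N * h + r"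
    using top_exists[OF \<open>c \<in> pol UNIV\<close> c, of w] by metis
  have "u \<noteq> 0" using u by auto
  obtain M h' r' where u': "h' \<in> pol (UNIV - {w})" "h' \<noteq> 0" "r' \<in> lowdeg w M" "u = var w ^ M * h' + r'"
    using top_exists[OF \<open>u \<in> pol UNIV\<close> \<open>u \<noteq> 0\<close>, of w] by metis
  \<comment> \<open>A unit has degree 0 in \<open>w\<close>, but the leading part of
    \<open>?a\<close> carries \<open>var w ^ Suc N\<close>.\<close>
  have "(var w :: ('v, 'k) mpoly) \<in> lowdeg w (Suc 1)" by (simp add: var_def monomial_def lowdeg_def)
  then have "var w * r \<in> lowdeg w (1 + N)" using c'(3) by (rule lowdeg_mult)
  moreover have "(1 :: ('v, 'k) mpoly) \<in> lowdeg w (1 + N)" by (simp add: lowdeg_def)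
  ultimately have "1 + var w * r \<in> lowdeg w (Suc N)" using lowdeg_add by fastforce
  moreover have "?a = var w ^ Suc N * h + (1 + var w * r)" unfolding c'(4) by (simp add: algebra_simps)
  ultimately have top: "?a * u - var w ^ (Suc N + M) * (h * h') \<in> lowdeg w (Suc N + M)"
    using c'(1) u' by (intro top_mult) auto
  have "(1 :: ('v, 'k) mpoly) \<in> lowdeg w (Suc N + M)" by (simp add: lowdeg_def)
  from lowdeg_diff[OF this top]
  have "1 - (?a * u - var w ^ (Suc N + M) * (h * h')) \<in> lowdeg w (Suc N + M)" .
  then have "var w ^ (Suc N + M) * (h * h') \<in> lowdeg w (Suc N + M)" unfolding u[symmetric] by simp
  then have "h * h' = 0" by (rule var_power_mult_lowdeg_zero)
  then show False using mpoly_domain c' u' by blast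
qed


lemma exp_box:
  fixes D :: "'v \<Rightarrow> nat"
  assumes F: "finite F"
  shows "finite {m. keys m \<subseteq> F \<and> (\<forall>v\<in>F. lookup m v \<le> D v)}"
    and "card {m. keys m \<subseteq> F \<and> (\<forall>v\<in>F. lookup m v \<le> D v)} \<le> (\<Prod>v\<in>F. D v + 1)"
proof -
  let ?E = "{m. keys m \<subseteq> F \<and> (\<forall>v\<in>F. lookup m v \<le> D v)}" and ?f = "\<lambda>m. restrict (lookup m) F"
  have inj: "inj_on ?f ?E"
  proof (rule inj_onI, rule poly_mapping_eqI)
    fix m n v assume mn: "m \<in> ?E" "n \<in> ?E" "?f m = ?f n"
    show "lookup m v = lookup n v"
    proof (cases "v \<in> F")
      case True
      then show ?thesis using fun_cong[OF mn(3), of v] by simp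
    next
      case False
      then have "v \<notin> keys m" "v \<notin> keys n" using mn by auto
      then show ?thesis by (simp add: in_keys_iff)
    qed
  qed
  have sub: "?f ` ?E \<subseteq> PiE F (\<lambda>v. {..D v})" by auto
  have fin: "finite (PiE F (\<lambda>v. {..D v}))" using F by (intro finite_PiE) auto
  show "finite ?E" using finite_imageD[OF finite_subset[OF sub fin] inj] .
  have "card ?E = card (?f ` ?E)" using inj by (simp add: card_image)
  also have "\<dots> \<le> card (PiE F (\<lambda>v. {..D v}))" by (rule card_mono[OF fin sub])
  also have "\<dots> = (\<Prod>v\<in>F. D v + 1)" using F by (simp add: card_PiE)
  finally show "card ?E \<le> (\<Prod>v\<in>F. D v + 1)" .
qed

lemma mpoly_prod_nonzero:
  fixes h :: "'a \<Rightarrow> ('v, 'k::field) mpoly"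
  assumes "finite A" "\<And>a. a \<in> A \<Longrightarrow> h a \<noteq> 0"
  shows "prod h A \<noteq> 0"
  using assms
proof (induction A rule: finite_induct)
  case (insert a A)
  then show ?case using mpoly_domain[of "h a" "prod h A"] by auto
qed simp

text \<open>\<open>T\<close> is a maximal set of variables that are algebraically independent modulo \<open>M\<close>.
  After inverting a common leading coefficient \<open>c\<close> of the equations of the other variables,
  the ring modulo \<open>M\<close> is a finite module over \<open>pol T\<close>, and \<open>1 + x c\<close> violates Nakayama's lemma.\<close>

lemma nullstellensatz:
  fixes M :: "('v, 'k::field) mpoly set"
  assumes fin: "finite V" and M: "pideal V M"
    and max: "\<And>f. f \<in> pol V \<Longrightarrow> f \<notin> M \<Longrightarrow> \<exists>g\<in>pol V. f * g - 1 \<in> M" and v: "v \<in> V"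
  shows "\<exists>q\<in>M \<inter> pol {v}. q \<noteq> 0"
proof (rule ccontr)
  assume neg: "\<not> ?thesis"
  \<comment> \<open>The negated claim says that the singleton of \<open>v\<close> is such a set, so
    \<open>v\<close> survives in a maximal \<open>T\<close> and can be used in
    \<open>a\<close>.\<close>
  let ?I = "{T. T \<subseteq> V \<and> v \<in> T \<and> pol T \<inter> M \<subseteq> {0}}"
  note MD = pidealD[OF M]
  have "finite ?I" by (rule finite_subset[of _ "Pow V"]) (use fin in auto)
  moreover have "{v} \<in> ?I" using neg v by auto
  ultimately have "\<exists>T\<in>?I. {v} \<subseteq> T \<and> (\<forall>T'\<in>?I. T \<subseteq> T' \<longrightarrow> T = T')"
    by (rule finite_has_maximal2)
  then obtain T where T: "T \<in> ?I" and "\<forall>T'\<in>?I. T \<subseteq> T' \<longrightarrow> T = T'" by (elim bexE conjE)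
  then have Tmax: "T = T'" if "T' \<in> ?I" "T \<subseteq> T'" for T' using that by (elim ballE[where x = T']) simp_all
  have TV: "T \<subseteq> V" and vT: "v \<in> T" and TM: "\<And>f. f \<in> pol T \<Longrightarrow> f \<in> M \<Longrightarrow> f = 0" using T by auto
  have TVp: "\<And>p. p \<in> pol T \<Longrightarrow> p \<in> (pol V :: ('v, 'k) mpoly set)"
    using pol_mono[OF TV] by auto
  let ?U = "V - T"
  let ?Q = "\<lambda>u N h r. h \<in> pol T \<and> h \<noteq> 0 \<and> r \<in> pol (insert u T) \<and> r \<in> lowdeg u N \<and> N > 0 \<and> var u ^ N * h + r \<in> M"
  have "\<exists>N h r. ?Q u N h r"
    if u: "u \<in> ?U" for u
  proof -
    have "insert u T \<notin> ?I" using Tmax[of "insert u T"] u by auto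
    then obtain f where f: "f \<in> pol (insert u T)" "f \<in> M" "f \<noteq> 0" using u TV vT by auto
    have 1: "insert u T - {u} = T" using u by auto
    obtain N h r where hr: "h \<in> pol T" "h \<noteq> 0" "r \<in> pol (insert u T)" "r \<in> lowdeg u N" "f = var u ^ N * h + r"
      using top_exists[OF f(1,3), of u] unfolding 1 by metis
    \<comment> \<open>With degree 0 in \<open>u\<close> the relation would lie in
      \<open>pol T\<close>, where \<open>M\<close> has only zero.\<close>
    have "N \<noteq> 0"
    proof
      assume "N = 0"
      then have "r = 0" using hr(4) keys_nonempty[of r] by (auto simp: lowdeg_def)
      then have "f = h" using hr \<open>N = 0\<close> by simp
      then show False using TM f hr by auto
    qed
    then show ?thesis using hr f by blast
  qed
  then have "\<forall>u\<in>?U. \<exists>N h r. ?Q u N h r" by (intro ballI)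
  from bchoice[OF this] obtain N where "\<forall>u\<in>?U. \<exists>h r. ?Q u (N u) h r" by (rule exE)
  from bchoice[OF this] obtain h where "\<forall>u\<in>?U. \<exists>r. ?Q u (N u) (h u) r" by (rule exE)
  from bchoice[OF this] obtain r where "\<forall>u\<in>?U. ?Q u (N u) (h u) (r u)" by (rule exE)
  then have rel: "\<And>u. u \<in> ?U \<Longrightarrow> h u \<in> pol T" "\<And>u. u \<in> ?U \<Longrightarrow> h u \<noteq> 0"
    "\<And>u. u \<in> ?U \<Longrightarrow> r u \<in> pol (insert u T)" "\<And>u. u \<in> ?U \<Longrightarrow> r u \<in> lowdeg u (N u)"
    "\<And>u. u \<in> ?U \<Longrightarrow> N u > (0::nat)" "\<And>u. u \<in> ?U \<Longrightarrow> var u ^ N u * h u + r u \<in> M"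
    by simp_all
  define c where "c = (\<Prod>u\<in>?U. h u)"
  have cT: "c \<in> pol T" using rel by (auto simp: c_def)
  have c0: "c \<noteq> 0" unfolding c_def by (rule mpoly_prod_nonzero) (use fin rel(2) in auto)
  \<comment> \<open>Each exponent stays below the degree \<open>N u\<close> of the equation of its
    variable. Up to powers of \<open>c\<close>, these monomials span everything over
    \<open>pol T\<close> modulo \<open>M\<close>.\<close>
  define E where "E = {m. keys m \<subseteq> ?U \<and> (\<forall>u\<in>?U. lookup m u \<le> N u - 1)}"
  define B where "B = (monomial ` E :: ('v, 'k) mpoly set)"
  have finB: "finite B" unfolding B_def E_def using fin by (intro finite_imageI exp_box) auto
  let ?L = "lspan (pol T) M B"
  have ladd: "x + y \<in> ?L" if "x \<in> ?L" "y \<in> ?L" for x y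
    using that MD by (intro lspan_add) auto
  have lmult: "p * x \<in> ?L" if "p \<in> pol T" "x \<in> ?L" for x p
    using that MD TVp by (intro lspan_mult[of x "pol T"]) auto
  have lbase: "p * monomial m \<in> ?L" if "p \<in> pol T" "m \<in> E" for p m
  proof -
    have "monomial m \<in> B" using that by (simp add: B_def)
    from lspan_step[OF that(1) this lspan_base[OF MD(2)]] show ?thesis by simp
  qed
  have mult_var: "c * (var u * x) \<in> ?L" if u: "u \<in> ?U" and x: "x \<in> ?L" for u x
    using x
  proof induction
    case (lspan_base x)
    then have "(c * var u) * x \<in> M" using u TVp[OF cT] by (intro MD(4)) auto
    then show ?case by (auto simp: mult.assoc intro: lspan.lspan_base)
  next
    case (lspan_step p b y)
    obtain m where m: "m \<in> E" "b = monomial m" using lspan_step by (auto simp: B_def)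
    have "c * (var u * b) \<in> ?L"
    proof (cases "Suc (lookup m u) \<le> N u - 1")
      case True
      then have "single u 1 + m \<in> E" using m u
        by (auto simp: E_def keys_plus_nat lookup_add lookup_single when_def)
      from lbase[OF cT this] show ?thesis by (simp add: m var_def monomial_def mult_single)
    next
      case False
      moreover have "lookup m u \<le> N u - 1" using m u unfolding E_def by blast
      ultimately have mu: "lookup m u = N u - 1" by linarith
      \<comment> \<open>The exponent of \<open>u\<close> is maximal, so one more factor produces
        \<open>var u ^ N u\<close>, which the equation of \<open>u\<close> rewrites;
        \<open>c'\<close> supplies the other leading coefficients in \<open>c\<close>.\<close>
      define m' where "m' = m - single u (N u - 1)"
      have mm: "m = single u (N u - 1) + m'"
        unfolding m'_def by (intro exp_le_split) (auto simp: lookup_single when_def mu)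
      have m'u: "lookup m' u = 0" by (simp add: m'_def lookup_minus mu)
      have m'E: "single u i + m' \<in> E" if "i < N u" for i
        unfolding E_def
      proof (intro CollectI conjI ballI)
        have "keys m' \<subseteq> ?U" using m mm by (auto simp: E_def keys_plus_nat)
        then show "keys (single u i + m') \<subseteq> ?U" using u by (auto simp: keys_plus_nat split: if_splits)
        fix x assume x: "x \<in> ?U"
        have "lookup m x = lookup (single u (N u - 1)) x + lookup m' x"
          by (subst mm) (rule lookup_add)
        moreover have "lookup m x \<le> N x - 1" using m(1) x unfolding E_def by blast
        ultimately have "lookup m' x \<le> N x - 1" by linarith
        then show "lookup (single u i + m') x \<le> N x - 1"
          using that m'u by (auto simp: lookup_add lookup_single when_def)
      qed
      define c' where "c' = (\<Prod>u\<in>?U - {u}. h u)"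
      have c'T: "c' \<in> pol T" using rel by (auto simp: c'_def)
      have cc': "c = c' * h u" unfolding c_def c'_def using fin u by (subst prod.remove[of _ u]) (auto simp: mult.commute)
      have "r u * monomial m' \<in> ?L"
      proof (rule singles_induct[of "\<lambda>f. f * monomial m' \<in> ?L"])
        show "0 * monomial m' \<in> ?L" by (simp add: lspan_base MD)
        show "(p + q) * monomial m' \<in> ?L" if "p * monomial m' \<in> ?L" "q * monomial m' \<in> ?L" for p q
          using ladd[OF that] by (simp add: distrib_right)
        fix k a assume k: "k \<in> keys (r u)"
        let ?i = "lookup k u"
        define k' where "k' = k - single u ?i"
        have kk: "k = single u ?i + k'"
          unfolding k'_def by (intro exp_le_split) (auto simp: lookup_single when_def)
        have "?i < N u" using k rel(4)[OF u] by (auto simp: lowdeg_def)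
        moreover have "keys k' \<subseteq> T"
        proof
          fix x assume "x \<in> keys k'"
          moreover have "keys k \<subseteq> insert u T" using k rel(3)[OF u] by (auto simp: pol_def)
          moreover have "keys k' \<subseteq> keys k" by (auto simp: k'_def in_keys_iff lookup_minus)
          ultimately have "x \<in> insert u T" by blast
          moreover have "x \<noteq> u" using \<open>x \<in> keys k'\<close> by (auto simp: k'_def in_keys_iff lookup_minus)
          ultimately show "x \<in> T" by simp
        qed
        ultimately have "single k' a * monomial (single u ?i + m') \<in> ?L" using m'E by (intro lbase) auto
        moreover have "single k' a * monomial (single u ?i + m') = single k a * monomial m'"
        proof -
          have "single k' a * monomial (single u ?i + m') = single (single u ?i + k' + m') a"
            by (simp add: monomial_def mult_single ac_simps)
          also have "\<dots> = single (k + m') a" by (subst (2) kk) (rule refl)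
          finally show ?thesis by (simp add: monomial_def mult_single)
        qed
        ultimately show "single k a * monomial m' \<in> ?L" by simp
      qed
      from lmult[OF pol_uminus[OF c'T] this] have 1: "(- c') * (r u * monomial m') \<in> ?L" .
      have "keys m' \<subseteq> V" using m'E[of 0] rel(5)[OF u] by (auto simp: E_def)
      then have "(c' * monomial m') * (var u ^ N u * h u + r u) \<in> M"
        using rel(6)[OF u] TVp[OF c'T] by (intro MD(4)) auto
      then have "(- c') * (r u * monomial m') + (c' * monomial m') * (var u ^ N u * h u + r u) \<in> ?L"
        using ladd[OF 1 lspan_base] by blast
      moreover have "(- c') * (r u * monomial m') + (c' * monomial m') * (var u ^ N u * h u + r u) = c * (var u * b)"
      proof -
        have "var u ^ N u = (var u * var u ^ (N u - 1) :: ('v, 'k) mpoly)"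
          using rel(5)[OF u] by (simp add: power_Suc[symmetric] del: power_Suc)
        moreover have "b = var u ^ (N u - 1) * monomial m'"
          by (simp add: m(2) mm var_power monomial_def mult_single)
        ultimately show ?thesis by (simp add: cc' algebra_simps)
      qed
      ultimately show ?thesis by simp
    qed
    from ladd[OF lmult[OF lspan_step(1) this] lspan_step.IH]
    have "p * (c * (var u * b)) + c * (var u * y) \<in> ?L" .
    then show ?case by (simp add: algebra_simps)
  qed
  let ?G = "\<lambda>f. \<exists>n. c ^ n * f \<in> ?L"
  have up: "c ^ (n + k) * f \<in> ?L" if "c ^ n * f \<in> ?L" for n k f
    using lmult[OF _ that, of "c ^ k"] cT by (simp add: power_add ac_simps)
  have "?G (single m a)" if "keys m \<subseteq> V" for m a
    using that
  proof (induction rule: exp_induct)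
    case zero
    have "0 \<in> E" by (simp add: E_def)
    from lbase[OF _ this, of "single 0 a"] have "c ^ 0 * single 0 a \<in> ?L"
      by (simp add: monomial_def)
    then show ?case by blast
  next
    case (step w m)
    then obtain n where n: "c ^ n * single m a \<in> ?L" by auto
    have eq: "single (single w 1 + m) a = var w * single m a" by (simp add: var_def monomial_def mult_single)
    show ?case
    proof (cases "w \<in> T")
      case True
      from lmult[OF _ n, of "var w"] have "c ^ n * (var w * single m a) \<in> ?L"
        using True by (simp add: mult.left_commute)
      then show ?thesis unfolding eq by blast
    next
      case False
      then have "c * (var w * (c ^ n * single m a)) \<in> ?L" using step.hyps n by (intro mult_var) auto
      moreover have "c ^ Suc n * (var w * single m a) = c * (var w * (c ^ n * single m a))" by (simp add: ac_simps)
      ultimately have "c ^ Suc n * (var w * single m a) \<in> ?L" by (simp only:)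
      then show ?thesis unfolding eq by blast
    qed
  qed
  moreover have "?G (f + g)" if fg: "?G f" "?G g" for f g
  proof -
    obtain n k where n: "c ^ n * f \<in> ?L" and k: "c ^ k * g \<in> ?L" using fg by auto
    have "c ^ (n + k) * f + c ^ (k + n) * g \<in> ?L" by (rule ladd[OF up[OF n] up[OF k]])
    then show ?thesis by (intro exI[of _ "n + k"]) (simp add: algebra_simps)
  qed
  moreover have "?G 0" by (intro exI[of _ 0]) (simp add: lspan_base MD)
  ultimately have G: "?G f" if fV: "f \<in> pol V" for f
    by (intro singles_induct[of ?G f]) (use fV in \<open>auto simp: pol_def\<close>)
  \<comment> \<open>\<open>a\<close> is a nonzero element of \<open>pol T\<close>, hence invertible
    modulo \<open>M\<close> with some inverse \<open>g\<close>. So every \<open>b\<close> in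
    \<open>B\<close> is congruent to \<open>a * g * b\<close>, which gives the hypothesis of
    \<open>nakayama\<close>.\<close>
  define a where "a = 1 + var v * c"
  have aT: "a \<in> pol T" using vT cT by (auto simp: a_def)
  have "a \<noteq> 0"
  proof
    assume "a = 0"
    moreover have "lookup a 0 = 1"
    proof -
      have "0 \<notin> keys (var v * c)"
      proof
        assume "0 \<in> keys (var v * c)"
        then obtain k where "0 = single v (Suc 0) + k" by (auto simp: var_def monomial_def keys_single_mult)
        then have "lookup 0 v = lookup (single v (Suc 0) + k) v" by (rule arg_cong)
        then show False by (simp add: lookup_add)
      qed
      then show ?thesis by (simp add: a_def lookup_add in_keys_iff)
    qed
    ultimately show False by simp
  qed
  then have "a \<notin> M" using TM aT by auto
  then obtain g where g: "g \<in> pol V" "a * g - 1 \<in> M" using max TVp aT by blast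
  have "\<exists>s\<in>{s. \<exists>n. \<exists>d\<in>pol T. s = c ^ n + a * d}. \<forall>b\<in>B. s * b \<in> M"
  proof (rule nakayama[OF finB M TV aT cT], intro ballI)
    fix b assume b: "b \<in> B"
    then have bV: "b \<in> pol V" by (auto simp: B_def E_def)
    then obtain n where n: "c ^ n * (g * b) \<in> ?L" using G[of "g * b"] g by auto
    have aM: "a * x \<in> M" if "x \<in> M" for x
      by (rule MD(4)[OF TVp[OF aT] that])
    have "a * (c ^ n * (g * b)) \<in> lspan ((*) a ` pol T) M B"
      using n by (rule lspan_mult) (auto intro: aM)
    moreover have "(- (c ^ n * b)) * (a * g - 1) \<in> M" using g bV TVp[OF cT] by (intro MD(4)[OF _ g(2)]) auto
    ultimately have "a * (c ^ n * (g * b)) + (- (c ^ n * b)) * (a * g - 1) \<in> lspan ((*) a ` pol T) M B"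
      by (rule lspan_add[OF _ lspan_base MD(3)])
    moreover have "a * (c ^ n * (g * b)) + (- (c ^ n * b)) * (a * g - 1) = c ^ n * b"
      by (simp add: algebra_simps)
    ultimately have "c ^ n * b \<in> lspan ((*) a ` pol T) M B" by (simp only:)
    moreover have "c ^ n = c ^ n + a * 0" by simp
    ultimately show "\<exists>s\<in>{s. \<exists>n. \<exists>d\<in>pol T. s = c ^ n + a * d}. s * b \<in> lspan ((*) a ` pol T) M B"
      using pol_0 by blast
  qed
  then obtain n d where nd: "d \<in> pol T" "\<forall>b\<in>B. (c ^ n + a * d) * b \<in> M" by auto
  \<comment> \<open>Since 1 is in \<open>B\<close>, the multiplier itself lies in \<open>M\<close>;
    being in \<open>pol T\<close>, it is zero, and \<open>a\<close> divides a power of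
    \<open>c\<close>.\<close>
  have "0 \<in> E" by (simp add: E_def)
  then have "1 \<in> B" unfolding B_def using image_eqI[of 1 monomial 0 E] by (simp add: monomial_def)
  then have "c ^ n + a * d \<in> M" using nd by fastforce
  then have "c ^ n + a * d = 0" using TM nd aT cT by auto
  then have "c ^ n = (1 + var v * c) * (- d)" by (simp add: a_def eq_neg_iff_add_eq_0)
  then show False using one_plus_not_dvd_power[OF c0] by blast
qed

section \<open>Chains of prime ideals\<close>

definition pprime :: "'v set \<Rightarrow> ('v, 'k::field) mpoly set \<Rightarrow> bool" where
  "pprime V P \<longleftrightarrow> pideal V P \<and> 1 \<notin> P \<and> (\<forall>x\<in>pol V. \<forall>y\<in>pol V. x * y \<in> P \<longrightarrow> x \<in> P \<or> y \<in> P)"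

lemma pprimeD:
  assumes "pprime V P"
  shows "pideal V P" "1 \<notin> P" "x \<in> pol V \<Longrightarrow> y \<in> pol V \<Longrightarrow> x * y \<in> P \<Longrightarrow> x \<in> P \<or> y \<in> P"
  using assms by (auto simp: pprime_def)

lemma pprime_power:
  assumes "pprime V P" "x \<in> pol V" "x ^ n \<in> P"
  shows "x \<in> P"
  using assms(3)
  by (induction n) (use pprimeD[OF assms(1)] assms(2) in auto)

fun mono_at :: "('v, 'k::field) mpoly list \<Rightarrow> nat list \<Rightarrow> ('v, 'k) mpoly" where
  "mono_at (a # as) (n # ns) = a ^ n * mono_at as ns"
| "mono_at _ _ = 1"

lemma mono_at_pol: "set as \<subseteq> pol V \<Longrightarrow> mono_at as ns \<in> pol V"
  by (induction as ns rule: mono_at.induct) auto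

text \<open>Looking at the smallest exponent of the first element (the constructive
  characterization of Krull dimension by Coquand and Lombardi).\<close>

lemma no_relation_along_chain:
  fixes as :: "('v, 'k::field) mpoly list"
  assumes "\<And>i. i \<le> length as \<Longrightarrow> pprime V (P i)"
    and "\<And>i. i < length as \<Longrightarrow> P i \<subseteq> P (Suc i) \<and> as ! i \<in> P (Suc i) \<and> as ! i \<notin> P i"
    and "finite S" "S \<noteq> {}" "S \<subseteq> {ns. length ns = length as}" "\<And>ns. ns \<in> S \<Longrightarrow> c ns \<noteq> 0"
    and "(\<Sum>ns\<in>S. single 0 (c ns) * mono_at as ns) \<in> P 0"
  shows False
  using assms
proof (induction as arbitrary: P S c)
  case Nil
  then have S: "S = {[]}" by auto
  \<comment> \<open>The only exponent list is empty, so the relation is a nonzero constant in a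
    proper ideal.\<close>
  note D = pprimeD[OF Nil(1)[of 0], simplified]
  have "single 0 (inverse (c [])) * single 0 (c []) \<in> P 0"
    using Nil(7) S by (intro pidealD(4)[OF D(1)]) auto
  moreover have "c [] \<noteq> 0" using Nil(6) S by auto
  ultimately show ?case using D(2) by (simp add: mult_single)
next
  case (Cons a as)
  have P0: "pprime V (P 0)" and P1: "pprime V (P 1)" using Cons.prems(1)[of 0] Cons.prems(1)[of 1] by auto
  note D0 = pprimeD[OF P0] and D1 = pprimeD[OF P1]
  have a: "a \<in> P 1" "a \<notin> P 0" "P 0 \<subseteq> P 1" using Cons.prems(2)[of 0] by auto
  have aV: "a \<in> pol V" using a pidealD(1)[OF D1(1)] by auto
  have asV: "set as \<subseteq> pol V"
  proof
    fix x assume "x \<in> set as"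
    then obtain i where i: "i < length as" "x = as ! i" by (auto simp: in_set_conv_nth)
    then have "x \<in> P (Suc (Suc i))" using Cons.prems(2)[of "Suc i"] by auto
    moreover have "pprime V (P (Suc (Suc i)))" using i Cons.prems(1)[of "Suc (Suc i)"] by auto
    ultimately show "x \<in> pol V" using pidealD(1)[OF pprimeD(1)] by auto
  qed
  \<comment> \<open>Since \<open>a\<close> is not in \<open>P 0\<close>, the common factor
    \<open>a ^ k\<close> can be cancelled there. Modulo \<open>P 1\<close> all terms with a higher
    power of \<open>a\<close> vanish, which leaves a relation among the remaining elements.\<close>
  define k where "k = Min (hd ` S)"
  have kmin: "k \<le> hd ns" if "ns \<in> S" for ns using that Cons.prems(3) by (auto simp: k_def)
  have "k \<in> hd ` S" unfolding k_def using Cons.prems by (intro Min_in) auto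
  define S1 where "S1 = {ns \<in> S. hd ns = k}"
  have S1ne: "S1 \<noteq> {}" using \<open>k \<in> hd ` S\<close> by (auto simp: S1_def)
  have Sform: "ns = hd ns # tl ns" "length (tl ns) = length as" if "ns \<in> S" for ns
    using that Cons.prems(5) by (cases ns; force)+
  define t where "t ns = single 0 (c ns) * (a ^ (hd ns - k) * mono_at as (tl ns))" for ns
  have tV: "t ns \<in> pol V" for ns using aV mono_at_pol[OF asV] by (auto simp: t_def)
  have "single 0 (c ns) * mono_at (a # as) ns = a ^ k * t ns" if "ns \<in> S" for ns
  proof -
    have "a ^ hd ns = a ^ k * a ^ (hd ns - k)" using kmin[OF that] by (simp add: power_add[symmetric])
    then have "mono_at (a # as) ns = a ^ k * (a ^ (hd ns - k) * mono_at as (tl ns))"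
      by (subst Sform(1)[OF that]) (simp add: mult.assoc)
    then show ?thesis by (simp add: t_def ac_simps)
  qed
  then have "a ^ k * (\<Sum>ns\<in>S. t ns) \<in> P 0"
    using Cons.prems(7) by (simp add: sum_distrib_left)
  moreover have "a ^ k \<notin> P 0" using pprime_power[OF P0 aV] a by auto
  ultimately have "(\<Sum>ns\<in>S. t ns) \<in> P 0" using D0(3)[of "a ^ k"] aV tV by (auto intro: pol_sum)
  then have "(\<Sum>ns\<in>S. t ns) \<in> P 1" using a by auto
  moreover have "(\<Sum>ns\<in>S - S1. t ns) \<in> P 1"
  proof (rule pideal_sum[OF D1(1)])
    fix ns assume "ns \<in> S - S1"
    then have "hd ns - k = Suc (hd ns - k - 1)" using kmin[of ns] by (auto simp: S1_def)
    then have "t ns = (single 0 (c ns) * (a ^ (hd ns - k - 1) * mono_at as (tl ns))) * a"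
      unfolding t_def by (metis (no_types, lifting) ab_semigroup_mult_class.mult_ac(1) mult.commute power_Suc)
    moreover have "single 0 (c ns) * (a ^ (hd ns - k - 1) * mono_at as (tl ns)) \<in> pol V"
      using aV mono_at_pol[OF asV] by auto
    ultimately show "t ns \<in> P 1" using pidealD(4)[OF D1(1) _ a(1)] by simp
  qed
  moreover have "(\<Sum>ns\<in>S. t ns) = (\<Sum>ns\<in>S1. t ns) + (\<Sum>ns\<in>S - S1. t ns)"
    using Cons.prems(3) by (metis (no_types, lifting) S1_def mem_Collect_eq subsetI sum.subset_diff add.commute)
  ultimately have s1: "(\<Sum>ns\<in>S1. t ns) \<in> P 1"
    using pidealD(6)[OF D1(1)] by (metis add_diff_cancel_right')
  have inj: "inj_on tl S1"
  proof (rule inj_onI)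
    fix x y assume "x \<in> S1" "y \<in> S1" "tl x = tl y"
    then show "x = y" using Sform(1)[of x] Sform(1)[of y] by (auto simp: S1_def)
  qed
  have "(\<Sum>ns\<in>tl ` S1. single 0 (c (k # ns)) * mono_at as ns) = (\<Sum>ns\<in>S1. t ns)"
    unfolding sum.reindex[OF inj] o_def
  proof (rule sum.cong)
    fix ns assume "ns \<in> S1"
    then have "k # tl ns = ns" "hd ns = k" using Sform(1)[of ns] by (auto simp: S1_def)
    then show "single 0 (c (k # tl ns)) * mono_at as (tl ns) = t ns" by (simp add: t_def)
  qed simp
  with s1 have last: "(\<Sum>ns\<in>tl ` S1. single 0 (c (k # ns)) * mono_at as ns) \<in> P (Suc 0)" by simp
  show False
  proof (rule Cons.IH[of "\<lambda>i. P (Suc i)" "tl ` S1" "\<lambda>ns. c (k # ns)"])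
    show "pprime V (P (Suc i))" if "i \<le> length as" for i using that Cons.prems(1) by auto
    show "P (Suc i) \<subseteq> P (Suc (Suc i)) \<and> as ! i \<in> P (Suc (Suc i)) \<and> as ! i \<notin> P (Suc i)" if "i < length as" for i
      using that Cons.prems(2)[of "Suc i"] by auto
    show "finite (tl ` S1)" using Cons.prems(3) by (auto simp: S1_def)
    show "tl ` S1 \<subseteq> {ns. length ns = length as}" using Sform by (auto simp: S1_def)
    show "c (k # ns) \<noteq> 0" if ns: "ns \<in> tl ` S1" for ns
    proof -
      obtain ms where "ms \<in> S1" "ns = tl ms" using ns by auto
      then have "k # ns = ms" "ms \<in> S" using Sform(1)[of ms] by (auto simp: S1_def)
      then show ?thesis using Cons.prems(6) by auto
    qed
  qed (use S1ne last in auto)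
qed

section \<open>Algebraic dependence\<close>

interpretation mpoly_space: vector_space "\<lambda>c p. single 0 c * p :: ('v, 'k::field) mpoly"
  by unfold_locales (auto simp: algebra_simps single_add mult_single mult.assoc[symmetric])

text \<open>A box with one bound for all exponents is counted by a plain power, and the bounds add
  under multiplication.\<close>

definition degbox :: "nat \<Rightarrow> ('v, 'k::field) mpoly set" where
  "degbox D = {f. \<forall>m\<in>keys f. \<forall>v. lookup m v \<le> D}"

lemma degbox_mult: "f \<in> degbox D \<Longrightarrow> g \<in> degbox D' \<Longrightarrow> f * g \<in> degbox (D + D')"
  unfolding degbox_def
proof (intro CollectI ballI allI)
  fix m v assume f: "f \<in> {f. \<forall>m\<in>keys f. \<forall>v. lookup m v \<le> D}" and g: "g \<in> {f. \<forall>m\<in>keys f. \<forall>v. lookup m v \<le> D'}"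
    and "m \<in> keys (f * g)"
  from subsetD[OF keys_mult this(3)] obtain p q where "p \<in> keys f" "q \<in> keys g" "m = p + q" by auto
  then have "lookup p v \<le> D" "lookup q v \<le> D'" "m = p + q" using f g by auto
  then show "lookup m v \<le> D + D'" by (simp add: lookup_add)
qed

lemma degbox_mono: "f \<in> degbox D \<Longrightarrow> D \<le> D' \<Longrightarrow> f \<in> degbox D'"
  unfolding degbox_def using le_trans by blast

lemma degbox_exists: "\<exists>D. f \<in> degbox D"
proof
  let ?A = "\<Union>m\<in>keys f. lookup m ` keys m"
  have "lookup m v \<le> Max (insert 0 ?A)" if "m \<in> keys f" for m v
  proof (cases "v \<in> keys m")
    case True
    then show ?thesis using that by (intro Max_ge) auto
  qed (auto simp: in_keys_iff)
  then show "f \<in> degbox (Max (insert 0 ?A))" by (auto simp: degbox_def)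
qed

lemma degbox_power: "f \<in> degbox D \<Longrightarrow> f ^ n \<in> degbox (D * n)"
proof (induction n)
  case (Suc n)
  then show ?case using degbox_mult[of f D "f ^ n" "D * n"] by simp
qed (simp add: degbox_def)

lemma degbox_mono_at:
  assumes "set as \<subseteq> degbox D" "set ns \<subseteq> {..N}"
  shows "mono_at as ns \<in> degbox (D * N * length as)"
  using assms
proof (induction as ns rule: mono_at.induct)
  case (1 a as n ns)
  have "a ^ n \<in> degbox (D * N)" using degbox_power[of a D n] 1 by (auto intro: degbox_mono)
  moreover have "mono_at as ns \<in> degbox (D * N * length as)" using 1 by auto
  ultimately have "a ^ n * mono_at as ns \<in> degbox (D * N + D * N * length as)" by (rule degbox_mult)
  then show ?case by (simp add: algebra_simps)
qed (simp_all add: degbox_def)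

text \<open>A dimension count with \<open>h = card F\<close>: exponents up to \<open>N\<close> give
  \<open>(N + 1) ^ Suc h\<close> products, all in the span of at most
  \<open>(D * N * Suc h + 1) ^ h\<close> monomials.\<close>

lemma algebraic_dependence:
  fixes as :: "('v, 'k::field) mpoly list"
  assumes F: "finite F" "length as = Suc (card F)" "set as \<subseteq> pol F"
  shows "\<exists>S c. finite S \<and> S \<noteq> {} \<and> S \<subseteq> {ns. length ns = length as} \<and> (\<forall>ns\<in>S. c ns \<noteq> 0) \<and>
    (\<Sum>ns\<in>S. single 0 (c ns) * mono_at as ns) = 0"
proof -
  have "\<exists>D. set xs \<subseteq> degbox D" for xs :: "('v, 'k) mpoly list"
  proof (induction xs)
    case (Cons x xs)
    then obtain D D' where "set xs \<subseteq> degbox D" "x \<in> degbox D'" using degbox_exists by blast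
    then have "set (x # xs) \<subseteq> degbox (max D D')" using degbox_mono[of _ D "max D D'"] degbox_mono[of x D' "max D D'"] by auto
    then show ?case by blast
  qed simp
  then obtain D where D: "set as \<subseteq> degbox D" by blast
  define h where "h = card F"
  \<comment> \<open>\<open>L\<close> is large enough for the side of the box to be at most
    \<open>N * L\<close>; then \<open>N = L ^ h\<close> turns the bound \<open>(N * L) ^ h\<close>
    into \<open>N ^ Suc h\<close>, which is below the number of products.\<close>
  define L where "L = D * Suc h + 1"
  define N where "N = L ^ h"
  have N1: "N \<ge> 1" by (simp add: N_def L_def)
  define A where "A = {ns. set ns \<subseteq> {..N} \<and> length ns = length as}"
  have finA: "finite A" unfolding A_def by (rule finite_lists_length_eq) simp
  have cardA: "card A = (N + 1) ^ Suc h" unfolding A_def using card_lists_length_eq[of "{..N}" "length as"] F(2) by (simp add: h_def)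
  define E where "E = {m. keys m \<subseteq> F \<and> (\<forall>v\<in>F. lookup m v \<le> (\<lambda>_. D * N * length as) v)}"
  note box = exp_box[OF F(1), of "\<lambda>_. D * N * length as", folded E_def]
  define B where "B = (monomial ` E :: ('v, 'k) mpoly set)"
  have "card B \<le> (D * N * length as + 1) ^ h"
    unfolding B_def using card_image_le[OF box(1)] box(2) by (auto intro: le_trans simp: h_def)
  also have "\<dots> \<le> (N * L) ^ h"
    using N1 F(2) by (intro power_mono) (auto simp: L_def h_def algebra_simps)
  also have "\<dots> = N ^ Suc h" by (simp add: power_mult_distrib N_def)
  also have "\<dots> < (N + 1) ^ Suc h" by (rule power_strict_mono) auto
  finally have cardB: "card B < card A" using cardA by simp
  have finB: "finite B" using box by (simp add: B_def)
  have span: "mono_at as ns \<in> mpoly_space.span B" if ns: "ns \<in> A" for ns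
  proof -
    let ?f = "mono_at as ns"
    have f: "?f \<in> degbox (D * N * length as)" "?f \<in> pol F"
      using degbox_mono_at[OF D] ns mono_at_pol[OF F(3)] by (auto simp: A_def)
    show ?thesis
    proof (rule singles_induct[of _ ?f])
      show "0 \<in> mpoly_space.span B" by (rule mpoly_space.span_zero)
      show "p + q \<in> mpoly_space.span B" if "p \<in> mpoly_space.span B" "q \<in> mpoly_space.span B" for p q
        using that by (rule mpoly_space.span_add)
      fix m a assume "m \<in> keys ?f"
      then have "m \<in> E" using f by (auto simp: E_def degbox_def pol_def)
      then have "single 0 a * monomial m \<in> mpoly_space.span B"
        by (intro mpoly_space.span_scale mpoly_space.span_base) (auto simp: B_def)
      then show "single m a \<in> mpoly_space.span B" by (simp add: monomial_def mult_single)
    qed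
  qed
  show ?thesis
  \<comment> \<open>Linear dependence concerns a set and overlooks repeated values; two exponent
    lists with the same value give a relation with coefficients 1 and -1.\<close>
  proof (cases "inj_on (mono_at as) A")
    case False
    then obtain x y where xy: "x \<in> A" "y \<in> A" "x \<noteq> y" "mono_at as x = mono_at as y"
      by (auto simp: inj_on_def)
    define c where "c ns = (if ns = x then 1 else - 1 :: 'k)" for ns
    have "(\<Sum>ns\<in>{x, y}. single 0 (c ns) * mono_at as ns) = 0"
      using xy by (simp add: c_def single_uminus)
    then show ?thesis using xy by (intro exI[of _ "{x, y}"] exI[of _ c]) (auto simp: c_def A_def)
  next
    case True
    have "mpoly_space.dependent (mono_at as ` A)"
    proof (rule ccontr)
      assume "\<not> ?thesis"
      then have "card (mono_at as ` A) \<le> card B"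
        using mpoly_space.independent_span_bound[OF finB, of "mono_at as ` A"] span by auto
      then show False using cardB True by (simp add: card_image)
    qed
    then obtain t u where tu: "finite t" "t \<subseteq> mono_at as ` A" "(\<Sum>v\<in>t. single 0 (u v) * v) = 0" "\<exists>v\<in>t. u v \<noteq> 0"
      unfolding mpoly_space.dependent_explicit by blast
    define S where "S = {ns \<in> A. mono_at as ns \<in> t \<and> u (mono_at as ns) \<noteq> 0}"
    have im: "mono_at as ` S = {v \<in> t. u v \<noteq> 0}" using tu(2) by (auto simp: S_def)
    have injS: "inj_on (mono_at as) S" using True by (rule inj_on_subset) (auto simp: S_def)
    have "(\<Sum>ns\<in>S. single 0 (u (mono_at as ns)) * mono_at as ns) = (\<Sum>v\<in>mono_at as ` S. single 0 (u v) * v)"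
      by (simp add: sum.reindex[OF injS])
    also have "\<dots> = (\<Sum>v\<in>t. single 0 (u v) * v)"
      unfolding im using tu(1) by (intro sum.mono_neutral_left) auto
    finally have "(\<Sum>ns\<in>S. single 0 (u (mono_at as ns)) * mono_at as ns) = 0" using tu by simp
    moreover have "S \<noteq> {}" using tu(4) im by auto
    moreover have "finite S" using finA by (simp add: S_def)
    ultimately show ?thesis
      by (intro exI[of _ S] exI[of _ "\<lambda>ns. u (mono_at as ns)"]) (auto simp: S_def A_def)
  qed
qed

section \<open>Bounding chains of primes over a set of variables\<close>

lemma reduce_mod_vars:
  fixes f :: "('v, 'k::field) mpoly"
  assumes "f \<in> pol V" "C \<subseteq> V"
  shows "\<exists>g\<in>pol (V - C). f - g \<in> gen V (var ` C)"
proof (rule singles_induct[of _ f])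
  show "\<exists>g\<in>pol (V - C). 0 - g \<in> gen V (var ` C)" by (intro bexI[of _ 0]) (auto intro: gen_0)
  show "\<exists>g\<in>pol (V - C). p + q - g \<in> gen V (var ` C)"
    if pq: "\<exists>g\<in>pol (V - C). p - g \<in> gen V (var ` C)" "\<exists>g\<in>pol (V - C). q - g \<in> gen V (var ` C)" for p q
  proof -
    obtain g g' where "g \<in> pol (V - C)" "p - g \<in> gen V (var ` C)" "g' \<in> pol (V - C)" "q - g' \<in> gen V (var ` C)"
      using pq by auto
    then show ?thesis using gen_add[of "p - g" V "var ` C" "q - g'"]
      by (intro bexI[of _ "g + g'"]) (auto simp: algebra_simps)
  qed
  fix m a assume "m \<in> keys f"
  then have mV: "keys m \<subseteq> V" using assms by (auto simp: pol_def)
  show "\<exists>g\<in>pol (V - C). single m a - g \<in> gen V (var ` C)"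
  proof (cases "keys m \<inter> C = {}")
    case True
    then show ?thesis using mV by (intro bexI[of _ "single m a"]) (auto intro: gen_0)
  next
    case False
    then have "single m a \<in> meet_ideal V {C}" using mV by (auto simp: meet_ideal_def)
    then show ?thesis using meet_ideal_singleton[OF assms(2)] by (intro bexI[of _ 0]) auto
  qed
qed

text \<open>A longer chain would offer \<open>card (V - C) + 1\<close> witnesses of strict inclusion
  in the variables outside \<open>C\<close>. These are algebraically dependent, contrary to
  \<open>no_relation_along_chain\<close>.\<close>

lemma chain_bound:
  fixes P :: "nat \<Rightarrow> ('v, 'k::field) mpoly set"
  assumes V: "finite V" "C \<subseteq> V" and P: "\<And>i. i \<le> n \<Longrightarrow> pprime V (P i)" "\<And>i. i < n \<Longrightarrow> P i \<subset> P (Suc i)"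
    and C: "var ` C \<subseteq> P 0"
  shows "n \<le> card (V - C)"
proof (rule ccontr)
  assume "\<not> n \<le> card (V - C)"
  then have n: "Suc (card (V - C)) \<le> n" by simp
  have P0: "P 0 \<subseteq> P i" if "i \<le> n" for i
    using that
  proof (induction i)
    case (Suc i)
    then show ?case using P(2)[of i] by auto
  qed simp
  \<comment> \<open>Removing the variables in \<open>C\<close> from a witness does not affect
    membership, as every prime of the chain contains them.\<close>
  have "\<exists>a. a \<in> pol (V - C) \<and> a \<in> P (Suc i) \<and> a \<notin> P i" if i: "i < n" for i
  proof -
    obtain f where f: "f \<in> P (Suc i)" "f \<notin> P i" using P(2)[OF i] by auto
    have I: "pideal V (P i)" "pideal V (P (Suc i))"
      using pprimeD(1)[OF P(1)[of i]] pprimeD(1)[OF P(1)[of "Suc i"]] i by auto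
    have "f \<in> pol V" using f(1) pidealD(1)[OF I(2)] by auto
    from reduce_mod_vars[OF this V(2)] obtain g where g: "g \<in> pol (V - C)" "f - g \<in> gen V (var ` C)" by auto
    have "gen V (var ` C) \<subseteq> P 0" by (rule gen_minimal[OF pprimeD(1)[OF P(1)] C]) simp
    then have d: "f - g \<in> P i" "f - g \<in> P (Suc i)" using g P0[of i] P0[of "Suc i"] i by auto
    have "f - (f - g) \<in> P (Suc i)" by (rule pidealD(6)[OF I(2) f(1) d(2)])
    then have "g \<in> P (Suc i)" by simp
    moreover have "g \<notin> P i"
    proof
      assume "g \<in> P i"
      then have "(f - g) + g \<in> P i" by (rule pidealD(3)[OF I(1) d(1)])
      then show False using f by simp
    qed
    ultimately show ?thesis using g by auto
  qed
  then obtain a where a: "\<And>i. i < n \<Longrightarrow> a i \<in> pol (V - C) \<and> a i \<in> P (Suc i) \<and> a i \<notin> P i" by metis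
  let ?h = "card (V - C)"
  let ?as = "map a [0..<Suc ?h]"
  have "set ?as \<subseteq> pol (V - C)" using a n by (auto simp del: upt_Suc)
  then obtain S c where S: "finite S" "S \<noteq> {}" "S \<subseteq> {ns. length ns = length ?as}" "\<forall>ns\<in>S. c ns \<noteq> 0"
    "(\<Sum>ns\<in>S. single 0 (c ns) * mono_at ?as ns) = 0"
    using algebraic_dependence[of "V - C" ?as] V(1) by (auto simp del: upt_Suc)
  show False
  proof (rule no_relation_along_chain[of ?as V P S c])
    show "(\<Sum>ns\<in>S. single 0 (c ns) * mono_at ?as ns) \<in> P 0"
      using S(5) pidealD(2)[OF pprimeD(1)[OF P(1)[of 0]]] by simp
    show "P i \<subseteq> P (Suc i) \<and> ?as ! i \<in> P (Suc i) \<and> ?as ! i \<notin> P i" if "i < length ?as" for i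
      using that n P(2)[of i] a[of i] by (auto simp del: upt_Suc)
    show "pprime V (P i)" if "i \<le> length ?as" for i using that n P(1) by simp
  qed (use S in auto)
qed

section \<open>Localization\<close>

locale mult_subset = cring R for R (structure) and S +
  assumes S_sub: "S \<subseteq> carrier R" and S_one: "\<one> \<in> S"
    and S_mult: "s \<in> S \<Longrightarrow> t \<in> S \<Longrightarrow> s \<otimes> t \<in> S"
begin

lemma S_carr [simp]: "s \<in> S \<Longrightarrow> s \<in> carrier R" using S_sub by auto

lemma frac_rel_iff:
  "((a, s), (b, t)) \<in> frac_rel R S \<longleftrightarrow> a \<in> carrier R \<and> s \<in> S \<and> b \<in> carrier R \<and> t \<in> S \<and>
     (\<exists>u\<in>S. u \<otimes> (a \<otimes> t) = u \<otimes> (b \<otimes> s))"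
  by (auto simp: frac_rel_def)

lemma frac_rel_equiv: "equiv (carrier R \<times> S) (frac_rel R S)"
proof (rule equivI)
  show "frac_rel R S \<subseteq> (carrier R \<times> S) \<times> (carrier R \<times> S)" by (auto simp: frac_rel_def)
  show "refl_on (carrier R \<times> S) (frac_rel R S)"
    by (rule refl_onI) (auto simp: frac_rel_iff intro: S_one)
  show "sym (frac_rel R S)"
  proof (rule symI)
    fix x y assume "(x, y) \<in> frac_rel R S"
    then show "(y, x) \<in> frac_rel R S" by (cases x; cases y) (auto simp: frac_rel_iff, metis)
  qed
  show "trans (frac_rel R S)"
  proof (rule transI)
    fix x y z assume xy: "(x, y) \<in> frac_rel R S" and yz: "(y, z) \<in> frac_rel R S"
    obtain a s b t c w where eq: "x = (a, s)" "y = (b, t)" "z = (c, w)" by (metis prod.exhaust)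
    from xy yz obtain u v where uv: "a \<in> carrier R" "b \<in> carrier R" "c \<in> carrier R" "s \<in> S" "t \<in> S" "w \<in> S"
      "u \<in> S" "v \<in> S" "u \<otimes> (a \<otimes> t) = u \<otimes> (b \<otimes> s)" "v \<otimes> (b \<otimes> w) = v \<otimes> (c \<otimes> t)"
      unfolding eq frac_rel_iff by auto
    \<comment> \<open>The middle denominator \<open>t\<close> need not be cancellable, so it is
      absorbed into the witness.\<close>
    have "(u \<otimes> v \<otimes> t) \<otimes> (a \<otimes> w) = (v \<otimes> w) \<otimes> (u \<otimes> (a \<otimes> t))" using uv(1-8) by (simp add: m_ac)
    also have "\<dots> = (u \<otimes> s) \<otimes> (v \<otimes> (b \<otimes> w))" unfolding uv(9) using uv(1-8) by (simp add: m_ac)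
    also have "\<dots> = (u \<otimes> v \<otimes> t) \<otimes> (c \<otimes> s)" unfolding uv(10) using uv(1-8) by (simp add: m_ac)
    finally show "(x, z) \<in> frac_rel R S"
      unfolding eq frac_rel_iff using uv by (auto intro!: bexI[of _ "u \<otimes> v \<otimes> t"] S_mult)
  qed
qed

lemma frac_eq_iff:
  assumes "a \<in> carrier R" "s \<in> S" "b \<in> carrier R" "t \<in> S"
  shows "frac R S a s = frac R S b t \<longleftrightarrow> (\<exists>u\<in>S. u \<otimes> (a \<otimes> t) = u \<otimes> (b \<otimes> s))"
  unfolding frac_def using eq_equiv_class_iff[OF frac_rel_equiv, of "(a, s)" "(b, t)"] assms
  by (auto simp: frac_rel_iff)

lemma frac_eqI:
  assumes "a \<in> carrier R" "s \<in> S" "b \<in> carrier R" "t \<in> S" "a \<otimes> t = b \<otimes> s"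
  shows "frac R S a s = frac R S b t"
  using assms S_one by (auto simp: frac_eq_iff)

lemma mem_frac: "(b, t) \<in> frac R S a s \<longleftrightarrow> ((a, s), (b, t)) \<in> frac_rel R S"
  by (simp add: frac_def)

lemma frac_memD:
  assumes "(b, t) \<in> frac R S a s"
  shows "a \<in> carrier R" "s \<in> S" "b \<in> carrier R" "t \<in> S" "\<exists>u\<in>S. u \<otimes> (a \<otimes> t) = u \<otimes> (b \<otimes> s)"
  using assms by (auto simp: mem_frac frac_rel_iff)

lemma frac_self: "a \<in> carrier R \<Longrightarrow> s \<in> S \<Longrightarrow> (a, s) \<in> frac R S a s"
  using S_one by (auto simp: mem_frac frac_rel_iff)

abbreviation "L \<equiv> localization R S"

lemma loc_carrier: "carrier L = {frac R S a s | a s. a \<in> carrier R \<and> s \<in> S}"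
  by (auto simp: localization_def quotient_def frac_def)

lemma loc_closed [simp]: "a \<in> carrier R \<Longrightarrow> s \<in> S \<Longrightarrow> frac R S a s \<in> carrier L"
  by (auto simp: loc_carrier)

text \<open>Operations on classes are unions over representatives; independence of the
  representatives collapses such a union to one class.\<close>

lemma UN2_const:
  assumes "x0 \<in> X" "y0 \<in> Y" "\<And>a s b t. (a, s) \<in> X \<Longrightarrow> (b, t) \<in> Y \<Longrightarrow> F a s b t = c"
  shows "(\<Union>(a, s)\<in>X. \<Union>(b, t)\<in>Y. F a s b t) = c"
  using assms by (cases x0; cases y0) fastforce

lemma loc_mult:
  assumes "a \<in> carrier R" "s \<in> S" "b \<in> carrier R" "t \<in> S"
  shows "frac R S a s \<otimes>\<^bsub>L\<^esub> frac R S b t = frac R S (a \<otimes> b) (s \<otimes> t)"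
  unfolding localization_def monoid.simps
proof (rule UN2_const[OF frac_self[OF assms(1,2)] frac_self[OF assms(3,4)]])
  fix a' s' b' t' assume "(a', s') \<in> frac R S a s" "(b', t') \<in> frac R S b t"
  then obtain u v where uv: "a' \<in> carrier R" "s' \<in> S" "b' \<in> carrier R" "t' \<in> S" "u \<in> S" "v \<in> S"
    "u \<otimes> (a \<otimes> s') = u \<otimes> (a' \<otimes> s)" "v \<otimes> (b \<otimes> t') = v \<otimes> (b' \<otimes> t)"
    using frac_memD[of a' s' a s] frac_memD[of b' t' b t] by auto
  have "(u \<otimes> v) \<otimes> ((a' \<otimes> b') \<otimes> (s \<otimes> t)) = (u \<otimes> (a' \<otimes> s)) \<otimes> (v \<otimes> (b' \<otimes> t))"
    using uv(1-6) assms by (simp add: m_ac)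
  also have "\<dots> = (u \<otimes> v) \<otimes> ((a \<otimes> b) \<otimes> (s' \<otimes> t'))"
    unfolding uv(7,8)[symmetric] using uv(1-6) assms by (simp add: m_ac)
  finally show "frac R S (a' \<otimes> b') (s' \<otimes> t') = frac R S (a \<otimes> b) (s \<otimes> t)"
    using uv assms by (subst frac_eq_iff) (auto intro: S_mult)
qed

lemma loc_add:
  assumes "a \<in> carrier R" "s \<in> S" "b \<in> carrier R" "t \<in> S"
  shows "frac R S a s \<oplus>\<^bsub>L\<^esub> frac R S b t = frac R S (a \<otimes> t \<oplus> b \<otimes> s) (s \<otimes> t)"
  unfolding localization_def ring.simps
proof (rule UN2_const[OF frac_self[OF assms(1,2)] frac_self[OF assms(3,4)]])
  fix a' s' b' t' assume "(a', s') \<in> frac R S a s" "(b', t') \<in> frac R S b t"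
  then obtain u v where uv: "a' \<in> carrier R" "s' \<in> S" "b' \<in> carrier R" "t' \<in> S" "u \<in> S" "v \<in> S"
    "u \<otimes> (a \<otimes> s') = u \<otimes> (a' \<otimes> s)" "v \<otimes> (b \<otimes> t') = v \<otimes> (b' \<otimes> t)"
    using frac_memD[of a' s' a s] frac_memD[of b' t' b t] by auto
  have "(u \<otimes> v) \<otimes> ((a' \<otimes> t' \<oplus> b' \<otimes> s') \<otimes> (s \<otimes> t))
      = (v \<otimes> t \<otimes> t') \<otimes> (u \<otimes> (a' \<otimes> s)) \<oplus> (u \<otimes> s \<otimes> s') \<otimes> (v \<otimes> (b' \<otimes> t))"
    using uv(1-6) assms by (simp add: m_ac l_distr r_distr)
  also have "\<dots> = (u \<otimes> v) \<otimes> ((a \<otimes> t \<oplus> b \<otimes> s) \<otimes> (s' \<otimes> t'))"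
    unfolding uv(7,8)[symmetric] using uv(1-6) assms by (simp add: m_ac l_distr r_distr)
  finally show "frac R S (a' \<otimes> t' \<oplus> b' \<otimes> s') (s' \<otimes> t') = frac R S (a \<otimes> t \<oplus> b \<otimes> s) (s \<otimes> t)"
    using uv assms by (subst frac_eq_iff) (auto intro!: S_mult bexI[of _ "u \<otimes> v"])
qed

lemma loc_one: "\<one>\<^bsub>L\<^esub> = frac R S \<one> \<one>" and loc_zero: "\<zero>\<^bsub>L\<^esub> = frac R S \<zero> \<one>"
  by (simp_all add: localization_def)

lemma loc_elim:
  assumes "x \<in> carrier L" obtains a s where "a \<in> carrier R" "s \<in> S" "x = frac R S a s"
  using assms by (auto simp: loc_carrier)

lemma loc_cring: "cring L"
proof (rule cringI)
  show "abelian_group L"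
  proof (rule abelian_groupI)
    show "\<zero>\<^bsub>L\<^esub> \<in> carrier L" using S_one by (auto simp: loc_zero)
    fix x assume "x \<in> carrier L"
    then obtain a s where x: "a \<in> carrier R" "s \<in> S" "x = frac R S a s" by (rule loc_elim)
    show "\<zero>\<^bsub>L\<^esub> \<oplus>\<^bsub>L\<^esub> x = x" unfolding x(3) loc_zero using x S_one by (subst loc_add) auto
    show "\<exists>y\<in>carrier L. y \<oplus>\<^bsub>L\<^esub> x = \<zero>\<^bsub>L\<^esub>"
    proof (intro bexI)
      have "(\<ominus> a) \<otimes> s \<oplus> a \<otimes> s = \<zero>" using x by (simp add: l_minus l_neg)
      then have "frac R S (\<ominus> a) s \<oplus>\<^bsub>L\<^esub> x = frac R S \<zero> (s \<otimes> s)"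
        unfolding x(3) using x by (simp add: loc_add)
      also have "\<dots> = \<zero>\<^bsub>L\<^esub>" unfolding loc_zero using x S_one by (intro frac_eqI) (auto intro: S_mult)
      finally show "frac R S (\<ominus> a) s \<oplus>\<^bsub>L\<^esub> x = \<zero>\<^bsub>L\<^esub>" .
    qed (use x in auto)
    fix y assume "y \<in> carrier L"
    then obtain b t where y: "b \<in> carrier R" "t \<in> S" "y = frac R S b t" by (rule loc_elim)
    show "x \<oplus>\<^bsub>L\<^esub> y \<in> carrier L" unfolding x y using x y by (simp add: loc_add S_mult)
    show "x \<oplus>\<^bsub>L\<^esub> y = y \<oplus>\<^bsub>L\<^esub> x" unfolding x y using x y by (simp add: loc_add a_comm m_comm)
    fix z assume "z \<in> carrier L"
    then obtain c w where z: "c \<in> carrier R" "w \<in> S" "z = frac R S c w" by (rule loc_elim)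
    have "(a \<otimes> t \<oplus> b \<otimes> s) \<otimes> w \<oplus> c \<otimes> (s \<otimes> t) = a \<otimes> (t \<otimes> w) \<oplus> (b \<otimes> w \<oplus> c \<otimes> t) \<otimes> s"
      using x y z by (simp add: l_distr r_distr m_ac a_ac)
    then show "x \<oplus>\<^bsub>L\<^esub> y \<oplus>\<^bsub>L\<^esub> z = x \<oplus>\<^bsub>L\<^esub> (y \<oplus>\<^bsub>L\<^esub> z)"
      unfolding x y z using x y z by (simp add: loc_add S_mult m_assoc)
  qed
  show "comm_monoid L"
  proof (rule comm_monoidI)
    show "\<one>\<^bsub>L\<^esub> \<in> carrier L" using S_one by (auto simp: loc_one)
    fix x assume "x \<in> carrier L"
    then obtain a s where x: "a \<in> carrier R" "s \<in> S" "x = frac R S a s" by (rule loc_elim)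
    show "\<one>\<^bsub>L\<^esub> \<otimes>\<^bsub>L\<^esub> x = x" unfolding x(3) loc_one using x S_one by (subst loc_mult) auto
    fix y assume "y \<in> carrier L"
    then obtain b t where y: "b \<in> carrier R" "t \<in> S" "y = frac R S b t" by (rule loc_elim)
    show "x \<otimes>\<^bsub>L\<^esub> y \<in> carrier L" unfolding x y using x y by (simp add: loc_mult S_mult)
    show "x \<otimes>\<^bsub>L\<^esub> y = y \<otimes>\<^bsub>L\<^esub> x" unfolding x y using x y by (simp add: loc_mult m_comm)
    fix z assume "z \<in> carrier L"
    then obtain c w where z: "c \<in> carrier R" "w \<in> S" "z = frac R S c w" by (rule loc_elim)
    show "x \<otimes>\<^bsub>L\<^esub> y \<otimes>\<^bsub>L\<^esub> z = x \<otimes>\<^bsub>L\<^esub> (y \<otimes>\<^bsub>L\<^esub> z)"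
      unfolding x y z using x y z by (simp add: loc_mult S_mult m_assoc)
  qed
  fix x y z assume "x \<in> carrier L" "y \<in> carrier L" "z \<in> carrier L"
  then obtain a s b t c w where x: "a \<in> carrier R" "s \<in> S" "x = frac R S a s"
    and y: "b \<in> carrier R" "t \<in> S" "y = frac R S b t" and z: "c \<in> carrier R" "w \<in> S" "z = frac R S c w"
    by (metis loc_elim)
  show "(x \<oplus>\<^bsub>L\<^esub> y) \<otimes>\<^bsub>L\<^esub> z = x \<otimes>\<^bsub>L\<^esub> z \<oplus>\<^bsub>L\<^esub> y \<otimes>\<^bsub>L\<^esub> z"
    unfolding x y z using x y z
    by (simp add: loc_add loc_mult S_mult) (rule frac_eqI; simp add: S_mult l_distr r_distr m_ac)
qed

lemma loc_hom:
  "a \<in> carrier R \<Longrightarrow> b \<in> carrier R \<Longrightarrow> frac R S (a \<oplus> b) \<one> = frac R S a \<one> \<oplus>\<^bsub>L\<^esub> frac R S b \<one>"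
  "a \<in> carrier R \<Longrightarrow> b \<in> carrier R \<Longrightarrow> frac R S (a \<otimes> b) \<one> = frac R S a \<one> \<otimes>\<^bsub>L\<^esub> frac R S b \<one>"
  using S_one by (simp_all add: loc_add loc_mult)

lemma loc_denominator: "a \<in> carrier R \<Longrightarrow> s \<in> S \<Longrightarrow> frac R S a s \<otimes>\<^bsub>L\<^esub> frac R S s \<one> = frac R S a \<one>"
  using S_one by (subst loc_mult) (simp_all, rule frac_eqI, simp_all add: m_ac)

lemma loc_unit:
  assumes "s \<in> S" shows "frac R S s \<one> \<in> Units L"
proof -
  interpret L: cring L by (rule loc_cring)
  have "frac R S \<one> s \<otimes>\<^bsub>L\<^esub> frac R S s \<one> = \<one>\<^bsub>L\<^esub>"
    unfolding loc_one using assms S_one by (subst loc_mult) (simp_all, rule frac_eqI, simp_all)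
  moreover have c: "frac R S \<one> s \<in> carrier L" "frac R S s \<one> \<in> carrier L"
    using assms S_one by simp_all
  ultimately have "frac R S s \<one> \<otimes>\<^bsub>L\<^esub> frac R S \<one> s = \<one>\<^bsub>L\<^esub>"
    using L.m_comm[OF c] by simp
  with \<open>frac R S \<one> s \<otimes>\<^bsub>L\<^esub> frac R S s \<one> = \<one>\<^bsub>L\<^esub>\<close> c show ?thesis
    unfolding Units_def by blast
qed

lemma loc_zero_iff:
  assumes "a \<in> carrier R"
  shows "frac R S a \<one> = \<zero>\<^bsub>L\<^esub> \<longleftrightarrow> (\<exists>u\<in>S. u \<otimes> a = \<zero>)"
  unfolding loc_zero using assms S_one by (subst frac_eq_iff) auto

end

section \<open>Regular elements and prime ideals\<close>

lemma (in cring) add_PIdl: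
  assumes M: "ideal M R" and x: "x \<in> carrier R"
  shows "ideal (M <+> PIdl x) R" "M \<subseteq> M <+> PIdl x" "x \<in> M <+> PIdl x"
    and "z \<in> M <+> PIdl x \<longleftrightarrow> (\<exists>n\<in>M. \<exists>r\<in>carrier R. z = n \<oplus> r \<otimes> x)"
proof -
  interpret M: ideal M R by fact
  show "ideal (M <+> PIdl x) R" using x M by (intro add_ideals cgenideal_ideal)
  have mem: "z \<in> M <+> PIdl x \<longleftrightarrow> (\<exists>n\<in>M. \<exists>r\<in>carrier R. z = n \<oplus> r \<otimes> x)" for z
    unfolding set_add_def' cgenideal_def by blast
  then show "z \<in> M <+> PIdl x \<longleftrightarrow> (\<exists>n\<in>M. \<exists>r\<in>carrier R. z = n \<oplus> r \<otimes> x)" .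
  show "M \<subseteq> M <+> PIdl x"
  proof
    fix n assume n: "n \<in> M"
    then have "n = n \<oplus> \<zero> \<otimes> x" using x M.Icarr by simp
    then show "n \<in> M <+> PIdl x" unfolding mem using n by blast
  qed
  have "x = \<zero> \<oplus> \<one> \<otimes> x" using x by simp
  then show "x \<in> M <+> PIdl x" unfolding mem using M.zero_closed one_closed by blast
qed

text \<open>The multiplicative set of all \<open>s \<otimes> x [^] n\<close> with \<open>s\<close>
  outside \<open>P\<close> avoids \<open>J\<close> by regularity. An ideal maximal among those
  containing \<open>J\<close> and avoiding this set is prime, lies in \<open>P\<close> and omits
  \<open>x\<close>.\<close>

lemma (in noetherian_ring) prime_below_regular:
  assumes "cring R" and J: "ideal J R" and P: "primeideal P R" "J \<subseteq> P" and x: "x \<in> P"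
    and reg: "\<And>y. y \<in> carrier R \<Longrightarrow> x \<otimes> y \<in> J \<Longrightarrow> y \<in> J"
  shows "\<exists>P'. primeideal P' R \<and> J \<subseteq> P' \<and> P' \<subset> P"
proof -
  interpret cring R by fact
  interpret P: primeideal P R by fact
  interpret J: ideal J R by fact
  have xc: "x \<in> carrier R" using x by (rule P.Icarr)
  have P1: "\<one> \<notin> P" using P.one_imp_carrier P.I_notcarr by auto
  define T where "T = {s \<otimes> x [^] (n::nat) | s n. s \<in> carrier R - P}"
  have T1: "s \<in> T" if "s \<in> carrier R - P" for s
    unfolding T_def using that by (intro CollectI exI[of _ s] exI[of _ 0]) auto
  have xT: "x \<in> T"
    unfolding T_def using P1 xc by (intro CollectI exI[of _ \<one>] exI[of _ 1]) auto
  have Tcarr: "T \<subseteq> carrier R" using xc by (auto simp: T_def)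
  have Tmult: "s \<otimes> t \<in> T" if st: "s \<in> T" "t \<in> T" for s t
  proof -
    from st obtain a m b n where a: "a \<in> carrier R - P" "s = a \<otimes> x [^] (m::nat)"
      and b: "b \<in> carrier R - P" "t = b \<otimes> x [^] (n::nat)" by (auto simp: T_def)
    have "a \<otimes> b \<in> carrier R - P" using a b P.I_prime by auto
    moreover have "s \<otimes> t = (a \<otimes> b) \<otimes> x [^] (m + n)"
      using a b xc by (simp add: nat_pow_mult[symmetric] m_ac)
    ultimately show ?thesis unfolding T_def by blast
  qed
  have TJ: "T \<inter> J = {}"
  proof -
    have "s \<in> J" if "s \<in> carrier R" "s \<otimes> x [^] n \<in> J" for s and n :: nat
      using that
    proof (induction n)
      case (Suc n)
      have "x \<otimes> (s \<otimes> x [^] n) = s \<otimes> x [^] Suc n" using Suc.prems xc by (simp add: m_ac)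
      then show ?case using Suc reg[of "s \<otimes> x [^] n"] xc by auto
    qed auto
    then show ?thesis using P(2) by (auto simp: T_def)
  qed
  let ?F = "{N. ideal N R \<and> J \<subseteq> N \<and> N \<inter> T = {}}"
  \<comment> \<open>In a noetherian ring the union of a nonempty chain of ideals belongs to the
    chain, which provides the upper bound for Zorn's lemma.\<close>
  have "\<exists>N\<in>?F. \<forall>N'\<in>?F. N \<subseteq> N' \<longrightarrow> N' = N"
  proof (rule subset_Zorn_nonempty)
    show "?F \<noteq> {}" using J TJ by auto
    fix C assume C: "C \<noteq> {}" "subset.chain ?F C"
    then have "subset.chain {I. ideal I R} C" by (auto simp: subset.chain_def)
    then have "\<Union>C \<in> C" using ideal_chain_is_trivial C by blast
    then show "\<Union>C \<in> ?F" using C by (auto simp: subset.chain_def)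
  qed
  then obtain N where "N \<in> ?F" and max: "\<forall>N'\<in>?F. N \<subseteq> N' \<longrightarrow> N' = N" by (rule bexE)
  then have N: "ideal N R" "J \<subseteq> N" "N \<inter> T = {}" by simp_all
  have Nmax: "N' = N" if "ideal N' R" "N \<subseteq> N'" "N' \<inter> T = {}" for N'
    using bspec[OF max, of N'] that N(2) by simp
  interpret N: ideal N R by fact
  have meet: "\<exists>n\<in>N. \<exists>r\<in>carrier R. n \<oplus> r \<otimes> a \<in> T" if a: "a \<in> carrier R" "a \<notin> N" for a
  proof -
    note I = add_PIdl[OF N(1) a(1)]
    have "(N <+> PIdl a) \<inter> T \<noteq> {}" using Nmax[OF I(1,2)] I(3) a(2) by auto
    then show ?thesis using I(4) by auto
  qed
  have "primeideal N R"
  proof (rule primeidealI[OF N(1) \<open>cring R\<close>])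
    have "\<one> \<in> T" using T1 P1 by auto
    then show "carrier R \<noteq> N" using N(3) one_closed by auto
    fix a b assume ab: "a \<in> carrier R" "b \<in> carrier R" "a \<otimes> b \<in> N"
    show "a \<in> N \<or> b \<in> N"
    proof (rule ccontr)
      assume "\<not> (a \<in> N \<or> b \<in> N)"
      then obtain n r m q where n: "n \<in> N" "r \<in> carrier R" "n \<oplus> r \<otimes> a \<in> T"
        and m: "m \<in> N" "q \<in> carrier R" "m \<oplus> q \<otimes> b \<in> T" using meet[OF ab(1)] meet[OF ab(2)] by auto
      have nc: "n \<in> carrier R" "m \<in> carrier R" using n m N.Icarr by auto
      have "(n \<oplus> r \<otimes> a) \<otimes> (m \<oplus> q \<otimes> b) = n \<otimes> (m \<oplus> q \<otimes> b) \<oplus> ((r \<otimes> a) \<otimes> m \<oplus> (r \<otimes> q) \<otimes> (a \<otimes> b))"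
        using nc n(2) m(2) ab by (simp add: l_distr r_distr m_ac a_ac)
      also have "\<dots> \<in> N"
      proof (intro N.a_closed)
        show "n \<otimes> (m \<oplus> q \<otimes> b) \<in> N" using n(1) nc m(2) ab by (intro N.I_r_closed) auto
        show "(r \<otimes> a) \<otimes> m \<in> N" using m(1) n(2) ab by (intro N.I_l_closed) auto
        show "(r \<otimes> q) \<otimes> (a \<otimes> b) \<in> N" using N.I_l_closed[OF ab(3), of "r \<otimes> q"] n(2) m(2) by simp
      qed
      finally show False using Tmult[OF n(3) m(3)] N(3) by auto
    qed
  qed
  moreover have "N \<subseteq> P"
  proof
    fix y assume "y \<in> N"
    then show "y \<in> P" using T1[of y] N(3) N.Icarr by auto
  qed
  moreover have "N \<noteq> P" using xT x N(3) by auto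
  ultimately show ?thesis using N(2) by blast
qed

text \<open>Descent along the sequence: its last element lies in \<open>P\<close> and is regular
  modulo the earlier ones, which forces a smaller prime that still contains those. Depth is thereby
  bounded by dimension.\<close>

lemma (in noetherian_ring) regular_sequence_chain:
  assumes "cring R" and reg: "regular_sequence R xs" and P: "primeideal P R" "Idl (set (take k xs)) \<subseteq> P"
    and k: "k \<le> length xs"
  shows "\<exists>Q. prime_chain R k Q \<and> Q k = P"
  using P k
proof (induction k arbitrary: P)
  case 0
  then show ?case by (intro exI[of _ "\<lambda>_. P"]) (auto simp: prime_chain_def)
next
  case (Suc k)
  have xs: "set xs \<subseteq> carrier R" using reg by (auto simp: regular_sequence_def)
  have sub: "set (take n xs) \<subseteq> carrier R" for n using xs set_take_subset by fast
  let ?J = "Idl (set (take k xs))"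
  have x: "xs ! k \<in> set (take (Suc k) xs)" using Suc.prems by (simp add: take_Suc_conv_app_nth)
  then have "xs ! k \<in> P" using Suc.prems genideal_self[OF sub] by blast
  moreover have "?J \<subseteq> P"
  proof -
    have "set (take k xs) \<subseteq> set (take (Suc k) xs)" by (rule set_take_subset_set_take) simp
    then have "?J \<subseteq> Idl (set (take (Suc k) xs))" by (rule subset_Idl_subset[OF sub])
    then show ?thesis using Suc.prems by auto
  qed
  moreover have "y \<in> ?J" if "y \<in> carrier R" "xs ! k \<otimes> y \<in> ?J" for y
    using reg that Suc.prems by (auto simp: regular_sequence_def)
  ultimately obtain P' where P': "primeideal P' R" "?J \<subseteq> P'" "P' \<subset> P"
    using prime_below_regular[OF \<open>cring R\<close> genideal_ideal[OF sub] Suc.prems(1)] by blast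
  obtain Q where "prime_chain R k Q" "Q k = P'" using Suc.IH[OF P'(1,2)] Suc.prems(3) by auto
  then show ?case using P' Suc.prems(1)
    by (intro exI[of _ "Q(Suc k := P)"]) (auto simp: prime_chain_def less_Suc_eq le_Suc_eq)
qed

section \<open>Local rings of a polynomial ring modulo an ideal\<close>

text \<open>Common ground for a quotient of the polynomial ring and its localization: up to a unit,
  every element comes from a polynomial. In the quotient the unit is 1.\<close>

locale poly_hom = cring B for B :: "('b, 'm) ring_scheme" (structure) +
  fixes V :: "'v set" and h :: "('v, 'k::field) mpoly \<Rightarrow> 'b"
  assumes h_closed [simp]: "a \<in> pol V \<Longrightarrow> h a \<in> carrier B"
    and h_add: "a \<in> pol V \<Longrightarrow> b \<in> pol V \<Longrightarrow> h (a + b) = h a \<oplus> h b"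
    and h_mult: "a \<in> pol V \<Longrightarrow> b \<in> pol V \<Longrightarrow> h (a * b) = h a \<otimes> h b"
    and h_one: "h 1 = \<one>"
    and finite_V: "finite V"
    and associate: "x \<in> carrier B \<Longrightarrow> \<exists>a\<in>pol V. \<exists>s\<in>pol V. h s \<in> Units B \<and> x \<otimes> h s = h a"
begin

lemma h_zero: "h 0 = \<zero>"
proof -
  have "h 0 \<oplus> h 0 = h 0 \<oplus> \<zero>" using h_add[of 0 0] by simp
  then show ?thesis by (simp only: add.l_cancel h_closed pol_0 zero_closed)
qed

lemma h_diff: "a \<in> pol V \<Longrightarrow> b \<in> pol V \<Longrightarrow> h (a - b) = h a \<ominus> h b"
proof -
  assume ab: "a \<in> pol V" "b \<in> pol V"
  then have "h (a - b) \<oplus> h b = h a" using h_add[of "a - b" b] by simp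
  then show ?thesis using ab by (metis h_closed pol_diff add.inv_solve_right' minus_eq)
qed

lemma h_gen:
  assumes K: "ideal K B" and A: "A \<subseteq> pol V" "h ` A \<subseteq> K" and x: "x \<in> gen V A"
  shows "h x \<in> K"
proof -
  interpret K: ideal K B by fact
  from x show ?thesis
  proof induction
    case gen_0
    then show ?case by (simp add: h_zero)
  next
    case (gen_step s r y)
    have "y \<in> pol V" using gen_step(3) pidealD(1)[OF pideal_gen[OF A(1)]] by auto
    moreover have "s \<in> pol V" "h s \<in> K" using gen_step A by auto
    moreover have "h r \<otimes> h s \<in> K" using gen_step \<open>h s \<in> K\<close> by (intro K.I_l_closed) auto
    ultimately show ?case using gen_step by (simp add: h_add h_mult K.a_closed)
  qed
qed

lemma unit_mult_mem:
  assumes K: "ideal K B" and b: "b \<in> carrier B" "u \<in> Units B" "b \<otimes> u \<in> K"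
  shows "b \<in> K"
proof -
  interpret K: ideal K B by fact
  have "(b \<otimes> u) \<otimes> inv u \<in> K" using K.I_r_closed[OF b(3), of "inv u"] b(2) by simp
  moreover have "(b \<otimes> u) \<otimes> inv u = b" using b(1) Units_closed[OF b(2)] b(2) by (simp add: m_assoc)
  ultimately show ?thesis by (simp only:)
qed

definition pull :: "'b set \<Rightarrow> ('v, 'k) mpoly set" where
  "pull K = {a \<in> pol V. h a \<in> K}"

lemma pideal_pull:
  assumes "ideal K B" shows "pideal V (pull K)"
proof -
  interpret K: ideal K B by fact
  show ?thesis
    unfolding pideal_def pull_def
    by (auto simp: h_zero h_add h_mult K.a_closed K.I_l_closed)
qed

text \<open>Each element of \<open>B\<close> is an associate of some \<open>h a\<close>, so an ideal
  is determined by its preimage. Finite generation and strictness of chains transfer through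
  this.\<close>

lemma pull_inj:
  assumes "ideal K B" "ideal K' B" "pull K \<subseteq> pull K'"
  shows "K \<subseteq> K'"
proof
  fix b assume b: "b \<in> K"
  interpret K: ideal K B by fact
  have bc: "b \<in> carrier B" using b by (rule K.Icarr)
  obtain a s where as: "a \<in> pol V" "s \<in> pol V" "h s \<in> Units B" "b \<otimes> h s = h a" using associate[OF bc] by auto
  have "h a \<in> K" using K.I_r_closed[OF b, of "h s"] as by simp
  then have "h a \<in> K'" using assms(3) as by (auto simp: pull_def)
  then show "b \<in> K'" using unit_mult_mem[OF assms(2) bc as(3)] as by simp
qed

lemma noetherian: "noetherian_ring B"
proof (rule noetherian_ringI)
  fix J assume J: "ideal J B"
  obtain A where A: "finite A" "A \<subseteq> pull J" "pull J = gen V A"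
    using hilbert_basis[OF finite_V pideal_pull[OF J]] by auto
  have AV: "A \<subseteq> pol V" using A(2) by (auto simp: pull_def)
  have hA: "h ` A \<subseteq> carrier B" using AV by auto
  have "J \<subseteq> Idl (h ` A)"
  proof (rule pull_inj[OF J genideal_ideal[OF hA]])
    show "pull J \<subseteq> pull (Idl (h ` A))"
    proof
      fix x assume x: "x \<in> pull J"
      then have "h x \<in> Idl (h ` A)"
        using A(3) h_gen[OF genideal_ideal[OF hA] AV genideal_self[OF hA]] by auto
      then show "x \<in> pull (Idl (h ` A))" using x by (auto simp: pull_def)
    qed
  qed
  moreover have "Idl (h ` A) \<subseteq> J" using A(2) by (intro genideal_minimal[OF J]) (auto simp: pull_def)
  ultimately show "\<exists>A\<subseteq>carrier B. finite A \<and> J = Idl A" using A(1) hA by blast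
qed

lemma pprime_pull:
  assumes "primeideal K B" shows "pprime V (pull K)"
proof -
  interpret K: primeideal K B by fact
  have "\<one> \<notin> K" using K.one_imp_carrier K.I_notcarr by auto
  then show ?thesis
    unfolding pprime_def using pideal_pull[OF K.ideal_axioms]
    by (auto simp: pull_def h_one h_mult dest: K.I_prime[rotated 2])
qed

end

text \<open>The localization of \<open>pol V\<close> modulo \<open>I\<close> at \<open>M\<close>,
  characterized by its denominators, units and kernel.\<close>

locale local_map = poly_hom B V h for B :: "('b, 'm) ring_scheme" (structure)
    and V :: "'v set" and h :: "('v, 'k::field) mpoly \<Rightarrow> 'b" +
  fixes I M :: "('v, 'k) mpoly set"
  assumes I: "pideal V I" and M: "pprime V M" and IM: "I \<subseteq> M"
    and denominator: "x \<in> carrier B \<Longrightarrow> \<exists>a\<in>pol V. \<exists>s\<in>pol V - M. x \<otimes> h s = h a"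
    and unit: "s \<in> pol V - M \<Longrightarrow> h s \<in> Units B"
    and kernel: "a \<in> pol V \<Longrightarrow> h a = \<zero> \<longleftrightarrow> (\<exists>u\<in>pol V - M. u * a \<in> I)"
begin

lemmas MD = pidealD[OF pprimeD(1)[OF M]] and ID = pidealD[OF I]

lemma M_prime: "s \<in> pol V - M \<Longrightarrow> t \<in> pol V - M \<Longrightarrow> s * t \<in> pol V - M"
  using pprimeD(3)[OF M, of s t] by auto

lemma Ikernel:
  assumes "z \<in> I" shows "h z = \<zero>"
proof -
  have "1 \<in> pol V - M" "1 * z \<in> I" using pprimeD(2)[OF M] assms by auto
  moreover have "z \<in> pol V" using assms ID(1) by auto
  ultimately show ?thesis using kernel by blast
qed

definition extend :: "('v, 'k) mpoly set \<Rightarrow> 'b set" where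
  "extend J = {b \<in> carrier B. \<exists>a\<in>J. \<exists>s\<in>pol V - M. b \<otimes> h s = h a}"

lemma extendI: "b \<in> carrier B \<Longrightarrow> a \<in> J \<Longrightarrow> s \<in> pol V - M \<Longrightarrow> b \<otimes> h s = h a \<Longrightarrow> b \<in> extend J"
  unfolding extend_def by blast

lemma extend_image: "a \<in> pol V \<Longrightarrow> a \<in> J \<Longrightarrow> h a \<in> extend J"
  using pprimeD(2)[OF M] by (intro extendI[of _ a J 1]) (auto simp: h_one)

lemma ideal_extend:
  assumes J: "pideal V J" shows "ideal (extend J) B"
proof (rule idealI)
  note G = pidealD[OF J]
  show "subgroup (extend J) (add_monoid B)"
  proof (rule add.subgroupI)
    show "extend J \<subseteq> carrier B" by (auto simp: extend_def)
    show "extend J \<noteq> {}" using extend_image[OF _ G(2)] by auto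
    fix b assume "b \<in> extend J"
    then obtain a s where as: "b \<in> carrier B" "a \<in> J" "s \<in> pol V - M" "b \<otimes> h s = h a" by (auto simp: extend_def)
    have aV: "a \<in> pol V" using as G(1) by auto
    have "h (- a) = \<ominus> (h a)" using h_diff[of 0 a] aV by (simp add: h_zero a_minus_def)
    then have "(\<ominus> b) \<otimes> h s = h (- a)" using as by (simp add: l_minus)
    then show "\<ominus> b \<in> extend J" using as G(5)[of a] by (intro extendI[of _ "- a" J s]) auto
    fix c assume "c \<in> extend J"
    then obtain a' t where ct: "c \<in> carrier B" "a' \<in> J" "t \<in> pol V - M" "c \<otimes> h t = h a'" by (auto simp: extend_def)
    have a'V: "a' \<in> pol V" using ct G(1) by auto
    have "(b \<oplus> c) \<otimes> h (s * t) = (b \<otimes> h s) \<otimes> h t \<oplus> (c \<otimes> h t) \<otimes> h s"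
      using as(1,3) ct(1,3) by (simp add: h_mult l_distr r_distr m_ac)
    also have "\<dots> = h (a * t + a' * s)"
      unfolding as(4) ct(4) using as(3) ct(3) aV a'V by (simp add: h_mult h_add)
    finally have "(b \<oplus> c) \<otimes> h (s * t) = h (a * t + a' * s)" .
    moreover have "a * t + a' * s \<in> J"
      using G(3)[OF G(4)[of t a] G(4)[of s a']] as ct by (simp add: mult.commute)
    ultimately show "b \<oplus> c \<in> extend J"
      using as ct M_prime[OF as(3) ct(3)] by (intro extendI[of _ "a * t + a' * s" J "s * t"]) auto
  qed
  fix b y assume "b \<in> extend J" and y: "y \<in> carrier B"
  then obtain a s where as: "b \<in> carrier B" "a \<in> J" "s \<in> pol V - M" "b \<otimes> h s = h a" by (auto simp: extend_def)
  have aV: "a \<in> pol V" using as G(1) by auto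
  obtain c t where ct: "c \<in> pol V" "t \<in> pol V - M" "y \<otimes> h t = h c" using denominator[OF y] by auto
  have "(y \<otimes> b) \<otimes> h (t * s) = (y \<otimes> h t) \<otimes> (b \<otimes> h s)" using as(1,3) ct(1,2) y by (simp add: h_mult m_ac)
  also have "\<dots> = h (c * a)" unfolding as(4) ct(3) using aV ct(1) by (simp add: h_mult)
  finally have "(y \<otimes> b) \<otimes> h (t * s) = h (c * a)" .
  moreover have "c * a \<in> J" by (rule G(4)[OF ct(1) as(2)])
  ultimately show "y \<otimes> b \<in> extend J"
    using y as M_prime[OF ct(2) as(3)] by (intro extendI[of _ "c * a" J "t * s"]) auto
  then show "b \<otimes> y \<in> extend J" using as y by (simp add: m_comm)
qed (rule ring_axioms)

abbreviation "max_ideal \<equiv> extend M"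

lemma max_ideal_ideal: "ideal max_ideal B"
  by (rule ideal_extend[OF pprimeD(1)[OF M]])

lemma h_eq:
  assumes "a \<in> pol V" "b \<in> pol V" "h a = h b"
  shows "\<exists>u\<in>pol V - M. u * (a - b) \<in> I"
proof -
  have "h (a - b) = \<zero>" using assms by (simp add: h_diff a_minus_def r_neg)
  then show ?thesis using kernel[of "a - b"] assms by auto
qed

text \<open>\<open>extend\<close> asks for one numerator in \<open>M\<close>. The kernel condition
  and primality of \<open>M\<close> put every other numerator into \<open>M\<close> as well.\<close>

lemma max_ideal_rep:
  assumes "b \<in> max_ideal" "c \<in> pol V" "t \<in> pol V - M" "b \<otimes> h t = h c"
  shows "c \<in> M"
proof -
  obtain a s where as: "b \<in> carrier B" "a \<in> M" "s \<in> pol V - M" "b \<otimes> h s = h a" using assms(1) by (auto simp: extend_def)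
  have aV: "a \<in> pol V" using as MD(1) by auto
  have "h (c * s) = (b \<otimes> h t) \<otimes> h s" unfolding assms(4) using assms(2) as(3) by (simp add: h_mult)
  also have "\<dots> = (b \<otimes> h s) \<otimes> h t" using assms(3) as(1,3) by (simp add: m_ac)
  also have "\<dots> = h (a * t)" unfolding as(4) using assms(3) aV by (simp add: h_mult)
  finally obtain u where u: "u \<in> pol V - M" "u * (c * s - a * t) \<in> I"
    using h_eq[of "c * s" "a * t"] assms as aV by auto
  have "c * s - a * t \<in> M" using pprimeD(3)[OF M, of u "c * s - a * t"] u IM assms as aV by auto
  moreover have "t * a \<in> M" by (rule MD(4)) (use assms as in auto)
  ultimately have "(c * s - a * t) + t * a \<in> M" by (rule MD(3))
  then have "c * s \<in> M" by (simp add: mult.commute)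
  then show ?thesis using pprimeD(3)[OF M, of c s] assms as by auto
qed

lemma h_max_ideal: "a \<in> pol V \<Longrightarrow> h a \<in> max_ideal \<longleftrightarrow> a \<in> M"
proof
  assume "a \<in> pol V" "h a \<in> max_ideal"
  then show "a \<in> M" using max_ideal_rep[of "h a" a 1] pprimeD(2)[OF M] by (auto simp: h_one)
qed (rule extend_image)

lemma unit_or_max_ideal:
  assumes b: "b \<in> carrier B" shows "b \<in> Units B \<or> b \<in> max_ideal"
proof -
  obtain a s where as: "a \<in> pol V" "s \<in> pol V - M" "b \<otimes> h s = h a" using denominator[OF b] by auto
  show ?thesis
  proof (cases "a \<in> M")
    case True
    then show ?thesis using as b by (auto simp: extend_def)
  next
    case False
    then have u: "h a \<in> Units B" using as unit by auto
    have "b \<otimes> (h s \<otimes> inv (h a)) = \<one>"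
      using as b u by (simp add: m_assoc[symmetric])
    moreover have c: "h s \<otimes> inv (h a) \<in> carrier B" using as u by auto
    ultimately have "(h s \<otimes> inv (h a)) \<otimes> b = \<one>" using m_comm[OF c b] by simp
    with \<open>b \<otimes> (h s \<otimes> inv (h a)) = \<one>\<close> b c show ?thesis unfolding Units_def by blast
  qed
qed

lemma max_ideal_proper: "\<one> \<notin> max_ideal"
  using h_max_ideal[of 1] pprimeD(2)[OF M] by (simp add: h_one)

lemma ideal_unit:
  assumes "ideal J B" "u \<in> Units B" "u \<in> J" shows "J = carrier B"
proof -
  interpret J: ideal J B by fact
  have "u \<otimes> inv u \<in> J" using assms by (intro J.I_r_closed) auto
  then show ?thesis using assms J.one_imp_carrier by simp
qed

lemma max_ideal_maximal: "maximalideal max_ideal B"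
proof (rule maximalidealI[OF max_ideal_ideal])
  show "carrier B \<noteq> max_ideal" using max_ideal_proper by auto
  fix J assume J: "ideal J B" "max_ideal \<subseteq> J" "J \<subseteq> carrier B"
  show "J = max_ideal \<or> J = carrier B"
  proof (cases "J = max_ideal")
    case False
    then obtain b where "b \<in> J" "b \<notin> max_ideal" using J by auto
    then have "b \<in> Units B" using unit_or_max_ideal[of b] J by auto
    then show ?thesis using ideal_unit[OF J(1)] \<open>b \<in> J\<close> by auto
  qed simp
qed

lemma proper_subset_max_ideal:
  assumes "ideal J B" "J \<noteq> carrier B" shows "J \<subseteq> max_ideal"
proof
  interpret J: ideal J B by fact
  fix b assume "b \<in> J"
  then show "b \<in> max_ideal" using unit_or_max_ideal[of b] J.Icarr ideal_unit[OF assms(1)] assms(2) by auto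
qed

lemma maximal_unique: "{N. maximalideal N B} = {max_ideal}"
proof -
  have uniq: "N = max_ideal" if N: "maximalideal N B" for N
  proof -
    interpret N: maximalideal N B by fact
    have "N \<subseteq> max_ideal" using N.I_notcarr by (intro proper_subset_max_ideal[OF N.ideal_axioms]) auto
    then have "max_ideal = N \<or> max_ideal = carrier B" using N.I_maximal[OF max_ideal_ideal] by (auto simp: extend_def)
    then show ?thesis using max_ideal_proper by auto
  qed
  show ?thesis
  proof (intro equalityI subsetI)
    show "N \<in> {max_ideal}" if "N \<in> {N. maximalideal N B}" for N
      using uniq[of N] that by (simp only: mem_Collect_eq singleton_iff)
    show "N \<in> {N. maximalideal N B}" if "N \<in> {max_ideal}" for N
      using max_ideal_maximal that by (simp only: mem_Collect_eq singleton_iff)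
  qed
qed

lemma Idl_image_rep:
  assumes A: "A \<subseteq> pol V" and b: "b \<in> Idl (h ` A)"
  shows "\<exists>a\<in>gen V (I \<union> A). \<exists>s\<in>pol V - M. b \<otimes> h s = h a"
proof -
  have IA: "I \<union> A \<subseteq> pol V" using A ID(1) by auto
  have "h ` A \<subseteq> extend (gen V (I \<union> A))"
    using A extend_image[of _ "gen V (I \<union> A)"] gen_base[of _ "I \<union> A"] by auto
  then have "Idl (h ` A) \<subseteq> extend (gen V (I \<union> A))"
    by (rule genideal_minimal[OF ideal_extend[OF pideal_gen[OF IA]]])
  then show ?thesis using b by (auto simp: extend_def)
qed

text \<open>Localization preserves regularity: denominators are cleared, the equation is lifted to
  polynomials, and regularity there applies. Properness holds because the elements lie in
  \<open>M\<close>.\<close>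

lemma regular_sequence_image:
  assumes xs: "set xs \<subseteq> M"
    and reg: "\<And>i y. i < length xs \<Longrightarrow> y \<in> pol V \<Longrightarrow> xs ! i * y \<in> gen V (I \<union> set (take i xs)) \<Longrightarrow>
      y \<in> gen V (I \<union> set (take i xs))"
  shows "regular_sequence B (map h xs)" "set (map h xs) \<subseteq> max_ideal"
proof -
  have xsV: "set xs \<subseteq> pol V" using xs MD(1) by auto
  show sub: "set (map h xs) \<subseteq> max_ideal" using xs xsV h_max_ideal by auto
  show "regular_sequence B (map h xs)"
    unfolding regular_sequence_def
  proof (intro conjI allI impI ballI)
    show "set (map h xs) \<subseteq> carrier B" using xsV by auto
    have "Idl (set (map h xs)) \<subseteq> max_ideal" by (rule genideal_minimal[OF max_ideal_ideal sub])
    then show "Idl (set (map h xs)) \<noteq> carrier B" using max_ideal_proper by auto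
    fix i y assume i: "i < length (map h xs)" and y: "y \<in> carrier B"
      and m: "map h xs ! i \<otimes> y \<in> Idl (set (take i (map h xs)))"
    let ?A = "set (take i xs)" and ?x = "xs ! i"
    have A: "?A \<subseteq> pol V" using xsV set_take_subset by fast
    have IA: "I \<union> ?A \<subseteq> pol V" using A ID(1) by auto
    note G = pidealD[OF pideal_gen[OF IA]]
    have x: "?x \<in> pol V" using i xsV by auto
    have hA: "h ` ?A \<subseteq> carrier B" using A by auto
    note K = genideal_ideal[OF hA]
    interpret K: ideal "Idl (h ` ?A)" B by (rule K)
    have m': "h ?x \<otimes> y \<in> Idl (h ` ?A)" using m i by (simp add: take_map)
    obtain a s where as: "a \<in> pol V" "s \<in> pol V - M" "y \<otimes> h s = h a" using denominator[OF y] by auto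
    obtain c t where ct: "c \<in> gen V (I \<union> ?A)" "t \<in> pol V - M" "(h ?x \<otimes> y) \<otimes> h t = h c"
      using Idl_image_rep[OF A m'] by auto
    have cV: "c \<in> pol V" using ct G(1) by auto
    have "h (?x * (a * t)) = h ?x \<otimes> ((y \<otimes> h s) \<otimes> h t)" using as x ct by (simp add: h_mult)
    also have "\<dots> = ((h ?x \<otimes> y) \<otimes> h t) \<otimes> h s" using as(1,2) x ct(2) y by (simp add: m_ac)
    also have "\<dots> = h (c * s)" unfolding ct(3) using cV as by (simp add: h_mult)
    \<comment> \<open>Equality in \<open>B\<close> lifts to polynomials only modulo \<open>I\<close>
      and after multiplication by some \<open>u\<close> outside \<open>M\<close>.\<close>
    finally obtain u where u: "u \<in> pol V - M" "u * (?x * (a * t) - c * s) \<in> I"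
      using h_eq[of "?x * (a * t)" "c * s"] as ct cV x by auto
    have "u * (?x * (a * t) - c * s) \<in> gen V (I \<union> ?A)" using u by (intro gen_base) auto
    moreover have "(u * s) * c \<in> gen V (I \<union> ?A)" by (rule G(4)[OF _ ct(1)]) (use u as in auto)
    ultimately have "u * (?x * (a * t) - c * s) + (u * s) * c \<in> gen V (I \<union> ?A)" by (rule G(3))
    moreover have "u * (?x * (a * t) - c * s) + (u * s) * c = ?x * (u * (a * t))" by (simp add: algebra_simps)
    ultimately have "?x * (u * (a * t)) \<in> gen V (I \<union> ?A)" by simp
    moreover have "i < length xs" "u * (a * t) \<in> pol V" using i u as ct by auto
    ultimately have "u * (a * t) \<in> gen V (I \<union> ?A)" by (intro reg[of i "u * (a * t)"])
    then have "h (u * (a * t)) \<in> Idl (h ` ?A)"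
    proof (rule h_gen[OF K IA, rotated])
      have "h z \<in> Idl (h ` ?A)" if "z \<in> I" for z
        unfolding Ikernel[OF that] by (rule K.zero_closed)
      then show "h ` (I \<union> ?A) \<subseteq> Idl (h ` ?A)"
        using genideal_self[OF hA] by (simp add: image_Un image_subset_iff)
    qed
    moreover have "h (u * (a * t)) = y \<otimes> (h s \<otimes> (h u \<otimes> h t))"
    proof -
      have "h (u * (a * t)) = h u \<otimes> ((y \<otimes> h s) \<otimes> h t)" unfolding as(3) using u as ct by (simp add: h_mult)
      then show ?thesis using u as(1,2) ct(2) y by (simp add: m_ac)
    qed
    moreover have "h s \<otimes> (h u \<otimes> h t) \<in> Units B" using unit u as ct by (intro Units_m_closed) auto
    ultimately have "y \<in> Idl (h ` ?A)" using unit_mult_mem[OF K y] by simp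
    then show "y \<in> Idl (set (take i (map h xs)))" by (simp add: take_map)
  qed
qed

text \<open>Dimension is at most \<open>length xs\<close>, which is at most depth, which is at most
  dimension. The first bound pulls a chain back to polynomials, where its smallest prime contains
  enough variables; the last one uses \<open>regular_sequence_chain\<close>.\<close>

lemma cm_local_ringI:
  assumes xs: "set xs \<subseteq> M"
    and reg: "\<And>i y. i < length xs \<Longrightarrow> y \<in> pol V \<Longrightarrow> xs ! i * y \<in> gen V (I \<union> set (take i xs)) \<Longrightarrow>
      y \<in> gen V (I \<union> set (take i xs))"
    and dim: "\<And>P. pprime V P \<Longrightarrow> I \<subseteq> P \<Longrightarrow> \<exists>C\<subseteq>V. card (V - C) = length xs \<and> var ` C \<subseteq> P"
  shows "cm_local_ring B"
proof -
  interpret N: noetherian_ring B by (rule noetherian)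
  have Mp: "primeideal max_ideal B" by (rule maximalideal_prime[OF max_ideal_maximal])
  have upper: "n \<le> length xs" if Q: "prime_chain B n Q" for n Q
  proof -
    have Qp: "primeideal (Q i) B" if "i \<le> n" for i using Q that by (auto simp: prime_chain_def)
    have "pprime V (pull (Q 0))" using pprime_pull Qp by auto
    moreover have "I \<subseteq> pull (Q 0)"
    proof
      interpret Q0: primeideal "Q 0" B using Qp by auto
      fix z assume "z \<in> I"
      then show "z \<in> pull (Q 0)" using Ikernel ID(1) Q0.zero_closed by (auto simp: pull_def)
    qed
    ultimately obtain C where C: "C \<subseteq> V" "card (V - C) = length xs" "var ` C \<subseteq> pull (Q 0)" using dim by metis
    have "n \<le> card (V - C)"
    proof (rule chain_bound[where P = "\<lambda>i. pull (Q i)", OF finite_V C(1) _ _ C(3)])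
      show "pprime V (pull (Q i))" if "i \<le> n" for i using pprime_pull Qp that by auto
      show "pull (Q i) \<subset> pull (Q (Suc i))" if i: "i < n" for i
      proof -
        have s: "Q i \<subset> Q (Suc i)" using Q i by (auto simp: prime_chain_def)
        have id: "ideal (Q i) B" "ideal (Q (Suc i)) B" using Qp[of i] Qp[of "Suc i"] i by (auto intro: primeideal.axioms)
        show ?thesis using s pull_inj[OF id(2,1)] by (auto simp: pull_def)
      qed
    qed
    then show ?thesis using C by simp
  qed
  have seq: "\<exists>Q. prime_chain B (length ys) Q" if ys: "regular_sequence B ys" "set ys \<subseteq> max_ideal" for ys
  proof -
    have "Idl (set (take (length ys) ys)) \<subseteq> max_ideal" using ys by (auto intro!: genideal_minimal[OF max_ideal_ideal])
    then show ?thesis using N.regular_sequence_chain[OF is_cring ys(1) Mp, of "length ys"] by auto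
  qed
  have "krull_dim B \<le> enat (length xs)"
    unfolding krull_dim_def by (rule Sup_least) (auto dest: upper)
  moreover have "enat (length xs) \<le> depth B max_ideal"
    unfolding depth_def using regular_sequence_image[OF xs reg]
    by (intro Sup_upper) (auto intro!: exI[of _ "map h xs"])
  moreover have "depth B max_ideal \<le> krull_dim B"
    unfolding depth_def krull_dim_def
  proof (rule Sup_mono, safe)
    fix ys assume "regular_sequence B ys" "set ys \<subseteq> max_ideal"
    from seq[OF this] show "\<exists>b\<in>{enat n |n. \<exists>Q. prime_chain B n Q}. enat (length ys) \<le> b" by blast
  qed
  ultimately have "depth B max_ideal = krull_dim B" by simp
  then show ?thesis unfolding cm_local_ring_def using is_cring noetherian maximal_unique by blast
qed

end

section \<open>Shellability implies the Cohen-Macaulay property\<close>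

lemma pprime_prod_var:
  fixes P :: "('v, 'k::field) mpoly set"
  assumes P: "pprime V P" and A: "finite A" "A \<subseteq> V" "(\<Prod>x\<in>A. var x) \<in> P"
  shows "\<exists>x\<in>A. var x \<in> P"
  using A
proof (induction A rule: finite_induct)
  case empty
  then show ?case using pprimeD(2)[OF P] by simp
next
  case (insert x A)
  have "(\<Prod>x\<in>A. var x) \<in> (pol V :: ('v, 'k) mpoly set)" using insert by (intro pol_prod) auto
  then have "var x \<in> P \<or> (\<Prod>x\<in>A. var x) \<in> P" using insert pprimeD(3)[OF P, of "var x"] by auto
  then show ?case using insert by auto
qed

lemma edge_ideal_eq:
  assumes fin: "finite V" and E: "\<And>A. A \<in> E \<Longrightarrow> A \<subseteq> V"
  shows "edge_ideal K V E = {f \<in> pol V. \<forall>m\<in>keys f. \<exists>A\<in>E. A \<subseteq> keys m}"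
proof -
  have finE: "finite A" if "A \<in> E" for A using E[OF that] fin by (rule finite_subset)
  have "{\<Prod>x\<in>e. var x | e. e \<in> E} = (\<lambda>A. \<Prod>x\<in>A. var x :: _ \<Rightarrow>\<^sub>0 'b) ` E" by auto
  also have "\<dots> = (\<lambda>A. monomial (sqf_exp A)) ` E" using finE by (intro image_cong refl prod_var)
  finally have eq: "{\<Prod>x\<in>e. var x | e. e \<in> E} = (\<lambda>A. monomial (sqf_exp A) :: _ \<Rightarrow>\<^sub>0 'b) ` E" .
  have sub: "(\<lambda>A. monomial (sqf_exp A)) ` E \<subseteq> (pol V :: (_ \<Rightarrow>\<^sub>0 'b) set)"
  proof safe
    fix A assume "A \<in> E"
    then show "monomial (sqf_exp A) \<in> (pol V :: (_ \<Rightarrow>\<^sub>0 'b) set)" using E finE by simp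
  qed
  show ?thesis
    unfolding edge_ideal_def eq Idl_eq_gen[OF sub] using finE E by (rule monomial_ideal_mem)
qed

text \<open>A set of vertices contains no edge exactly when its complement is a cover. Hence the
  support of a monomial outside the edge ideal is disjoint from some member of
  \<open>F\<close>.\<close>

lemma edge_ideal_eq_meet_ideal:
  fixes V :: "'v set" and K :: "'k::field itself"
  assumes fin: "finite V" and E: "\<And>A. A \<in> E \<Longrightarrow> A \<subseteq> V"
    and cov: "\<And>C. C \<in> F \<Longrightarrow> vertex_cover V E C"
    and sub: "\<And>C. vertex_cover V E C \<Longrightarrow> \<exists>C'\<in>F. C' \<subseteq> C"
  shows "edge_ideal K V E = meet_ideal V F"
proof -
  have "(\<exists>A\<in>E. A \<subseteq> keys m) \<longleftrightarrow> (\<forall>C\<in>F. keys m \<inter> C \<noteq> {})" if "keys m \<subseteq> V" for m :: "'v \<Rightarrow>\<^sub>0 nat"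
  proof
    assume "\<exists>A\<in>E. A \<subseteq> keys m"
    then show "\<forall>C\<in>F. keys m \<inter> C \<noteq> {}" using cov unfolding vertex_cover_def by blast
  next
    assume *: "\<forall>C\<in>F. keys m \<inter> C \<noteq> {}"
    show "\<exists>A\<in>E. A \<subseteq> keys m"
    proof (rule ccontr)
      assume "\<not> ?thesis"
      then have "vertex_cover V E (V - keys m)" using E unfolding vertex_cover_def by blast
      then obtain C where "C \<in> F" "C \<subseteq> V - keys m" using sub by auto
      then show False using * by auto
    qed
  qed
  note iff = this
  have "(\<forall>m\<in>keys f. \<exists>A\<in>E. A \<subseteq> keys m) \<longleftrightarrow> (\<forall>m\<in>keys f. \<forall>C\<in>F. keys m \<inter> C \<noteq> {})"
    if f: "f \<in> pol V" for f :: "('v, 'k) mpoly"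
  proof (rule ball_cong[OF refl])
    fix m assume "m \<in> keys f"
    then have "keys m \<subseteq> V" using f by (simp add: pol_def)
    then show "(\<exists>A\<in>E. A \<subseteq> keys m) \<longleftrightarrow> (\<forall>C\<in>F. keys m \<inter> C \<noteq> {})" by (rule iff)
  qed
  then have "{f \<in> pol V. \<forall>m\<in>keys f. \<exists>A\<in>E. A \<subseteq> keys m} = (meet_ideal V F :: ('v, 'k) mpoly set)"
    unfolding meet_ideal_def by (intro Collect_cong conj_cong refl)
  moreover have "edge_ideal K V E = {f \<in> pol V. \<forall>m\<in>keys f. \<exists>A\<in>E. A \<subseteq> keys m}"
    using fin E by (rule edge_ideal_eq)
  ultimately show ?thesis by (simp only:)
qed

lemma (in cring) maximalideal_inverse:
  assumes M: "maximalideal M R" and x: "x \<in> carrier R" "x \<notin> M"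
  shows "\<exists>y\<in>carrier R. \<exists>m\<in>M. \<one> = m \<oplus> y \<otimes> x"
proof -
  interpret M: maximalideal M R by fact
  note I = add_PIdl[OF M.ideal_axioms x(1)]
  have "M <+> PIdl x = carrier R"
    using M.I_maximal[OF I(1,2)] I(3) x(2) additive_subgroup.a_subset[OF ideal.axioms(1)[OF I(1)]] by auto
  then show ?thesis using I(4)[of \<one>] by auto
qed

lemma quotient_poly_hom:
  fixes I :: "('v, 'k::field) mpoly set" and K :: "'k itself"
  assumes fin: "finite V" and I: "pideal V I"
  shows "poly_hom (mpoly_ring K V Quot I) V (\<lambda>a. I +>\<^bsub>mpoly_ring K V\<^esub> a)"
proof -
  let ?R = "mpoly_ring K V" and ?h = "\<lambda>a. I +>\<^bsub>mpoly_ring K V\<^esub> a"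
  interpret R: cring ?R by (rule mpoly_cring)
  interpret I: ideal I ?R using I by (simp add: ideal_iff_pideal)
  interpret Q: cring "?R Quot I" by (rule I.quotient_is_cring[OF R.is_cring])
  note hom = I.rcos_ring_hom
  show ?thesis
  proof
    show "?h a \<in> carrier (?R Quot I)" if "a \<in> pol V" for a
      using ring_hom_closed[OF hom] that by simp
    show "?h (a + b) = ?h a \<oplus>\<^bsub>?R Quot I\<^esub> ?h b" if "a \<in> pol V" "b \<in> pol V" for a b
      using ring_hom_add[OF hom, of a b] that by simp
    show "?h (a * b) = ?h a \<otimes>\<^bsub>?R Quot I\<^esub> ?h b" if "a \<in> pol V" "b \<in> pol V" for a b
      using ring_hom_mult[OF hom, of a b] that by simp
    show one: "?h 1 = \<one>\<^bsub>?R Quot I\<^esub>" using ring_hom_one[OF hom] by simp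
    fix x assume x: "x \<in> carrier (?R Quot I)"
    then obtain a where a: "a \<in> pol V" "x = ?h a" by (auto simp: FactRing_def A_RCOSETS_def')
    show "\<exists>a\<in>pol V. \<exists>s\<in>pol V. ?h s \<in> Units (?R Quot I) \<and> x \<otimes>\<^bsub>?R Quot I\<^esub> ?h s = ?h a"
      using a x one by (intro bexI[of _ a] bexI[of _ 1]) auto
  qed (rule fin)
qed

text \<open>The factor \<open>var v\<close> makes the degree positive; the leading coefficient of
  \<open>q\<close> is a constant because \<open>q\<close> involves only \<open>v\<close>, so
  \<open>c\<close> can be its inverse.\<close>

lemma monic_normalization:
  fixes q :: "('v, 'k::field) mpoly"
  assumes v: "v \<in> V" and q: "q \<in> pol {v}" "q \<noteq> 0"
  shows "\<exists>c. \<exists>D>0. monic_in V v D (single 0 c * (var v * q))"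
proof -
  obtain N h r where hr: "h \<in> pol ({v} - {v})" "h \<noteq> 0" "r \<in> pol {v}" "r \<in> lowdeg v N" "q = var v ^ N * h + r"
    using top_exists[OF q, of v] by metis
  have h: "h = single 0 (lookup h 0)" using hr(1) by (intro pol_empty) simp
  define c where "c = inverse (lookup h 0)"
  have "lookup h 0 \<noteq> 0" using h hr(2) by (metis single_zero)
  then have ch: "single 0 c * h = 1" by (subst h) (simp add: mult_single c_def)
  have vD: "(var v :: ('v, 'k) mpoly) \<in> lowdeg v (Suc 1)" by (simp add: var_def monomial_def lowdeg_def)
  have "var v * r \<in> lowdeg v (1 + N)" using vD hr(4) by (rule lowdeg_mult)
  moreover have "single 0 c \<in> lowdeg v (Suc 0)" by (simp add: lowdeg_def)
  ultimately have low: "single 0 c * (var v * r) \<in> lowdeg v (Suc N)" using lowdeg_mult by fastforce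
  have rV: "r \<in> pol V" using hr(3) pol_mono[of "{v}" V] v by auto
  have "single 0 c * (var v * q) - var v ^ Suc N = var v ^ Suc N * (single 0 c * h) + single 0 c * (var v * r) - var v ^ Suc N"
    unfolding hr(5) by (simp add: algebra_simps)
  also have "\<dots> = single 0 c * (var v * r)" by (simp add: ch)
  finally have "monic_in V v (Suc N) (single 0 c * (var v * q))"
    unfolding monic_in_def using low rV v by simp
  then show ?thesis by blast
qed

text \<open>Each cover in \<open>Cs\<close> meets every fibre of \<open>\<tau>\<close> exactly once.
  So \<open>card V\<close> minus the number of fibres is both the length of the regular sequence and
  the number of variables outside each cover.\<close>

theorem cohen_macaulay_of_shelling:
  fixes V :: "'v set" and K :: "'k::field itself"
  assumes fin: "finite V" and E: "\<And>A. A \<in> E \<Longrightarrow> A \<subseteq> V" and sh: "shelling Cs"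
    and cov: "\<And>C. C \<in> set Cs \<Longrightarrow> vertex_cover V E C"
    and sub: "\<And>C. vertex_cover V E C \<Longrightarrow> \<exists>C'\<in>set Cs. C' \<subseteq> C"
    and tau: "\<And>v. v \<in> V \<Longrightarrow> \<tau> v \<in> V" "\<And>v. v \<in> V \<Longrightarrow> \<tau> (\<tau> v) = \<tau> v"
    and transversal: "\<And>C. C \<in> set Cs \<Longrightarrow> inj_on \<tau> C" "\<And>C. C \<in> set Cs \<Longrightarrow> \<tau> ` C = \<tau> ` V"
  shows "cohen_macaulay_clutter K V E"
proof -
  let ?R = "mpoly_ring K V"
  define I :: "('v, 'k) mpoly set" where "I = meet_ideal V (set Cs)"
  have IE: "edge_ideal K V E = I" unfolding I_def by (rule edge_ideal_eq_meet_ideal[OF fin E cov sub])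
  have I: "pideal V I" unfolding I_def by (rule pideal_meet_ideal)
  have CV: "C \<subseteq> V" if "C \<in> set Cs" for C using cov[OF that] by (simp add: vertex_cover_def)
  define A where "A = ?R Quot I"
  let ?q = "\<lambda>a. I +>\<^bsub>?R\<^esub> a"
  interpret Q: poly_hom A V ?q unfolding A_def by (rule quotient_poly_hom[OF fin I])
  interpret R: cring ?R by (rule mpoly_cring)
  interpret II: ideal I ?R using I by (simp add: ideal_iff_pideal)
  have qzero: "?q a = \<zero>\<^bsub>A\<^esub> \<longleftrightarrow> a \<in> I" if "a \<in> pol V" for a
    using that II.rcos_const_imp_mem[of a] R.a_rcos_zero[OF II.is_ideal, of a] by (auto simp: A_def FactRing_def)
  have qrep: "\<exists>a\<in>pol V. x = ?q a" if "x \<in> carrier A" for x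
    using that by (auto simp: A_def FactRing_def A_RCOSETS_def')
  have "cm_local_ring (localization A (carrier A - N))" if N: "maximalideal N A" for N
  proof -
    interpret N: maximalideal N A by fact
    have Np: "primeideal N A" by (rule Q.maximalideal_prime[OF N])
    interpret Np: primeideal N A by fact
    let ?S = "carrier A - N"
    have N1: "\<one>\<^bsub>A\<^esub> \<notin> N" using N.one_imp_carrier N.I_notcarr by auto
    interpret S: mult_subset A ?S
      by unfold_locales (use N1 Np.I_prime in auto)
    define B where "B = localization A ?S"
    define h where "h a = frac A ?S (?q a) \<one>\<^bsub>A\<^esub>" for a
    define M where "M = Q.pull N"
    have Mmem: "a \<in> M \<longleftrightarrow> a \<in> pol V \<and> ?q a \<in> N" for a by (auto simp: M_def Q.pull_def)
    have M: "pprime V M" unfolding M_def by (rule Q.pprime_pull[OF Np])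
    note MD = pidealD[OF pprimeD(1)[OF M]]
    have qS: "?q s \<in> ?S" if "s \<in> pol V - M" for s using that Mmem by auto
    have IM: "I \<subseteq> M"
    proof
      fix a assume a: "a \<in> I"
      then have aV: "a \<in> pol V" using pidealD(1)[OF I] by auto
      then have "?q a = \<zero>\<^bsub>A\<^esub>" using qzero a by simp
      then show "a \<in> M" unfolding Mmem using aV N.zero_closed by simp
    qed
    have den: "\<exists>a\<in>pol V. \<exists>s\<in>pol V - M. x \<otimes>\<^bsub>B\<^esub> h s = h a" if x: "x \<in> carrier B" for x
    proof -
      obtain y t where yt: "y \<in> carrier A" "t \<in> ?S" "x = frac A ?S y t"
        using S.loc_elim x unfolding B_def by metis
      obtain a s where as: "a \<in> pol V" "y = ?q a" "s \<in> pol V" "t = ?q s" using qrep yt by (metis DiffD1)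
      have "s \<in> pol V - M" using as yt Mmem by auto
      moreover have "x \<otimes>\<^bsub>B\<^esub> h s = h a"
        unfolding B_def h_def yt(3) as(2,4)[symmetric] by (rule S.loc_denominator[OF yt(1,2)])
      ultimately show ?thesis using as by blast
    qed
    have unit: "h s \<in> Units B" if "s \<in> pol V - M" for s
      unfolding h_def B_def by (rule S.loc_unit[OF qS[OF that]])
    interpret B: cring B unfolding B_def by (rule S.loc_cring)
    interpret L: local_map B V h I M
    proof
      show "h a \<in> carrier B" if "a \<in> pol V" for a
        unfolding h_def B_def using that S.S_one by (intro S.loc_closed) auto
      show "h (a + b) = h a \<oplus>\<^bsub>B\<^esub> h b" "h (a * b) = h a \<otimes>\<^bsub>B\<^esub> h b" if "a \<in> pol V" "b \<in> pol V" for a b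
        unfolding h_def B_def using that by (simp_all add: Q.h_add Q.h_mult S.loc_hom)
      show "h 1 = \<one>\<^bsub>B\<^esub>" unfolding h_def B_def by (simp add: Q.h_one S.loc_one)
      show "\<exists>a\<in>pol V. \<exists>s\<in>pol V. h s \<in> Units B \<and> x \<otimes>\<^bsub>B\<^esub> h s = h a" if "x \<in> carrier B" for x
        using den[OF that] unit by blast
      show "h a = \<zero>\<^bsub>B\<^esub> \<longleftrightarrow> (\<exists>u\<in>pol V - M. u * a \<in> I)" if a: "a \<in> pol V" for a
      proof -
        have "h a = \<zero>\<^bsub>B\<^esub> \<longleftrightarrow> (\<exists>u\<in>?S. u \<otimes>\<^bsub>A\<^esub> ?q a = \<zero>\<^bsub>A\<^esub>)"
          unfolding h_def B_def using a by (intro S.loc_zero_iff) auto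
        also have "\<dots> \<longleftrightarrow> (\<exists>u\<in>pol V - M. u * a \<in> I)"
        proof
          assume "\<exists>u\<in>?S. u \<otimes>\<^bsub>A\<^esub> ?q a = \<zero>\<^bsub>A\<^esub>"
          then obtain x where x: "x \<in> ?S" "x \<otimes>\<^bsub>A\<^esub> ?q a = \<zero>\<^bsub>A\<^esub>" by auto
          then obtain u where u: "u \<in> pol V" "x = ?q u" using qrep by auto
          then have "?q (u * a) = \<zero>\<^bsub>A\<^esub>" using x a by (simp add: Q.h_mult)
          then have "u * a \<in> I" using qzero[of "u * a"] u a by auto
          moreover have "u \<in> pol V - M" using u x Mmem by auto
          ultimately show "\<exists>u\<in>pol V - M. u * a \<in> I" by blast
        next
          assume "\<exists>u\<in>pol V - M. u * a \<in> I"
          then obtain u where u: "u \<in> pol V - M" "u * a \<in> I" by auto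
          then have "?q u \<otimes>\<^bsub>A\<^esub> ?q a = \<zero>\<^bsub>A\<^esub>" using qzero[of "u * a"] a by (simp add: Q.h_mult)
          then show "\<exists>u\<in>?S. u \<otimes>\<^bsub>A\<^esub> ?q a = \<zero>\<^bsub>A\<^esub>" using qS[OF u(1)] by blast
        qed
        finally show ?thesis .
      qed
    qed (use fin I M IM den unit in auto)
    have inv: "\<exists>g\<in>pol V. f * g - 1 \<in> M" if f: "f \<in> pol V" "f \<notin> M" for f
    proof -
      obtain y m where ym: "y \<in> carrier A" "m \<in> N" "\<one>\<^bsub>A\<^esub> = m \<oplus>\<^bsub>A\<^esub> y \<otimes>\<^bsub>A\<^esub> ?q f"
        using Q.maximalideal_inverse[OF N, of "?q f"] f Mmem by auto
      obtain g where g: "g \<in> pol V" "y = ?q g" using qrep ym by auto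
      obtain n where n: "n \<in> pol V" "m = ?q n" using qrep N.Icarr ym by metis
      have "?q 1 = ?q (n + g * f)" using ym f g n by (simp add: Q.h_one Q.h_add Q.h_mult)
      then have "?q (1 - (n + g * f)) = \<zero>\<^bsub>A\<^esub>"
        using f g n Q.h_diff[of 1 "n + g * f"] by (simp add: a_minus_def Q.r_neg)
      then have "1 - (n + g * f) \<in> I" using qzero[of "1 - (n + g * f)"] f g n by auto
      then have "1 - (n + g * f) \<in> M" using IM by auto
      moreover have "n \<in> M" using n ym Mmem by auto
      ultimately have "(1 - (n + g * f)) + n \<in> M" by (rule MD(3))
      from MD(5)[OF this] have "f * g - 1 \<in> M" by (simp add: algebra_simps)
      then show ?thesis using g by auto
    qed
    have "\<exists>z. z \<in> pol {v} \<and> z \<in> gen V {var v} \<and> (\<exists>D>0. monic_in V v D z) \<and> z \<in> M" if v: "v \<in> V" for v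
    proof -
      obtain q where q: "q \<in> M" "q \<in> pol {v}" "q \<noteq> 0"
        using nullstellensatz[OF fin pprimeD(1)[OF M] inv v] by auto
      obtain c D where c: "D > 0" "monic_in V v D (single 0 c * (var v * q))"
        using monic_normalization[OF v q(2,3)] by auto
      have "single 0 c * (var v * q) = (single 0 c * q) * var v" by (simp add: ac_simps)
      moreover have "(single 0 c * q) * var v \<in> gen V {var v}"
        using q(1) MD(1) by (intro gen_base_mult) auto
      ultimately have "single 0 c * (var v * q) \<in> gen V {var v}" by (simp only:)
      moreover have "(single 0 c * var v) * q \<in> M" using v by (intro MD(4)[OF _ q(1)]) auto
      ultimately show ?thesis using c q(2)
        by (intro exI[of _ "single 0 c * (var v * q)"]) (auto simp: mult.assoc)
    qed
    then have "\<forall>v\<in>V. \<exists>z. z \<in> pol {v} \<and> z \<in> gen V {var v} \<and> (\<exists>D>0. monic_in V v D z) \<and> z \<in> M" by blast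
    from bchoice[OF this] obtain z where z: "\<And>v. v \<in> V \<Longrightarrow> z v \<in> pol {v}" "\<And>v. v \<in> V \<Longrightarrow> z v \<in> gen V {var v}"
      "\<And>v. v \<in> V \<Longrightarrow> \<exists>D>0. monic_in V v D (z v)" "\<And>v. v \<in> V \<Longrightarrow> z v \<in> M" by auto
    obtain vs where vs: "set vs = {v \<in> V. \<tau> v \<noteq> v}" "distinct vs"
      using finite_distinct_list[of "{v \<in> V. \<tau> v \<noteq> v}"] fin by auto
    define xs where "xs = map (\<lambda>v. z v - z (\<tau> v)) vs"
    have xsM: "set xs \<subseteq> M"
      using vs(1) z(4) tau(1) MD(6) by (auto simp: xs_def)
    have xsV: "set xs \<subseteq> pol V" using xsM MD(1) by auto
    have "weakly_regular (pol V) (meet_ideal V {C}) xs" if C: "C \<in> set Cs" for C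
      unfolding meet_ideal_singleton[OF CV[OF C]] xs_def
    proof (rule differences_weakly_regular)
      show "finite C" using CV[OF C] fin by (rule finite_subset)
      show "c = c'" if "c \<in> C" "c' \<in> C" "\<tau> c = \<tau> c'" for c c'
        using transversal(1)[OF C] that by (auto dest: inj_onD)
    qed (use CV C tau z vs in auto)
    then have wr: "weakly_regular (pol V) (gen V I) xs"
      unfolding gen_pideal[OF I] unfolding I_def by (intro shelling_weakly_regular[OF fin CV sh xsV])
    have len: "length xs = card (V - \<tau> ` V)"
    proof -
      have "{v \<in> V. \<tau> v \<noteq> v} = V - \<tau> ` V" using tau by (auto simp: image_iff) (metis)
      then show ?thesis using vs by (simp add: xs_def distinct_card[symmetric])
    qed
    have "cm_local_ring B"
    proof (rule L.cm_local_ringI[OF xsM])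
      show "y \<in> gen V (I \<union> set (take i xs))"
        if "i < length xs" "y \<in> pol V" "xs ! i * y \<in> gen V (I \<union> set (take i xs))" for i y
        by (rule weakly_regular_regular[OF wr that])
      fix P assume P: "pprime V P" "I \<subseteq> P"
      \<comment> \<open>A prime containing every edge monomial contains a variable from each edge,
        so these variables form a cover.\<close>
      let ?C = "{x \<in> V. var x \<in> P}"
      have "?C \<inter> e \<noteq> {}" if e: "e \<in> E" for e
      proof -
        have fe: "finite e" "e \<subseteq> V" using E[OF e] fin by (auto intro: finite_subset)
        have "(\<Prod>x\<in>e. var x :: ('v, 'k) mpoly) \<in> I"
        proof -
          have "I = {f \<in> pol V. \<forall>m\<in>keys f. \<exists>A\<in>E. A \<subseteq> keys m}"
            unfolding IE[symmetric] using fin E by (rule edge_ideal_eq)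
          then show ?thesis unfolding prod_var[OF fe(1)] using fe e by (auto simp: monomial_def)
        qed
        then obtain x where "x \<in> e" "var x \<in> P" using pprime_prod_var[OF P(1) fe] P(2) by blast
        then show ?thesis using fe by auto
      qed
      then have "vertex_cover V E ?C" by (auto simp: vertex_cover_def)
      then obtain C where C: "C \<in> set Cs" "C \<subseteq> ?C" using sub by auto
      have finC: "finite C" using CV[OF C(1)] fin by (rule finite_subset)
      have "card C = card (\<tau> ` V)" using card_image[OF transversal(1)[OF C(1)]] transversal(2)[OF C(1)] by simp
      moreover have "\<tau> ` V \<subseteq> V" using tau(1) by auto
      ultimately have "card (V - C) = length xs"
        unfolding len using card_Diff_subset[OF finC CV[OF C(1)]] card_Diff_subset[of "\<tau> ` V" V] fin tau(1) by auto
      then show "\<exists>C\<subseteq>V. card (V - C) = length xs \<and> var ` C \<subseteq> P" using C CV[OF C(1)] by blast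
    qed
    then show ?thesis by (simp add: B_def)
  qed
  then show ?thesis
    unfolding cohen_macaulay_clutter_def cohen_macaulay_ring_def IE A_def[symmetric]
    using Q.is_cring Q.noetherian by blast
qed

section \<open>Linear quotients of the Alexander dual\<close>

lemma cover_contains_minimal:
  assumes "finite C" "vertex_cover V E C"
  shows "\<exists>D\<subseteq>C. minimal_vertex_cover V E D"
proof -
  let ?P = "{D. D \<subseteq> C \<and> vertex_cover V E D}"
  have "finite ?P" by (rule finite_subset[of _ "Pow C"]) (use assms in auto)
  then obtain D where "D \<in> ?P" and min: "\<forall>D'\<in>?P. D' \<subseteq> D \<longrightarrow> D = D'"
    using finite_has_minimal2[of ?P C] assms by auto
  then show ?thesis unfolding minimal_vertex_cover_def by (intro exI[of _ D]) auto
qed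

lemma minimal_vertex_cover_subset:
  "minimal_vertex_cover V E C \<Longrightarrow> minimal_vertex_cover V E D \<Longrightarrow> D \<subseteq> C \<Longrightarrow> D = C"
  unfolding minimal_vertex_cover_def by blast

lemma minimal_vertex_cover_finite:
  "finite V \<Longrightarrow> minimal_vertex_cover V E C \<Longrightarrow> C \<subseteq> V \<and> finite C"
  unfolding minimal_vertex_cover_def vertex_cover_def using finite_subset by blast

lemma alexander_dual_gen:
  fixes V :: "'v set" and E :: "'v set set" and K :: "'k::field itself"
  assumes fin: "finite V"
  defines "F \<equiv> {C. minimal_vertex_cover V E C}"
  shows "alexander_dual K V E = gen V ((\<lambda>C. monomial (sqf_exp C)) ` F)"
proof -
  note mf = minimal_vertex_cover_finite[OF fin]
  have "{\<Prod>x\<in>C. var x | C. minimal_vertex_cover V E C}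
      = (\<lambda>C. \<Prod>x\<in>C. var x :: ('v, 'k) mpoly) ` F" by (auto simp: F_def)
  also have "\<dots> = (\<lambda>C. monomial (sqf_exp C)) ` F"
    using mf by (intro image_cong refl prod_var) (auto simp: F_def)
  finally have eq: "{\<Prod>x\<in>C. var x | C. minimal_vertex_cover V E C}
      = (\<lambda>C. monomial (sqf_exp C) :: ('v, 'k) mpoly) ` F" .
  have sub: "(\<lambda>C. monomial (sqf_exp C)) ` F \<subseteq> (pol V :: ('v, 'k) mpoly set)"
  proof safe
    fix C assume "C \<in> F"
    then have "C \<subseteq> V" "finite C" using mf[of E C] by (auto simp: F_def)
    then show "monomial (sqf_exp C) \<in> (pol V :: ('v, 'k) mpoly set)" by simp
  qed
  show ?thesis unfolding alexander_dual_def eq by (rule Idl_eq_gen[OF sub])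
qed

lemma alexander_dual_eq:
  fixes V :: "'v set" and E :: "'v set set" and K :: "'k::field itself"
  assumes fin: "finite V"
  shows "alexander_dual K V E = {f \<in> pol V. \<forall>m\<in>keys f. \<exists>C. minimal_vertex_cover V E C \<and> C \<subseteq> keys m}"
proof -
  note mf = minimal_vertex_cover_finite[OF fin]
  have "gen V ((\<lambda>C. monomial (sqf_exp C)) ` {C. minimal_vertex_cover V E C})
    = {f \<in> pol V :: ('v, 'k) mpoly set. \<forall>m\<in>keys f. \<exists>C\<in>{C. minimal_vertex_cover V E C}. C \<subseteq> keys m}"
    using mf by (intro monomial_ideal_mem) auto
  then show ?thesis unfolding alexander_dual_gen[OF fin] by simp
qed

lemma mon_degree_sqf_exp:
  assumes "finite C" shows "mon_degree (sqf_exp C) = card C"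
  unfolding mon_degree_def using assms by (simp add: lookup_sqf_exp)

lemma monomial_inj: "monomial m = (monomial n :: ('v, 'k::field) mpoly) \<Longrightarrow> m = n"
proof -
  assume eq: "monomial m = (monomial n :: ('v, 'k) mpoly)"
  have "keys (monomial m :: ('v, 'k) mpoly) = {m}" "keys (monomial n :: ('v, 'k) mpoly) = {n}"
    by (simp_all add: monomial_def)
  then show "m = n" unfolding eq by simp
qed

text \<open>The colon ideal is generated by the variables \<open>v\<close> for which some earlier
  cover exceeds the current one by exactly \<open>v\<close>; by the shelling condition every earlier
  generator contributes a multiple of such a variable. Equal cardinalities make the degrees
  sorted.\<close>

lemma linear_quotients_of_shelling:
  fixes V :: "'v set" and E :: "'v set set" and K :: "'k::field itself"
  assumes fin: "finite V" and Cs: "set Cs = {C. minimal_vertex_cover V E C}" "distinct Cs" "shelling Cs"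
    and card: "\<And>C. C \<in> set Cs \<Longrightarrow> card C = g"
  shows "has_linear_quotients (mpoly_ring K V) (alexander_dual K V E)"
proof -
  let ?R = "mpoly_ring K V"
  let ?mon = "\<lambda>C. monomial (sqf_exp C) :: ('v, 'k) mpoly"
  have CV: "C \<subseteq> V" "finite C" if "C \<in> set Cs" for C
    using minimal_vertex_cover_finite[OF fin, of E C] that Cs(1) by auto
  have ideal_of: "Idl\<^bsub>?R\<^esub> (?mon ` F) = {f \<in> pol V. \<forall>m\<in>keys f. \<exists>C\<in>F. C \<subseteq> keys m}" if F: "F \<subseteq> set Cs" for F
  proof -
    have "?mon ` F \<subseteq> pol V"
    proof safe
      fix C assume "C \<in> F"
      then have "C \<in> set Cs" using F by auto
      then show "?mon C \<in> pol V" using CV[of C] by simp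
    qed
    moreover have "gen V (?mon ` F) = {f \<in> pol V. \<forall>m\<in>keys f. \<exists>C\<in>F. C \<subseteq> keys m}"
      using F CV by (intro monomial_ideal_mem) auto
    ultimately show ?thesis by (simp add: Idl_eq_gen)
  qed
  define ms where "ms = map sqf_exp Cs"
  have us: "map monomial ms = map ?mon Cs" by (simp add: ms_def)
  have setus: "set (map ?mon Cs) = ?mon ` set Cs" by simp
  have dual: "Idl\<^bsub>?R\<^esub> (?mon ` set Cs) = alexander_dual K V E"
    unfolding ideal_of[OF subset_refl] alexander_dual_eq[OF fin] by (simp add: Cs(1))
  have inj: "C = C'" if "?mon C = ?mon C'" "C \<in> set Cs" "C' \<in> set Cs" for C C'
    using monomial_inj[OF that(1)] keys_sqf_exp CV that(2,3) by metis
  have 1: "set (map ?mon Cs) \<subseteq> carrier ?R" using CV by auto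
  have 2: "distinct (map ?mon Cs)" using Cs(2) inj by (auto simp: distinct_map inj_on_def)
  have 3: "Idl\<^bsub>?R\<^esub> U \<noteq> alexander_dual K V E" if U: "U \<subset> ?mon ` set Cs" for U
  proof
    assume eq: "Idl\<^bsub>?R\<^esub> U = alexander_dual K V E"
    define F where "F = {C \<in> set Cs. ?mon C \<in> U}"
    have UF: "U = ?mon ` F" using U unfolding F_def by blast
    have "?mon ` set Cs \<noteq> U" using U by auto
    then have "F \<noteq> set Cs" using UF by metis
    moreover have FCs: "F \<subseteq> set Cs" unfolding F_def by (rule Collect_restrict)
    ultimately obtain C where C: "C \<in> set Cs" "C \<notin> F" by blast
    have "?mon C \<in> Idl\<^bsub>?R\<^esub> (?mon ` set Cs)"
      unfolding ideal_of[OF subset_refl] using C CV[of C] by (auto simp: monomial_def)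
    then have "?mon C \<in> Idl\<^bsub>?R\<^esub> (?mon ` F)" unfolding dual using eq UF by simp
    then obtain C' where C': "C' \<in> F" "C' \<subseteq> C"
      unfolding ideal_of[OF FCs] using CV[of C] C(1) by (auto simp: monomial_def)
    moreover have "minimal_vertex_cover V E C" "minimal_vertex_cover V E C'"
      using C(1) C'(1) FCs Cs(1) by auto
    ultimately have "C' = C" by (intro minimal_vertex_cover_subset)
    then show False using C(2) C'(1) by simp
  qed
  have 4: "sorted (map mon_degree ms)"
  proof -
    have "mon_degree (sqf_exp C) = g" if "C \<in> set Cs" for C
      using mon_degree_sqf_exp[OF CV(2)[OF that]] card[OF that] by simp
    then have "map mon_degree ms = map (\<lambda>_. g) Cs" unfolding ms_def by simp
    then show ?thesis by (simp add: sorted_iff_nth_mono)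
  qed
  have 5: "\<exists>L. L \<subseteq> carrier ?R \<and> (\<forall>f\<in>L. linear_form f) \<and>
      colon ?R (Idl\<^bsub>?R\<^esub> (set (take i (map ?mon Cs)))) (map ?mon Cs ! i) = Idl\<^bsub>?R\<^esub> L"
    if i: "i < length Cs" for i
  proof (intro exI conjI ballI)
    define W where "W = {v. \<exists>k<i. Cs ! k - Cs ! i = {v}}"
    let ?F = "set (take i Cs)"
    have WV: "W \<subseteq> V"
    proof
      fix v assume "v \<in> W"
      then obtain k where "k < i" "Cs ! k - Cs ! i = {v}" by (auto simp: W_def)
      then have "v \<in> Cs ! k" "Cs ! k \<in> set Cs" using i by auto
      then show "v \<in> V" using CV by auto
    qed
    have FS: "?F \<subseteq> set Cs" by (rule set_take_subset)
    have Ci: "Cs ! i \<in> set Cs" using i by simp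
    show "var ` W \<subseteq> carrier ?R" using WV by auto
    show "linear_form f" if "f \<in> var ` W" for f :: "('v, 'k) mpoly"
      using that by (auto simp: linear_form_def var_def monomial_def mon_degree_def)
    have key: "(\<exists>C\<in>?F. C \<subseteq> Cs ! i \<union> S) \<longleftrightarrow> S \<inter> W \<noteq> {}" for S
    proof
      assume "\<exists>C\<in>?F. C \<subseteq> Cs ! i \<union> S"
      then obtain k0 where k0: "k0 < i" "Cs ! k0 \<subseteq> Cs ! i \<union> S" using i by (auto simp: in_set_conv_nth)
      then obtain k v where k: "k < i" "v \<in> Cs ! k0" "Cs ! k - Cs ! i = {v}"
        using Cs(3) i unfolding shelling_def by blast
      then have "v \<in> W" "v \<notin> Cs ! i" by (auto simp: W_def)
      then show "S \<inter> W \<noteq> {}" using k k0 by auto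
    next
      assume "S \<inter> W \<noteq> {}"
      then obtain v k where k: "v \<in> S" "k < i" "Cs ! k - Cs ! i = {v}" by (auto simp: W_def)
      then have "Cs ! k \<in> ?F" using i by (auto simp: in_set_conv_nth)
      moreover have "Cs ! k \<subseteq> Cs ! i \<union> S" using k by auto
      ultimately show "\<exists>C\<in>?F. C \<subseteq> Cs ! i \<union> S" by blast
    qed
    have "colon ?R (Idl\<^bsub>?R\<^esub> (?mon ` ?F)) (?mon (Cs ! i)) = {f \<in> pol V. \<forall>m\<in>keys f. keys m \<inter> W \<noteq> {}}"
    proof -
      have "r * ?mon (Cs ! i) \<in> Idl\<^bsub>?R\<^esub> (?mon ` ?F) \<longleftrightarrow> (\<forall>m\<in>keys r. keys m \<inter> W \<noteq> {})" if r: "r \<in> pol V" for r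
      proof -
        have k: "keys (r * ?mon (Cs ! i)) = (+) (sqf_exp (Cs ! i)) ` keys r"
          by (simp add: monomial_def mult.commute[of r] keys_single_mult)
        have "r * ?mon (Cs ! i) \<in> pol V" using r CV[OF Ci] by auto
        then have "r * ?mon (Cs ! i) \<in> Idl\<^bsub>?R\<^esub> (?mon ` ?F) \<longleftrightarrow>
            (\<forall>m\<in>keys r. \<exists>C\<in>?F. C \<subseteq> Cs ! i \<union> keys m)"
          using CV[OF Ci] by (simp add: ideal_of[OF FS] k keys_plus_nat)
        then show ?thesis by (simp add: key)
      qed
      then show ?thesis by (auto simp: colon_def)
    qed
    also have "\<dots> = meet_ideal V {W}" by (simp add: meet_ideal_def)
    also have "\<dots> = Idl\<^bsub>?R\<^esub> (var ` W)"
    proof -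
      have "var ` W \<subseteq> (pol V :: ('v, 'k) mpoly set)" using WV by auto
      then show ?thesis by (simp add: Idl_eq_gen meet_ideal_singleton[OF WV])
    qed
    finally show "colon ?R (Idl\<^bsub>?R\<^esub> (set (take i (map ?mon Cs)))) (map ?mon Cs ! i) = Idl\<^bsub>?R\<^esub> (var ` W)"
      using i by (simp add: take_map)
  qed
  show ?thesis
    unfolding has_linear_quotients_def Let_def
    by (rule exI[of _ ms]) (use 1 2 3 4 5 dual in \<open>simp only: us setus length_map; blast\<close>)
qed

text \<open>The order of the generators is unknown, so the conclusion is symmetric: whichever cover
  comes later is exchanged towards the earlier one.\<close>

lemma linear_quotients_exchange:
  fixes V :: "'v set" and E :: "'v set set" and K :: "'k::field itself"
  assumes fin: "finite V" and lq: "has_linear_quotients (mpoly_ring K V) (alexander_dual K V E)"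
    and C: "minimal_vertex_cover V E C" "minimal_vertex_cover V E C'" "C \<noteq> C'"
  shows "(\<exists>D v. minimal_vertex_cover V E D \<and> v \<in> C - C' \<and> D \<noteq> C' \<and> D \<subseteq> insert v C') \<or>
    (\<exists>D v. minimal_vertex_cover V E D \<and> v \<in> C' - C \<and> D \<noteq> C \<and> D \<subseteq> insert v C)"
proof -
  let ?R = "mpoly_ring K V" and ?I = "alexander_dual K V E"
  let ?mon = "\<lambda>C. monomial (sqf_exp C) :: ('v, 'k) mpoly"
  let ?mvc = "minimal_vertex_cover V E"
  note mf = minimal_vertex_cover_finite[OF fin]
  note I = alexander_dual_eq[OF fin, of K E]
  from lq obtain ms where H: "set (map monomial ms) \<subseteq> (pol V :: ('v, 'k) mpoly set) \<and>
      distinct (map monomial ms :: ('v, 'k) mpoly list) \<and>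
      Idl\<^bsub>?R\<^esub> (set (map monomial ms)) = ?I \<and>
      (\<forall>U. U \<subset> set (map monomial ms) \<longrightarrow> Idl\<^bsub>?R\<^esub> U \<noteq> ?I) \<and> sorted (map mon_degree ms) \<and>
      (\<forall>i. 1 \<le> i \<and> i < length ms \<longrightarrow>
        (\<exists>L. L \<subseteq> pol V \<and> (\<forall>f\<in>L. linear_form f) \<and>
          colon ?R (Idl\<^bsub>?R\<^esub> (set (take i (map monomial ms)))) (map monomial ms ! i) = Idl\<^bsub>?R\<^esub> L))"
    unfolding has_linear_quotients_def Let_def mpoly_ring_simps length_map by (rule exE)
  note ms = conjunct1[OF H] conjunct1[OF conjunct2[OF conjunct2[OF H]]]
    conjunct1[OF conjunct2[OF conjunct2[OF conjunct2[OF H]]], rule_format]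
  note dist_us = conjunct1[OF conjunct2[OF H]]
  note lin = conjunct2[OF conjunct2[OF conjunct2[OF conjunct2[OF conjunct2[OF H]]]], rule_format, OF conjI]
  have msV: "keys g \<subseteq> V" if "g \<in> set ms" for g
  proof -
    have "monomial g \<in> (pol V :: ('v, 'k) mpoly set)" using ms(1) that by (auto simp: image_subset_iff simp del: pol_monomial)
    then show ?thesis by simp
  qed
  have gen_of: "Idl\<^bsub>?R\<^esub> (monomial ` G) = {f \<in> pol V. \<forall>m\<in>keys f. \<exists>g\<in>G. \<exists>h. m = g + h}" if "G \<subseteq> set ms" for G
  proof -
    have "monomial ` G \<subseteq> (pol V :: ('v, 'k) mpoly set)" using msV that by auto
    moreover have "gen V (monomial ` G) = {f \<in> pol V :: ('v, 'k) mpoly set. \<forall>m\<in>keys f. \<exists>g\<in>G. \<exists>h. m = g + h}"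
      using msV that by (intro gen_monomials) auto
    ultimately show ?thesis by (simp add: Idl_eq_gen)
  qed
  have I2: "?I = {f \<in> pol V. \<forall>m\<in>keys f. \<exists>g\<in>set ms. \<exists>h. m = g + h}"
    using ms(2) gen_of[of "set ms"] by simp
  have cover_in: "\<exists>D. ?mvc D \<and> D \<subseteq> keys g" if g: "g \<in> set ms" for g
  proof -
    have "monomial g \<in> ?I" unfolding I2 using g msV[OF g] by (auto simp: monomial_def intro!: exI[of _ 0])
    then show ?thesis unfolding I by (auto simp: monomial_def)
  qed
  \<comment> \<open>A generator dividing the monomial of a minimal cover has a support containing a
    minimal cover, hence this one, and so equals that monomial.\<close>
  have sqf_in: "sqf_exp D \<in> set ms" if D: "?mvc D" for D
  proof -
    have Df: "D \<subseteq> V" "finite D" using mf[OF D] by auto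
    have "?mon D \<in> ?I" unfolding I using D Df by (auto simp: monomial_def)
    then obtain g h where gh: "g \<in> set ms" "sqf_exp D = g + h" unfolding I2 by (auto simp: monomial_def)
    obtain D' where D': "?mvc D'" "D' \<subseteq> keys g" using cover_in[OF gh(1)] by auto
    have "keys g \<subseteq> D" using keys_plus_nat[of g h] gh(2) Df by (metis keys_sqf_exp Un_upper1)
    then have "D' = D" using minimal_vertex_cover_subset[OF D D'(1)] D' by auto
    then obtain k where "g = sqf_exp D + k" using sqf_exp_dvd[OF Df(2)] D' by auto
    then have "g + 0 = g + (k + h)" using gh(2) by (metis add.assoc add.right_neutral add.commute)
    then have "k + h = 0" by (metis add_left_cancel)
    then have "keys k \<union> keys h = {}" by (metis keys_plus_nat keys_zero)
    then have "h = 0" using keys_nonempty[of h] by auto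
    then show ?thesis using gh by simp
  qed
  \<comment> \<open>Any further generator would be a proper multiple of the monomial of a minimal
    cover and could be dropped, against irredundancy.\<close>
  have is_sqf: "\<exists>D. ?mvc D \<and> g = sqf_exp D" if g: "g \<in> set ms" for g
  proof (rule ccontr)
    assume neg: "\<not> ?thesis"
    obtain D where D: "?mvc D" "D \<subseteq> keys g" using cover_in[OF g] by auto
    have ne: "sqf_exp D \<noteq> g" using neg D by auto
    have "finite D" using mf[OF D(1)] by simp
    then obtain h where h: "g = sqf_exp D + h" using sqf_exp_dvd[of D g] D(2) by auto
    let ?G = "set ms - {g}"
    have "(monomial ` ?G :: ('v, 'k) mpoly set) \<subset> set (map monomial ms)"
    proof
      show "(monomial ` ?G :: ('v, 'k) mpoly set) \<subseteq> set (map monomial ms)" by auto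
      have "monomial g \<notin> (monomial ` ?G :: ('v, 'k) mpoly set)" using monomial_inj by auto
      moreover have "monomial g \<in> (set (map monomial ms) :: ('v, 'k) mpoly set)" using g by auto
      ultimately show "monomial ` ?G \<noteq> (set (map monomial ms) :: ('v, 'k) mpoly set)" by metis
    qed
    then have "Idl\<^bsub>?R\<^esub> (monomial ` ?G) \<noteq> ?I" by (rule ms(3))
    moreover have "(\<exists>g\<in>?G. \<exists>h. m = g + h) \<longleftrightarrow> (\<exists>g\<in>set ms. \<exists>h. m = g + h)" for m
    proof
      assume "\<exists>g\<in>set ms. \<exists>h. m = g + h"
      then obtain g' k where g': "g' \<in> set ms" "m = g' + k" by auto
      show "\<exists>g\<in>?G. \<exists>h. m = g + h"
      proof (cases "g' = g")
        case True
        then have "m = sqf_exp D + (h + k)" using g' h by (simp add: add.assoc)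
        then show ?thesis using sqf_in[OF D(1)] ne by blast
      next
        case False
        then show ?thesis using g' by blast
      qed
    qed blast
    ultimately show False unfolding gen_of[of ?G, OF Diff_subset] I2 by simp
  qed
  \<comment> \<open>The monomial of \<open>A - A'\<close> lies in the colon ideal, so a monomial of
    some linear form divides it; that is a variable \<open>v\<close> of \<open>A - A'\<close>.
    Multiplying the form by the monomial of \<open>A'\<close> exhibits an earlier generator dividing
    \<open>v\<close> times that monomial.\<close>
  have core: "\<exists>D v. ?mvc D \<and> v \<in> A - A' \<and> D \<noteq> A' \<and> D \<subseteq> insert v A'"
    if A: "?mvc A" "?mvc A'" and ij: "i < j" "j < length ms" "ms ! i = sqf_exp A" "ms ! j = sqf_exp A'" for A A' i j
  proof -
    have Af: "A \<subseteq> V" "finite A" "A' \<subseteq> V" "finite A'" using mf[OF A(1)] mf[OF A(2)] by auto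
    obtain L where L: "L \<subseteq> pol V" "\<forall>f\<in>L. linear_form f"
      "colon ?R (Idl\<^bsub>?R\<^esub> (set (take j (map monomial ms)))) (map monomial ms ! j) = Idl\<^bsub>?R\<^esub> L"
      using lin[of j] ij by auto
    let ?G = "set (take j ms)"
    have GS: "?G \<subseteq> set ms" by (rule set_take_subset)
    have col: "r \<in> Idl\<^bsub>?R\<^esub> L \<longleftrightarrow> r \<in> pol V \<and> r * ?mon A' \<in> Idl\<^bsub>?R\<^esub> (monomial ` ?G)" for r
      unfolding L(3)[symmetric] using ij by (simp add: colon_def take_map)
    have kmul: "keys (r * ?mon A') = (+) (sqf_exp A') ` keys r" for r
      by (simp add: monomial_def mult.commute[of r] keys_single_mult)
    have pm: "?mon B \<in> pol V" if "B \<subseteq> V" "finite B" for B using that by simp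
    have "?mon (A - A') \<in> Idl\<^bsub>?R\<^esub> L"
      unfolding col gen_of[OF GS]
    proof (intro conjI CollectI ballI)
      show p: "?mon (A - A') \<in> pol V" using Af by (intro pm) auto
      show "?mon (A - A') * ?mon A' \<in> pol V" using p pm[OF Af(3,4)] by (rule pol_mult)
      fix m assume "m \<in> keys (?mon (A - A') * ?mon A')"
      then have m: "m = sqf_exp A' + sqf_exp (A - A')" unfolding kmul by (auto simp: monomial_def)
      have "A \<subseteq> keys m" using Af by (auto simp: m keys_plus_nat)
      then obtain h where "m = sqf_exp A + h" using sqf_exp_dvd[OF Af(2)] by auto
      moreover have "sqf_exp A \<in> ?G" using ij by (auto simp: in_set_conv_nth intro!: exI[of _ i])
      ultimately show "\<exists>g\<in>?G. \<exists>h. m = g + h" by blast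
    qed
    then have "?mon (A - A') \<in> gen V L" by (simp add: Idl_eq_gen[OF L(1)])
    moreover have "sqf_exp (A - A') \<in> keys (?mon (A - A'))" by (simp add: monomial_def)
    ultimately obtain l k h where l: "l \<in> L" "k \<in> keys l" "sqf_exp (A - A') = k + h" using gen_keys by metis
    have k1: "mon_degree k = 1" using L(2) l by (auto simp: linear_form_def)
    have "keys k \<noteq> {}" using k1 by (auto simp: mon_degree_def)
    then obtain v where v: "v \<in> keys k" by blast
    have "finite (A - A')" using Af by simp
    then have "keys k \<subseteq> A - A'" using keys_plus_nat[of k h] l(3) by (metis keys_sqf_exp Un_upper1)
    moreover have kv: "keys k \<subseteq> {v}"
    proof
      fix w assume w: "w \<in> keys k"
      show "w \<in> {v}"
      proof (rule ccontr)
        assume "w \<notin> {v}"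
        then have "card {v, w} = 2" by auto
        moreover have "card {v, w} \<le> (\<Sum>x\<in>{v, w}. lookup k x)"
          using v w sum_mono[of "{v, w}" "\<lambda>_. 1" "lookup k"] by (auto simp: in_keys_iff Suc_le_eq)
        moreover have "(\<Sum>x\<in>{v, w}. lookup k x) \<le> (\<Sum>x\<in>keys k. lookup k x)"
          using v w by (intro sum_mono2) auto
        ultimately show False using k1 by (simp add: mon_degree_def)
      qed
    qed
    ultimately have vA: "v \<in> A - A'" using v by auto
    have "l \<in> Idl\<^bsub>?R\<^esub> L" using l(1) by (simp add: Idl_eq_gen[OF L(1)] gen_base)
    then have "l * ?mon A' \<in> Idl\<^bsub>?R\<^esub> (monomial ` ?G)" by (simp add: col)
    moreover have "sqf_exp A' + k \<in> keys (l * ?mon A')" unfolding kmul using l by auto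
    ultimately obtain g h' where g: "g \<in> ?G" "sqf_exp A' + k = g + h'" unfolding gen_of[OF GS] by blast
    obtain D where D: "?mvc D" "g = sqf_exp D" using is_sqf[of g] g(1) GS by auto
    have Df: "finite D" using mf[OF D(1)] by auto
    have "D \<subseteq> keys (sqf_exp A' + k)" unfolding g(2) D(2) using Df by (simp add: keys_plus_nat)
    then have Dsub: "D \<subseteq> insert v A'" using kv Af by (auto simp: keys_plus_nat)
    have "D \<noteq> A'"
    proof
      assume DA: "D = A'"
      obtain n where n: "n < j" "ms ! n = g" using g(1) ij by (auto simp: in_set_conv_nth)
      have "distinct ms" using dist_us by (simp add: distinct_map)
      moreover have "ms ! n = ms ! j" using n ij D DA by simp
      moreover have "n < length ms" using n ij by simp
      ultimately have "n = j" using ij(2) nth_eq_iff_index_eq by blast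
      then show False using n by simp
    qed
    then show ?thesis using D vA Dsub by blast
  qed
  obtain i where i: "i < length ms" "ms ! i = sqf_exp C" using sqf_in[OF C(1)] by (auto simp: in_set_conv_nth)
  obtain j where j: "j < length ms" "ms ! j = sqf_exp C'" using sqf_in[OF C(2)] by (auto simp: in_set_conv_nth)
  have "i \<noteq> j"
  proof
    assume "i = j"
    then have "sqf_exp C = sqf_exp C'" using i j by simp
    then show False using C(3) keys_sqf_exp mf[OF C(1)] mf[OF C(2)] by metis
  qed
  then consider "i < j" | "j < i" by linarith
  then show ?thesis
  proof cases
    case 1
    then show ?thesis using core[OF C(1,2) 1 j(1) i(2) j(2)] by blast
  next
    case 2
    then show ?thesis using core[OF C(2,1) 2 i(1) j(2) i(2)] by blast
  qed
qed

section \<open>Unmixed uniform admissible clutters of height four\<close>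

lemma block_index: "j \<in> {1..4} \<longleftrightarrow> j = 1 \<or> j = 2 \<or> j = 3 \<or> j = (4::nat)" by auto

locale admissible4 =
  fixes V :: "'v set" and E :: "'v set set" and d :: nat and X e :: "nat \<Rightarrow> 'v set"
  assumes clutter: "clutter V E" and unmixed: "unmixed V E" and uniform: "uniform E"
    and admissible: "admissible_clutter V E d 4 X e"
begin

section \<open>Vertices as entries of a \<open>d\<close> by 4 grid\<close>

abbreviation "x \<equiv> vert X e"

lemma fin: "finite V" using clutter by (simp add: clutter_def)

lemma edge_sub: "A \<in> E \<Longrightarrow> A \<subseteq> V" using clutter by (simp add: clutter_def)

lemma parts: "admissible_partitions V d 4 X e" and e_edge: "j \<in> {1..4} \<Longrightarrow> e j \<in> E"
  and adm_set: "A \<in> E \<Longrightarrow> admissible_set V d 4 X e A"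
  using admissible by (auto simp: admissible_clutter_def)

lemma d1: "1 \<le> d" and partX: "partition_on V (X ` {1..d})" and injX: "inj_on X {1..d}"
  and parte: "partition_on V (e ` {1..4})" and inje: "inj_on e {1..4}"
  and card_le: "j \<in> {1..4} \<Longrightarrow> i \<in> {1..d} \<Longrightarrow> card (e j \<inter> X i) \<le> 1"
  using parts by (auto simp: admissible_partitions_def)

lemma X_disjoint: "i \<in> {1..d} \<Longrightarrow> i' \<in> {1..d} \<Longrightarrow> i \<noteq> i' \<Longrightarrow> X i \<inter> X i' = {}"
  using partition_onD2[OF partX] injX by (metis disjointD imageI inj_onD)

lemma e_disjoint: "j \<in> {1..4} \<Longrightarrow> j' \<in> {1..4} \<Longrightarrow> j \<noteq> j' \<Longrightarrow> e j \<inter> e j' = {}"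
  using partition_onD2[OF parte] inje by (metis disjointD imageI inj_onD)

lemma cover_X: "v \<in> V \<Longrightarrow> \<exists>i\<in>{1..d}. v \<in> X i" and cover_e: "v \<in> V \<Longrightarrow> \<exists>j\<in>{1..4}. v \<in> e j"
  using partition_onD1[OF partX] partition_onD1[OF parte] by auto

lemma X_sub: "i \<in> {1..d} \<Longrightarrow> X i \<subseteq> V" and e_sub: "j \<in> {1..4} \<Longrightarrow> e j \<subseteq> V"
  using partition_onD1[OF partX] partition_onD1[OF parte] by auto

text \<open>All edges have one size \<open>k\<close> and meet exactly the first \<open>k\<close>
  classes. The block through a vertex of the last class puts \<open>d\<close> among them.\<close>

lemma card_edge: assumes A: "A \<in> E" shows "card A = d"
proof -
  obtain k where k: "\<And>A. A \<in> E \<Longrightarrow> card A = k" using uniform by (auto simp: uniform_def)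
  have meets: "{i \<in> {1..d}. A \<inter> X i \<noteq> {}} = {1..k}" if "A \<in> E" for A
    using adm_set[OF that] k[OF that] by (simp add: admissible_set_def)
  have dd: "d \<in> {1..d}" using d1 by simp
  have "X d \<noteq> {}" using partition_onD3[OF partX] dd by (metis imageI)
  then obtain v where v: "v \<in> X d" by auto
  then have "v \<in> V" using X_sub[OF dd] by blast
  from bexE[OF cover_e[OF this]] obtain j where j: "j \<in> {1..4}" "v \<in> e j" .
  have "d \<in> {i \<in> {1..d}. e j \<inter> X i \<noteq> {}}" using v j dd by blast
  then have dk: "d \<in> {1..k}" by (simp only: meets[OF e_edge[OF j(1)]])
  then have "k \<in> {1..k}" by simp
  then have "k \<in> {i \<in> {1..d}. A \<inter> X i \<noteq> {}}" by (simp only: meets[OF A])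
  then have "k = d" using dk by simp
  then show ?thesis using k[OF A] by simp
qed

lemma edge_meets: "A \<in> E \<Longrightarrow> i \<in> {1..d} \<Longrightarrow> A \<inter> X i \<noteq> {}"
  using adm_set[of A] card_edge[of A] by (auto simp: admissible_set_def)

lemma block_point: assumes "j \<in> {1..4}" "i \<in> {1..d}" shows "e j \<inter> X i = {x i j}"
proof -
  have "e j \<inter> X i \<noteq> {}" by (rule edge_meets[OF e_edge[OF assms(1)] assms(2)])
  moreover have "finite (e j \<inter> X i)" using e_sub[OF assms(1)] fin by (meson finite_Int finite_subset)
  ultimately have "card (e j \<inter> X i) = 1" using card_le[OF assms] by (metis One_nat_def card_gt_0_iff le_antisym Suc_leI)
  then obtain y where y: "e j \<inter> X i = {y}" by (auto simp: card_1_singleton_iff)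
  then have "x i j = y" unfolding vert_def by auto
  then show ?thesis using y by simp
qed

lemma x_mem: assumes "j \<in> {1..4}" "i \<in> {1..d}" shows "x i j \<in> e j" "x i j \<in> X i" "x i j \<in> V"
  using block_point[OF assms] e_sub[OF assms(1)] by auto

lemma x_eq:
  assumes "i \<in> {1..d}" "i' \<in> {1..d}" "j \<in> {1..4}" "j' \<in> {1..4}"
  shows "x i j = x i' j' \<longleftrightarrow> i = i' \<and> j = j'"
proof
  assume eq: "x i j = x i' j'"
  have "x i j \<in> X i \<inter> X i'" "x i j \<in> e j \<inter> e j'"
    using x_mem[OF assms(3,1)] x_mem[OF assms(4,2)] eq by auto
  then show "i = i' \<and> j = j'"
    using X_disjoint[OF assms(1,2)] e_disjoint[OF assms(3,4)] by blast
qed simp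

lemma x_rep: assumes "v \<in> e j" "j \<in> {1..4}" shows "\<exists>i\<in>{1..d}. v = x i j"
proof -
  have "v \<in> V" using e_sub[OF assms(2)] assms(1) by blast
  from bexE[OF cover_X[OF this]] obtain i where i: "i \<in> {1..d}" "v \<in> X i" .
  then have "v \<in> e j \<inter> X i" using assms by auto
  then show ?thesis using block_point[OF assms(2) i(1)] i by auto
qed

text \<open>Having \<open>d\<close> vertices, an edge takes one from each class, which makes it the
  graph of a nondecreasing function into the block indices.\<close>

lemma edge_profile:
  assumes A: "A \<in> E"
  shows "\<exists>f. (\<forall>l\<in>{1..d}. f l \<in> {1..4} \<and> x l (f l) \<in> A \<and> A \<inter> X l \<subseteq> {x l (f l)}) \<and>
    (\<forall>l m. 1 \<le> l \<longrightarrow> l \<le> m \<longrightarrow> m \<le> d \<longrightarrow> f l \<le> (f m :: nat))"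
proof -
  obtain f where f: "\<forall>l\<in>{1..d}. f l \<in> {1..4} \<and> A \<inter> X l \<subseteq> e (f l)"
    "\<forall>l m. 1 \<le> l \<and> l \<le> m \<and> m \<le> d \<longrightarrow> f l \<le> f m"
    using adm_set[OF A] card_edge[OF A] unfolding admissible_set_def by auto
  have "f l \<in> {1..4} \<and> x l (f l) \<in> A \<and> A \<inter> X l \<subseteq> {x l (f l)}" if l: "l \<in> {1..d}" for l
  proof -
    have fl: "f l \<in> {1..4}" "A \<inter> X l \<subseteq> e (f l)" using f l by auto
    have "A \<inter> X l \<subseteq> {x l (f l)}" using block_point[OF fl(1) l] fl(2) by auto
    then show ?thesis using fl edge_meets[OF A l] by auto
  qed
  then show ?thesis using f(2) by blast
qed

lemma edge_first_block:
  assumes A: "A \<in> E" and i: "i \<in> {1..d}" "i' \<in> {1..d}" "i \<le> i'" and x: "x i' 1 \<in> A"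
  shows "x i 1 \<in> A"
proof -
  obtain f where f: "\<forall>l\<in>{1..d}. f l \<in> {1..4} \<and> x l (f l) \<in> A \<and> A \<inter> X l \<subseteq> {x l (f l)}"
    "\<forall>l m. 1 \<le> l \<longrightarrow> l \<le> m \<longrightarrow> m \<le> d \<longrightarrow> f l \<le> f m" using edge_profile[OF A] by auto
  have "x i' 1 \<in> A \<inter> X i'" using x x_mem[of 1 i'] i by auto
  then have "x i' 1 = x i' (f i')" using f(1) i by auto
  moreover have fi: "f i' \<in> {1..4}" "f i \<in> {1..4}" using f(1) i by auto
  ultimately have "f i' = 1" using x_eq[of i' i' 1 "f i'"] i by auto
  moreover have "f i \<le> f i'" using f(2) i by auto
  ultimately have "f i = 1" using fi by auto
  then show ?thesis using f(1) i by metis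
qed

lemma edge_last_block:
  assumes A: "A \<in> E" and i: "i \<in> {1..d}" "i' \<in> {1..d}" "i \<le> i'" and x: "x i 4 \<in> A"
  shows "x i' 4 \<in> A"
proof -
  obtain f where f: "\<forall>l\<in>{1..d}. f l \<in> {1..4} \<and> x l (f l) \<in> A \<and> A \<inter> X l \<subseteq> {x l (f l)}"
    "\<forall>l m. 1 \<le> l \<longrightarrow> l \<le> m \<longrightarrow> m \<le> d \<longrightarrow> f l \<le> f m" using edge_profile[OF A] by auto
  have "x i 4 \<in> A \<inter> X i" using x x_mem[of 4 i] i by auto
  then have "x i 4 = x i (f i)" using f(1) i by auto
  moreover have fi: "f i' \<in> {1..4}" "f i \<in> {1..4}" using f(1) i by auto
  ultimately have "f i = 4" using x_eq[of i i 4 "f i"] i by auto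
  moreover have "f i \<le> f i'" using f(2) i by auto
  ultimately have "f i' = 4" using fi by auto
  then show ?thesis using f(1) i by metis
qed

section \<open>Minimal covers as quadruples of superscripts\<close>

fun cset :: "nat \<times> nat \<times> nat \<times> nat \<Rightarrow> 'v set" where
  "cset (a, b, c, q) = {x a 1, x b 2, x c 3, x q 4}"

definition covers :: "(nat \<times> nat \<times> nat \<times> nat) set" where
  "covers = {(a, b, c, q). a \<in> {1..d} \<and> b \<in> {1..d} \<and> c \<in> {1..d} \<and> q \<in> {1..d} \<and>
    vertex_cover V E {x a 1, x b 2, x c 3, x q 4}}"

lemma covers_iff: "(a, b, c, q) \<in> covers \<longleftrightarrow> a \<in> {1..d} \<and> b \<in> {1..d} \<and> c \<in> {1..d} \<and> q \<in> {1..d} \<and>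
    vertex_cover V E {x a 1, x b 2, x c 3, x q 4}"
  by (simp add: covers_def)

lemma card_cset:
  assumes "a \<in> {1..d}" "b \<in> {1..d}" "c \<in> {1..d}" "q \<in> {1..d}"
  shows "card {x a 1, x b 2, x c 3, x q 4} = 4"
  using assms x_eq by simp

lemma cover_transversal:
  assumes "vertex_cover V E C"
  shows "\<exists>a\<in>{1..d}. \<exists>b\<in>{1..d}. \<exists>c\<in>{1..d}. \<exists>q\<in>{1..d}. {x a 1, x b 2, x c 3, x q 4} \<subseteq> C"
proof -
  have "\<exists>i\<in>{1..d}. x i j \<in> C" if j: "j \<in> {1..4}" for j
  proof -
    have "C \<inter> e j \<noteq> {}" using assms e_edge[OF j] by (auto simp: vertex_cover_def)
    then show ?thesis using x_rep[OF _ j] by auto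
  qed
  from this[of 1] this[of 2] this[of 3] this[of 4] show ?thesis by auto
qed

text \<open>The four disjoint edges \<open>e j\<close> give the lower bound. The class
  \<open>X 1\<close> meets every edge and has four vertices, so some minimal cover attains the
  bound, and unmixedness spreads the value.\<close>

lemma mvc_card: assumes "minimal_vertex_cover V E C" shows "card C = 4"
proof -
  have 1: "1 \<in> {1..d}" using d1 by simp
  have finC: "finite C" if "minimal_vertex_cover V E C" for C
    using minimal_vertex_cover_finite[OF fin that] by simp
  have ge: "4 \<le> card C" if C: "minimal_vertex_cover V E C" for C
  proof -
    have "vertex_cover V E C" using C by (simp add: minimal_vertex_cover_def)
    then obtain a b c q where i: "a \<in> {1..d}" "b \<in> {1..d}" "c \<in> {1..d}" "q \<in> {1..d}"
      "{x a 1, x b 2, x c 3, x q 4} \<subseteq> C" using cover_transversal by blast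
    show ?thesis using card_mono[OF finC[OF C] i(5)] card_cset[OF i(1-4)] by simp
  qed
  have "vertex_cover V E (X 1)"
    unfolding vertex_cover_def using X_sub[OF 1] edge_meets[OF _ 1] by auto
  moreover have "finite (X 1)" using X_sub[OF 1] fin by (rule finite_subset)
  ultimately obtain D where D: "D \<subseteq> X 1" "minimal_vertex_cover V E D" using cover_contains_minimal by metis
  have "X 1 \<subseteq> {x 1 1, x 1 2, x 1 3, x 1 4}"
  proof
    fix v assume v: "v \<in> X 1"
    then have "v \<in> V" using X_sub[OF 1] by blast
    from bexE[OF cover_e[OF this]] obtain j where j: "j \<in> {1..4}" "v \<in> e j" .
    then have "v = x 1 j" using block_point[OF j(1) 1] v by auto
    then show "v \<in> {x 1 1, x 1 2, x 1 3, x 1 4}" using j(1)[unfolded block_index] by blast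
  qed
  then have "card D \<le> card {x 1 1, x 1 2, x 1 3, x 1 4}" using D(1) by (intro card_mono) auto
  then have "card D = 4" using ge[OF D(2)] card_cset[OF 1 1 1 1] by simp
  moreover have "card C = card D" by (rule unmixed[unfolded unmixed_def, rule_format, OF assms D(2)])
  ultimately show ?thesis by simp
qed

lemma mvc_iff: "minimal_vertex_cover V E C \<longleftrightarrow> C \<in> cset ` covers"
proof
  assume C: "minimal_vertex_cover V E C"
  then have vc: "vertex_cover V E C" by (simp add: minimal_vertex_cover_def)
  obtain a b c q where i: "a \<in> {1..d}" "b \<in> {1..d}" "c \<in> {1..d}" "q \<in> {1..d}"
      "{x a 1, x b 2, x c 3, x q 4} \<subseteq> C" using cover_transversal[OF vc] by blast
  have "{x a 1, x b 2, x c 3, x q 4} = C"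
    using card_seteq[OF _ i(5)] mvc_card[OF C] card_cset[OF i(1-4)] minimal_vertex_cover_finite[OF fin C] by auto
  then have "(a, b, c, q) \<in> covers" "cset (a, b, c, q) = C" using i vc by (auto simp: covers_iff)
  then show "C \<in> cset ` covers" by (metis imageI)
next
  assume "C \<in> cset ` covers"
  then obtain a b c q where i: "a \<in> {1..d}" "b \<in> {1..d}" "c \<in> {1..d}" "q \<in> {1..d}"
    "C = {x a 1, x b 2, x c 3, x q 4}" "vertex_cover V E C" by (auto simp: covers_def)
  have "finite C" using i by simp
  then obtain D where D: "D \<subseteq> C" "minimal_vertex_cover V E D" using cover_contains_minimal i(6) by metis
  have "card D = card C" using mvc_card[OF D(2)] card_cset[OF i(1-4)] i(5) by simp
  then have "D = C" using card_subset_eq[OF \<open>finite C\<close> D(1)] by simp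
  then show "minimal_vertex_cover V E C" using D by simp
qed

text \<open>An edge that contains a vertex of block 1 contains all earlier ones of that block, so
  lowering \<open>a\<close> loses no edge.\<close>

lemma covers_first: "(a', b, c, q) \<in> covers \<Longrightarrow> a \<in> {1..d} \<Longrightarrow> a \<le> a' \<Longrightarrow> (a, b, c, q) \<in> covers"
  unfolding covers_iff vertex_cover_def
proof (intro conjI ballI)
  assume *: "a' \<in> {1..d} \<and> b \<in> {1..d} \<and> c \<in> {1..d} \<and> q \<in> {1..d} \<and>
    {x a' 1, x b 2, x c 3, x q 4} \<subseteq> V \<and> (\<forall>A\<in>E. {x a' 1, x b 2, x c 3, x q 4} \<inter> A \<noteq> {})"
    "a \<in> {1..d}" "a \<le> a'"
  then show "{x a 1, x b 2, x c 3, x q 4} \<subseteq> V" using x_mem[of 1 a] by auto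
  fix A assume A: "A \<in> E"
  then have "{x a' 1, x b 2, x c 3, x q 4} \<inter> A \<noteq> {}" using * by auto
  moreover have "x a' 1 \<in> A \<longrightarrow> x a 1 \<in> A" using edge_first_block[OF A] * by auto
  ultimately show "{x a 1, x b 2, x c 3, x q 4} \<inter> A \<noteq> {}" by auto
qed auto

lemma covers_last: "(a, b, c, q') \<in> covers \<Longrightarrow> q \<in> {1..d} \<Longrightarrow> q' \<le> q \<Longrightarrow> (a, b, c, q) \<in> covers"
  unfolding covers_iff vertex_cover_def
proof (intro conjI ballI)
  assume *: "a \<in> {1..d} \<and> b \<in> {1..d} \<and> c \<in> {1..d} \<and> q' \<in> {1..d} \<and>
    {x a 1, x b 2, x c 3, x q' 4} \<subseteq> V \<and> (\<forall>A\<in>E. {x a 1, x b 2, x c 3, x q' 4} \<inter> A \<noteq> {})"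
    "q \<in> {1..d}" "q' \<le> q"
  then show "{x a 1, x b 2, x c 3, x q 4} \<subseteq> V" using x_mem[of 4 q] by auto
  fix A assume A: "A \<in> E"
  then have "{x a 1, x b 2, x c 3, x q' 4} \<inter> A \<noteq> {}" using * by auto
  moreover have "x q' 4 \<in> A \<longrightarrow> x q 4 \<in> A" using edge_last_block[OF A] * by auto
  ultimately show "{x a 1, x b 2, x c 3, x q 4} \<inter> A \<noteq> {}" by auto
qed auto

section \<open>Ferrers diagrams and the shelling order\<close>

definition thirds :: "nat \<Rightarrow> nat \<Rightarrow> nat \<Rightarrow> nat set" where
  "thirds a q b = {c. (a, b, c, q) \<in> covers}"

lemma thirds_sub: "thirds a q b \<subseteq> {1..d}" by (auto simp: thirds_def covers_iff)

lemma bad_iff: "has_bad_vertex_cover_pair V E d X e \<longleftrightarrow>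
  (\<exists>a b c q s t. (a, b, c, q) \<in> covers \<and> (a, s, t, q) \<in> covers \<and> (a, b, t, q) \<notin> covers \<and> (a, s, c, q) \<notin> covers)"
  unfolding has_bad_vertex_cover_pair_def covers_iff by blast

text \<open>For fixed \<open>a\<close> and \<open>q\<close>, two incomparable rows are a bad pair:
  each has an element that the other lacks.\<close>

lemma nested:
  assumes "\<not> has_bad_vertex_cover_pair V E d X e"
  shows "thirds a q b \<subseteq> thirds a q b' \<or> thirds a q b' \<subseteq> thirds a q b"
proof (rule ccontr)
  assume "\<not> ?thesis"
  then obtain c t where "(a, b, c, q) \<in> covers" "(a, b', c, q) \<notin> covers" "(a, b', t, q) \<in> covers" "(a, b, t, q) \<notin> covers"
    by (auto simp: thirds_def)
  then show False using assms unfolding bad_iff by blast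
qed

text \<open>Subtraction from \<open>d\<close> reverses the order in the second and the third component.\<close>

fun key :: "nat \<times> nat \<times> nat \<times> nat \<Rightarrow> nat \<times> nat \<times> nat \<times> nat" where
  "key (a, b, c, q) = (a, d - q, d - card (thirds a q b), b)"

text \<open>In the first of the positions \<open>a\<close>, \<open>q\<close>, \<open>b\<close>,
  \<open>c\<close> where \<open>t'\<close> differs from \<open>t\<close>, replace its entry by that
  of \<open>t\<close>. Monotonicity or nestedness keeps it a cover. The first three changes lower
  the key; in the last case the result is \<open>t\<close> itself, as the key ignores
  \<open>c\<close>.\<close>

lemma exchange:
  assumes nb: "\<not> has_bad_vertex_cover_pair V E d X e"
    and t: "t \<in> covers" "t' \<in> covers" "t \<noteq> t'" "key t \<le> key t'"
  shows "\<exists>u\<in>covers. (u = t \<or> key u < key t') \<and> (\<exists>v\<in>cset t. cset u - cset t' = {v})"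
proof -
  obtain a b c q a' b' c' q' where eq: "t = (a, b, c, q)" "t' = (a', b', c', q')" by (metis prod_cases4)
  have r: "a \<in> {1..d}" "b \<in> {1..d}" "c \<in> {1..d}" "q \<in> {1..d}"
    "a' \<in> {1..d}" "b' \<in> {1..d}" "c' \<in> {1..d}" "q' \<in> {1..d}" using t by (auto simp: eq covers_iff)
  have n1: "x i 1 \<notin> {x a' 1, x b' 2, x c' 3, x q' 4}" if "i \<noteq> a'" "i \<in> {1..d}" for i
    using that r by (simp add: x_eq)
  have n2: "x i 2 \<notin> {x a' 1, x b' 2, x c' 3, x q' 4}" if "i \<noteq> b'" "i \<in> {1..d}" for i
    using that r by (simp add: x_eq)
  have n3: "x i 3 \<notin> {x a' 1, x b' 2, x c' 3, x q' 4}" if "i \<noteq> c'" "i \<in> {1..d}" for i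
    using that r by (simp add: x_eq)
  have n4: "x i 4 \<notin> {x a' 1, x b' 2, x c' 3, x q' 4}" if "i \<noteq> q'" "i \<in> {1..d}" for i
    using that r by (simp add: x_eq)
  have k: "(a, d - q, d - card (thirds a q b), b) \<le> (a', d - q', d - card (thirds a' q' b'), b')"
    using t(4) by (simp add: eq)
  consider "a < a'" | "a = a'" "q' < q" | "a = a'" "q = q'" "b \<noteq> b'" | "a = a'" "q = q'" "b = b'"
  proof -
    have "a \<le> a'" using k by (auto simp: less_eq_prod_def)
    moreover have "q' \<le> q" if "a = a'"
    proof -
      have "d - q \<le> d - q'" using k that by (auto simp: less_eq_prod_def)
      then show ?thesis using r by auto
    qed
    ultimately show ?thesis using that by linarith
  qed
  then show ?thesis
  proof cases
    case 1
    let ?u = "(a, b', c', q')"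
    have "?u \<in> covers" using covers_first[of a' b' c' q' a] t(2) r 1 by (simp add: eq)
    moreover have "key ?u < key t'" using 1 by (simp add: eq)
    moreover have "cset ?u - cset t' = {x a 1}" using n1[of a] 1 r by (auto simp: eq)
    moreover have "x a 1 \<in> cset t" by (simp add: eq)
    ultimately show ?thesis by blast
  next
    case 2
    let ?u = "(a', b', c', q)"
    have "?u \<in> covers" using covers_last[of a' b' c' q' q] t(2) r 2 by (simp add: eq)
    moreover have "key ?u < key t'" using 2 r by (simp add: eq) linarith
    moreover have "cset ?u - cset t' = {x q 4}" using n4[of q] 2 r by (auto simp: eq)
    moreover have "x q 4 \<in> cset t" by (simp add: eq)
    ultimately show ?thesis by blast
  next
    case 3
    let ?u = "(a', b, c', q')"
    have le: "card (thirds a q b'') \<le> d" for b'' using card_mono[OF _ thirds_sub, of a q b''] by simp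
    have fS: "finite (thirds a q b'')" for b'' by (rule finite_subset[OF thirds_sub]) simp
    have k3: "(d - card (thirds a q b), b) \<le> (d - card (thirds a q b'), b')" using k 3 by simp
    \<comment> \<open>The bound \<open>le\<close> keeps the subtractions from truncating, so
      comparing keys compares the lengths of the rows.\<close>
    then have ge: "card (thirds a q b') \<le> card (thirds a q b)" using le[of b] le[of b'] by (auto simp: less_eq_prod_def)
    have "thirds a q b' \<subseteq> thirds a q b"
      using nested[OF nb, of a q b b']
    proof
      assume "thirds a q b \<subseteq> thirds a q b'"
      then show ?thesis using card_seteq[OF fS _ ge] by simp
    qed
    then have "?u \<in> covers" using t(2) 3 by (auto simp: eq thirds_def)
    moreover have "key ?u < key t'" using k3 3 by (auto simp: eq less_eq_prod_def)
    moreover have "cset ?u - cset t' = {x b 2}" using n2[of b] 3 r by (auto simp: eq)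
    moreover have "x b 2 \<in> cset t" by (simp add: eq)
    ultimately show ?thesis by blast
  next
    case 4
    then have "c \<noteq> c'" using t(3) by (simp add: eq)
    then have "cset t - cset t' = {x c 3}" using n3[of c] 4 r by (auto simp: eq)
    moreover have "x c 3 \<in> cset t" by (simp add: eq)
    ultimately show ?thesis using t(1) by blast
  qed
qed

lemma cset_inj: "inj_on cset covers"
proof (rule inj_onI)
  fix t t' assume t: "t \<in> covers" "t' \<in> covers" "cset t = cset t'"
  obtain a b c q a' b' c' q' where eq: "t = (a, b, c, q)" "t' = (a', b', c', q')" by (metis prod_cases4)
  have r: "a \<in> {1..d}" "b \<in> {1..d}" "c \<in> {1..d}" "q \<in> {1..d}"
    "a' \<in> {1..d}" "b' \<in> {1..d}" "c' \<in> {1..d}" "q' \<in> {1..d}" using t by (auto simp: eq covers_iff)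
  have "x a 1 \<in> cset t'" "x b 2 \<in> cset t'" "x c 3 \<in> cset t'" "x q 4 \<in> cset t'"
    unfolding t(3)[symmetric] by (simp_all add: eq)
  then show "t = t'" using r by (simp add: eq x_eq)
qed

lemma shelling_exists:
  assumes nb: "\<not> has_bad_vertex_cover_pair V E d X e"
  shows "\<exists>Cs. set Cs = {C. minimal_vertex_cover V E C} \<and> distinct Cs \<and> shelling Cs"
proof -
  have "covers \<subseteq> {1..d} \<times> {1..d} \<times> {1..d} \<times> {1..d}" by (auto simp: covers_iff)
  then have "finite covers" by (rule finite_subset) simp
  then obtain ts0 where ts0: "set ts0 = covers" "distinct ts0" using finite_distinct_list by auto
  define ts where "ts = sort_key key ts0"
  have ts: "set ts = covers" "distinct ts" "sorted (map key ts)" using ts0 by (simp_all add: ts_def)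
  have "shelling (map cset ts)"
    unfolding shelling_def
  proof (intro allI impI)
    fix j i assume j: "j < length (map cset ts)" and i: "i < j"
    have le: "key (ts ! i) \<le> key (ts ! j)" using sorted_nth_mono[OF ts(3), of i j] i j by simp
    have ne: "ts ! i \<noteq> ts ! j" using ts(2) i j by (simp add: nth_eq_iff_index_eq)
    have mem: "ts ! i \<in> covers" "ts ! j \<in> covers" using ts(1) i j nth_mem[of i ts] nth_mem[of j ts] by auto
    from exchange[OF nb mem ne le]
    obtain u v where u: "u \<in> covers" "u = ts ! i \<or> key u < key (ts ! j)" "v \<in> cset (ts ! i)"
      "cset u - cset (ts ! j) = {v}" by (elim bexE conjE)
    \<comment> \<open>\<open>key\<close> is not injective, so sorting does not locate elements of
      equal key. An earlier position follows from a strict inequality or from \<open>u\<close> being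
      \<open>ts ! i\<close>.\<close>
    have "\<exists>k<j. ts ! k = u"
      using u(2)
    proof
      assume "u = ts ! i" then show ?thesis using i by auto
    next
      assume less: "key u < key (ts ! j)"
      have "\<exists>k<length ts. ts ! k = u" using u(1) unfolding ts(1)[symmetric] in_set_conv_nth .
      then obtain k where k: "k < length ts" "ts ! k = u" by blast
      have "k < j"
      proof (rule ccontr)
        assume "\<not> k < j"
        then have "key (ts ! j) \<le> key (ts ! k)" using sorted_nth_mono[OF ts(3), of j k] j k by simp
        then show False using less k by simp
      qed
      then show ?thesis using k by auto
    qed
    then obtain k where "k < j" "ts ! k = u" by auto
    then show "\<exists>k<j. \<exists>v\<in>map cset ts ! i. map cset ts ! k - map cset ts ! j = {v}"
      using u i j by (intro exI[of _ k]) auto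
  qed
  moreover have "set (map cset ts) = {C. minimal_vertex_cover V E C}" using ts(1) mvc_iff by auto
  moreover have "distinct (map cset ts)" using ts cset_inj by (simp add: distinct_map)
  ultimately show ?thesis by blast
qed

section \<open>Transversality of the blocks and the Cohen-Macaulay property\<close>

definition \<tau> :: "'v \<Rightarrow> 'v" where
  "\<tau> v = x d (THE j. j \<in> {1..4} \<and> v \<in> e j)"

lemma tau_x: assumes "i \<in> {1..d}" "j \<in> {1..4}" shows "\<tau> (x i j) = x d j"
proof -
  have "(THE j'. j' \<in> {1..4} \<and> x i j \<in> e j') = j"
  proof (rule the_equality)
    show "j \<in> {1..4} \<and> x i j \<in> e j" using x_mem[OF assms(2,1)] assms by simp
    show "j' = j" if "j' \<in> {1..4} \<and> x i j \<in> e j'" for j'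
      using x_mem[OF assms(2,1)] e_disjoint[of j' j] that assms by auto
  qed
  then show ?thesis by (simp add: \<tau>_def)
qed

lemma V_rep: assumes "v \<in> V" obtains i j where "i \<in> {1..d}" "j \<in> {1..4}" "v = x i j"
  using cover_e[OF assms] x_rep by metis

lemma cohen_macaulay:
  assumes nb: "\<not> has_bad_vertex_cover_pair V E d X e"
  shows "cohen_macaulay_clutter (K :: 'k::field itself) V E"
proof -
  obtain Cs where Cs: "set Cs = {C. minimal_vertex_cover V E C}" "shelling Cs"
    using shelling_exists[OF nb] by auto
  have dd: "d \<in> {1..d}" using d1 by simp
  have tauV: "\<tau> ` V = {x d 1, x d 2, x d 3, x d 4}"
  proof
    show "\<tau> ` V \<subseteq> {x d 1, x d 2, x d 3, x d 4}"
    proof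
      fix y assume "y \<in> \<tau> ` V"
      then obtain v where v: "v \<in> V" "y = \<tau> v" by blast
      obtain i j where ij: "i \<in> {1..d}" "j \<in> {1..4}" "v = x i j" using V_rep[OF v(1)] .
      then have "y = x d j" using tau_x v(2) by simp
      then show "y \<in> {x d 1, x d 2, x d 3, x d 4}" using ij(2)[unfolded block_index] by blast
    qed
    have "x d j \<in> \<tau> ` V" if "j \<in> {1..4}" for j
      using tau_x[OF dd that] x_mem(3)[OF that dd] by (metis imageI)
    then show "{x d 1, x d 2, x d 3, x d 4} \<subseteq> \<tau> ` V" by simp
  qed
  have rep: "\<exists>a\<in>{1..d}. \<exists>b\<in>{1..d}. \<exists>c\<in>{1..d}. \<exists>q\<in>{1..d}. C = {x a 1, x b 2, x c 3, x q 4}"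
    if "C \<in> set Cs" for C
  proof -
    from that have "C \<in> cset ` covers" unfolding Cs(1) mvc_iff mem_Collect_eq .
    then obtain u where u: "u \<in> covers" "C = cset u" by blast
    obtain a b c q where "u = (a, b, c, q)" by (metis prod_cases4)
    then have "(a, b, c, q) \<in> covers" "C = {x a 1, x b 2, x c 3, x q 4}" using u by simp_all
    then show ?thesis unfolding covers_iff by blast
  qed
  show ?thesis
  proof (rule cohen_macaulay_of_shelling[where \<tau> = \<tau>, OF fin edge_sub Cs(2)])
    show "vertex_cover V E C" if "C \<in> set Cs" for C
      using that Cs(1) by (simp add: minimal_vertex_cover_def)
    show "\<exists>C'\<in>set Cs. C' \<subseteq> C" if "vertex_cover V E C" for C
    proof -
      have "finite C" using that fin by (auto simp: vertex_cover_def intro: finite_subset)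
      then show ?thesis using cover_contains_minimal[OF _ that] Cs(1) by auto
    qed
    show "\<tau> v \<in> V" "\<tau> (\<tau> v) = \<tau> v" if v: "v \<in> V" for v
    proof -
      obtain i j where "i \<in> {1..d}" "j \<in> {1..4}" "v = x i j" using V_rep[OF v] .
      then show "\<tau> v \<in> V" "\<tau> (\<tau> v) = \<tau> v" using tau_x dd x_mem(3) by simp_all
    qed
    show "inj_on \<tau> C" if C: "C \<in> set Cs" for C
    proof -
      obtain a b c q where r: "a \<in> {1..d}" "b \<in> {1..d}" "c \<in> {1..d}" "q \<in> {1..d}"
        "C = {x a 1, x b 2, x c 3, x q 4}" using rep[OF C] by blast
      then show ?thesis using dd by (simp add: tau_x x_eq)
    qed
    show "\<tau> ` C = \<tau> ` V" if C: "C \<in> set Cs" for C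
    proof -
      obtain a b c q where r: "a \<in> {1..d}" "b \<in> {1..d}" "c \<in> {1..d}" "q \<in> {1..d}"
        "C = {x a 1, x b 2, x c 3, x q 4}" using rep[OF C] by blast
      then show ?thesis unfolding tauV by (simp add: tau_x)
    qed
  qed
qed

text \<open>A minimal cover has one vertex in each block, so adding \<open>v\<close> allows a change
  only in the block of \<open>v\<close>. In blocks 1 and 4 the vertex \<open>v\<close> is already
  present; blocks 2 and 3 give the two mixed quadruples.\<close>

lemma exchange_forces:
  assumes D: "minimal_vertex_cover V E D" "D \<noteq> {x a 1, x b 2, x c 3, x q 4}"
    and r: "a \<in> {1..d}" "b \<in> {1..d}" "c \<in> {1..d}" "q \<in> {1..d}" "s \<in> {1..d}" "t \<in> {1..d}"
    and v: "v \<in> {x a 1, x s 2, x t 3, x q 4}" "D \<subseteq> insert v {x a 1, x b 2, x c 3, x q 4}"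
  shows "(a, s, c, q) \<in> covers \<or> (a, b, t, q) \<in> covers"
proof -
  obtain a' b' c' q' where covers: "(a', b', c', q') \<in> covers" and D': "D = {x a' 1, x b' 2, x c' 3, x q' 4}"
    using D(1) unfolding mvc_iff by (auto simp: covers_def)
  have r': "a' \<in> {1..d}" "b' \<in> {1..d}" "c' \<in> {1..d}" "q' \<in> {1..d}" using covers by (auto simp: covers_iff)
  from v(1) consider "v = x a 1 \<or> v = x q 4" | "v = x s 2" | "v = x t 3" by auto
  then show ?thesis
  proof cases
    case 1
    then have "a' = a" "b' = b" "c' = c" "q' = q" using v(2) r r' unfolding D' by (auto simp: x_eq)
    then show ?thesis using D D' by simp
  next
    case 2
    then have "a' = a" "b' = b \<or> b' = s" "c' = c" "q' = q" using v(2) r r' unfolding D' by (auto simp: x_eq)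
    then show ?thesis using D D' covers by auto
  next
    case 3
    then have "a' = a" "b' = b" "c' = c \<or> c' = t" "q' = q" using v(2) r r' unfolding D' by (auto simp: x_eq)
    then show ?thesis using D D' covers by auto
  qed
qed

lemma no_bad_pair:
  assumes lq: "has_linear_quotients (mpoly_ring (K :: 'k::field itself) V) (alexander_dual K V E)"
  shows "\<not> has_bad_vertex_cover_pair V E d X e"
proof
  assume "has_bad_vertex_cover_pair V E d X e"
  then obtain a b c q s t where bad: "(a, b, c, q) \<in> covers" "(a, s, t, q) \<in> covers" "(a, b, t, q) \<notin> covers" "(a, s, c, q) \<notin> covers"
    unfolding bad_iff by auto
  have r: "a \<in> {1..d}" "b \<in> {1..d}" "c \<in> {1..d}" "q \<in> {1..d}" "s \<in> {1..d}" "t \<in> {1..d}"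
    using bad(1,2) by (auto simp: covers_iff)
  let ?C = "{x a 1, x b 2, x c 3, x q 4}" and ?C' = "{x a 1, x s 2, x t 3, x q 4}"
  have mvc: "minimal_vertex_cover V E ?C" "minimal_vertex_cover V E ?C'"
    using imageI[OF bad(1), of cset] imageI[OF bad(2), of cset] unfolding mvc_iff by simp_all
  have "?C \<noteq> ?C'"
  proof
    assume "?C = ?C'"
    then have "cset (a, b, c, q) = cset (a, s, t, q)" by simp
    from inj_onD[OF cset_inj this bad(1,2)] have "(a, b, c, q) = (a, s, t, q)" .
    then show False using bad by simp
  qed
  from linear_quotients_exchange[OF fin lq mvc this] show False
  proof (elim disjE exE conjE)
    fix D v assume "minimal_vertex_cover V E D" "v \<in> ?C - ?C'" "D \<noteq> ?C'" "D \<subseteq> insert v ?C'"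
    then show False using exchange_forces[of D a s t q b c v] r bad by auto
  next
    fix D v assume "minimal_vertex_cover V E D" "v \<in> ?C' - ?C" "D \<noteq> ?C" "D \<subseteq> insert v ?C"
    then show False using exchange_forces[of D a b c q s t v] r bad by auto
  qed
qed

lemma linear_quotients_iff:
  "has_linear_quotients (mpoly_ring (K :: 'k::field itself) V) (alexander_dual K V E)
    \<longleftrightarrow> \<not> has_bad_vertex_cover_pair V E d X e"
proof
  assume "\<not> has_bad_vertex_cover_pair V E d X e"
  from shelling_exists[OF this] obtain Cs where
    "set Cs = {C. minimal_vertex_cover V E C}" "distinct Cs" "shelling Cs" by auto
  then show "has_linear_quotients (mpoly_ring K V) (alexander_dual K V E)"
    using mvc_card by (intro linear_quotients_of_shelling[OF fin]) auto
qed (rule no_bad_pair)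

end

theorem theorem5p3:
  fixes V :: "'v set" and E :: "'v set set"
    and d :: nat and X e :: "nat \<Rightarrow> 'v set"
  assumes "clutter V E"
    and "unmixed V E"
    and "uniform E"
    and "ideal_height (mpoly_ring TYPE('k::field) V) (edge_ideal TYPE('k) V E) = 4"
    and "admissible_clutter V E d 4 X e"
  shows "(has_linear_quotients (mpoly_ring TYPE('k) V) (alexander_dual TYPE('k) V E)
            \<longleftrightarrow> \<not> has_bad_vertex_cover_pair V E d X e)
         \<and> (\<not> has_bad_vertex_cover_pair V E d X e \<longrightarrow> cohen_macaulay_clutter TYPE('k) V E)"
proof -
  interpret admissible4 V E d X e
    using assms(1,2,3,5) by unfold_locales
  show ?thesis using linear_quotients_iff cohen_macaulay by blast
qed

end
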